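(* Let $\Sigma$ be a Polish space, $k\ge1$ a fixed integer, and let $((x_i^n)_{1\le i\le n})_n$ be a triangular array of elements of $\Sigma$ such that $$\frac1n\sum_{i=1}^n\delta_{(x_i^n,\ldots,x_{i+k-1}^n)}\to\mu^{(k)}\in M_1(\Sigma^k)\quad\text{weakly},$$ the indices being taken modulo $n$. Let $m=n/k$ and let $(W_1^n,\dots,W_n^n)$ be random variables such that $$\frac1k(W_1^n,\dots,W_n^n)\sim\mathrm{Mult}_n\big(m,(1/n,\dots,1/n)\big).$$ Then the sequence of (moving or circular) $k$-blocks bootstrapped empirical measures $$\widetilde{\mathcal{L}}_n=\frac1n\sum_{i=1}^nW_i^n\,\frac1k\sum_{j\sim i}\delta_{x_j^n}$$ satisfies an LDP on $M_1(\Sigma)$ endowed with the weak convergence topology with good rate function $$\widetilde{\mathcal{K}}(\nu;\mu^{(k)})=\inf\left\{\frac1kH(\nu^{(k)}|\mu^{(k)}):\ \nu^{(k)}\in M_1(\Sigma^k),\ \frac1k\sum_{i=1}^k\nu_i^{(k)}=\nu\right\}.$$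
   Context: $j\sim i$ means that $j$ belongs to block $i$, where block $i$ is the set of $k$ consecutive indices $\{i-s,\,i-s+1,\dots,i-s+k-1\}$ taken modulo $n$, with $s=0$ for the circular $k$-blocks bootstrap and $s=\lfloor k/2\rfloor$ for the moving $k$-blocks bootstrap. Here $n$ ranges over multiples of $k$, so that $m=n/k$ is an integer. $\mathrm{Mult}_n(m,(1/n,\dots,1/n))$ is the law of the occupation numbers of $n$ urns when $m$ balls are thrown independently and uniformly into the urns. $M_1(E)$ is the set of Borel probability measures on $E$; $\nu_i^{(k)}\in M_1(\Sigma)$ is the $i$-th marginal of $\nu^{(k)}\in M_1(\Sigma^k)$. $H(\nu|\rho)=\int\log\frac{d\nu}{d\rho}d\nu$ if $\nu\ll\rho$, $+\infty$ otherwise. LDP: a sequence of Borel probability measures $(P^n)$ on a topological space satisfies an LDP with rate function $I$ if $I$ is nonnegative, lower semicontinuous and, for every measurable $A$, $-\inf_{A^o}I\le\liminf_n\frac1n\log P^n(A)\le\limsup_n\frac1n\log P^n(A)\le-\inf_{\bar A}I$; $I$ is good if its level sets are compact. A sequence of random variables satisfies an LDP if their laws do. *)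

theory Defs
  imports "HOL-Probability.Probability"
begin

section \<open>Borel probability measures and the weak topology\<close>

definition borel_of :: "'a topology \<Rightarrow> 'a measure" where
  "borel_of X = sigma (topspace X) {U. openin X U}"

definition borel_probs :: "'a topology \<Rightarrow> 'a measure set" where
  "borel_probs X = {\<mu>. sets \<mu> = sets (borel_of X) \<and> prob_space \<mu>}"

text \<open>The coarsest topology on the Borel probability measures that makes the integrals of all
  bounded continuous functions continuous.\<close>
definition weak_topology :: "'a topology \<Rightarrow> 'a measure topology" where
  "weak_topology X = topology_generated_by
     {{\<mu> \<in> borel_probs X. (\<integral>x. f x \<partial>\<mu>) \<in> U} | f U.
        continuous_map X euclideanreal f \<and> bounded (f ` topspace X) \<and> open U}"

text \<open>The space of \<open>k\<close>-tuples; the entries of a tuple are indexed by \<open>0, \<dots>, k - 1\<close>.\<close>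
definition power_topology :: "nat \<Rightarrow> 'a topology \<Rightarrow> (nat \<Rightarrow> 'a) topology" where
  "power_topology k X = product_topology (\<lambda>_. X) {..<k}"

text \<open>The finite linear combination of the Borel measures \<open>\<mu> i\<close> on \<open>X\<close> with nonnegative
  weights \<open>w i\<close>, where \<open>i\<close> ranges over \<open>I\<close>.\<close>
definition lin_comb :: "'a topology \<Rightarrow> 'i set \<Rightarrow> ('i \<Rightarrow> real) \<Rightarrow> ('i \<Rightarrow> 'a measure) \<Rightarrow> 'a measure" where
  "lin_comb X I w \<mu> = measure_of (topspace X) (sets (borel_of X))
     (\<lambda>A. \<Sum>i\<in>I. ennreal (w i) * emeasure (\<mu> i) A)"

abbreviation dirac :: "'a topology \<Rightarrow> 'a \<Rightarrow> 'a measure" where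
  "dirac X \<equiv> return (borel_of X)"

definition marginal :: "'a topology \<Rightarrow> nat \<Rightarrow> (nat \<Rightarrow> 'a) measure \<Rightarrow> 'a measure" where
  "marginal X i \<nu> = distr \<nu> (borel_of X) (\<lambda>z. z i)"


section \<open>Large deviations\<close>

definition rate_function :: "'e topology \<Rightarrow> ('e \<Rightarrow> ereal) \<Rightarrow> bool" where
  "rate_function T I \<longleftrightarrow>
     (\<forall>x\<in>topspace T. 0 \<le> I x) \<and>
     (\<forall>x\<in>topspace T. \<forall>c<I x. \<exists>U. openin T U \<and> x \<in> U \<and> (\<forall>y\<in>U. c < I y))"

definition good_rate_function :: "'e topology \<Rightarrow> ('e \<Rightarrow> ereal) \<Rightarrow> bool" where
  "good_rate_function T I \<longleftrightarrow>
     rate_function T I \<and> (\<forall>c::real. compactin T {x \<in> topspace T. I x \<le> ereal c})"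

definition log_prob :: "real \<Rightarrow> ereal" where
  "log_prob p = (if p = 0 then -\<infinity> else ereal (ln p))"

text \<open>The filter \<open>F\<close> says how \<open>n\<close> tends to infinity; this allows \<open>n\<close> to
  run through a subsequence while the speed remains \<open>n\<close>.\<close>
definition satisfies_LDP ::
  "nat filter \<Rightarrow> 'e topology \<Rightarrow> (nat \<Rightarrow> 'e measure) \<Rightarrow> ('e \<Rightarrow> ereal) \<Rightarrow> bool" where
  "satisfies_LDP F T P I \<longleftrightarrow>
     (\<forall>\<^sub>F n in F. P n \<in> borel_probs T) \<and>
     rate_function T I \<and>
     (\<forall>A\<in>sets (borel_of T).
        - (INF x\<in>T interior_of A. I x)
          \<le> Liminf F (\<lambda>n. ereal (1 / real n) * log_prob (measure (P n) A)) \<and>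
        Liminf F (\<lambda>n. ereal (1 / real n) * log_prob (measure (P n) A))
          \<le> Limsup F (\<lambda>n. ereal (1 / real n) * log_prob (measure (P n) A)) \<and>
        Limsup F (\<lambda>n. ereal (1 / real n) * log_prob (measure (P n) A))
          \<le> - (INF x\<in>T closure_of A. I x))"

definition multiples :: "nat \<Rightarrow> nat filter" where
  "multiples k = inf at_top (principal {n. k dvd n})"


section \<open>Relative entropy\<close>

text \<open>The Bochner integral and hence \<open>KL_divergence\<close> are \<open>0\<close> for a function that
  is not integrable. The logarithm of the density may have an infinite integral, so positive and
  negative part are integrated separately.\<close>
definition extended_integral :: "'a measure \<Rightarrow> ('a \<Rightarrow> real) \<Rightarrow> ereal" where
  "extended_integral M f =
     enn2ereal (\<integral>\<^sup>+x. ennreal (f x) \<partial>M) - enn2ereal (\<integral>\<^sup>+x. ennreal (- f x) \<partial>M)"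

definition rel_entropy :: "'a measure \<Rightarrow> 'a measure \<Rightarrow> ereal" where
  "rel_entropy \<nu> \<rho> =
     (if absolutely_continuous \<rho> \<nu>
      then extended_integral \<nu> (\<lambda>x. ln (enn2real (RN_deriv \<rho> \<nu> x)))
      else \<infinity>)"


section \<open>The block bootstrap\<close>

text \<open>The representative of \<open>z\<close> modulo \<open>n\<close> in \<open>{1..n}\<close>.\<close>
definition index_mod :: "nat \<Rightarrow> int \<Rightarrow> nat" where
  "index_mod n z = nat ((z - 1) mod int n) + 1"

definition block :: "nat \<Rightarrow> nat \<Rightarrow> nat \<Rightarrow> nat \<Rightarrow> nat set" where
  "block n k s i = (\<lambda>r. index_mod n (int i - int s + int r)) ` {..<k}"

text \<open>The law, on real vectors indexed by \<open>{1..n}\<close>, of the occupation numbers of \<open>n\<close> urns when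
  \<open>m\<close> balls are thrown independently; a ball falls into urn \<open>i\<close> with probability \<open>p i\<close>.\<close>
definition Mult :: "nat \<Rightarrow> nat \<Rightarrow> (nat \<Rightarrow> real) \<Rightarrow> (nat \<Rightarrow> real) measure" where
  "Mult n m p =
     distr (Pi\<^sub>M {..<m} (\<lambda>_. point_measure {1..n} (\<lambda>i. ennreal (p i))))
       (Pi\<^sub>M {1..n} (\<lambda>_. borel))
       (\<lambda>b. \<lambda>i\<in>{1..n}. real (card {l \<in> {..<m}. b l = i}))"

definition tuple_empirical ::
  "'a topology \<Rightarrow> nat \<Rightarrow> nat \<Rightarrow> (nat \<Rightarrow> 'a) \<Rightarrow> (nat \<Rightarrow> 'a) measure" where
  "tuple_empirical X k n x =
     lin_comb (power_topology k X) {1..n} (\<lambda>_. 1 / real n)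
       (\<lambda>i. dirac (power_topology k X) (\<lambda>r\<in>{..<k}. x (index_mod n (int i + int r))))"

definition block_bootstrap ::
  "'a topology \<Rightarrow> nat \<Rightarrow> nat \<Rightarrow> nat \<Rightarrow> (nat \<Rightarrow> 'a) \<Rightarrow> (nat \<Rightarrow> real) \<Rightarrow> 'a measure" where
  "block_bootstrap X k s n x w =
     lin_comb X {1..n} (\<lambda>i. 1 / real n * w i)
       (\<lambda>i. lin_comb X (block n k s i) (\<lambda>_. 1 / real k) (\<lambda>j. dirac X (x j)))"

definition bootstrap_rate ::
  "'a topology \<Rightarrow> nat \<Rightarrow> (nat \<Rightarrow> 'a) measure \<Rightarrow> 'a measure \<Rightarrow> ereal" where
  "bootstrap_rate X k \<mu> \<nu> =
     Inf {ereal (1 / real k) * rel_entropy \<nu>k \<mu> | \<nu>k.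
       \<nu>k \<in> borel_probs (power_topology k X) \<and>
       lin_comb X {..<k} (\<lambda>_. 1 / real k) (\<lambda>i. marginal X i \<nu>k) = \<nu>}"


section \<open>Basic facts\<close>

lemma space_borel_of [simp]: "space (borel_of X) = topspace X"
  by (simp add: borel_of_def space_measure_of_conv)

lemma borel_of_euclidean: "borel_of euclidean = borel"
  by (simp add: borel_of_def borel_def)

lemma topspace_weak_topology: "topspace (weak_topology X) = borel_probs X"
proof -
  have "borel_probs X \<in> {{\<mu> \<in> borel_probs X. (\<integral>x. f x \<partial>\<mu>) \<in> U} | f U.
        continuous_map X euclideanreal f \<and> bounded (f ` topspace X) \<and> open U}"
    by (intro CollectI exI[of _ "\<lambda>_. 0"] exI[of _ UNIV]) (auto simp: image_constant_conv)
  then show ?thesis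
    unfolding weak_topology_def topology_generated_by_topspace by blast
qed

lemma space_lin_comb [simp]: "space (lin_comb X I w \<mu>) = topspace X"
  by (simp add: lin_comb_def space_measure_of_conv)

lemma sets_lin_comb [simp]: "sets (lin_comb X I w \<mu>) = sets (borel_of X)"
  using sets.sigma_sets_eq[of "borel_of X"] sets.space_closed[of "borel_of X"]
  by (simp add: lin_comb_def)

lemma emeasure_lin_comb:
  assumes "\<And>i. i \<in> I \<Longrightarrow> sets (\<mu> i) = sets (borel_of X)" and "A \<in> sets (borel_of X)"
  shows "emeasure (lin_comb X I w \<mu>) A = (\<Sum>i\<in>I. ennreal (w i) * emeasure (\<mu> i) A)"
proof (rule emeasure_measure_of[OF lin_comb_def])
  show "sets (borel_of X) \<subseteq> Pow (topspace X)"
    using sets.space_closed[of "borel_of X"] by simp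
  show "positive (sets (lin_comb X I w \<mu>)) (\<lambda>A. \<Sum>i\<in>I. ennreal (w i) * emeasure (\<mu> i) A)"
    by (simp add: positive_def)
  show "countably_additive (sets (lin_comb X I w \<mu>))
          (\<lambda>A. \<Sum>i\<in>I. ennreal (w i) * emeasure (\<mu> i) A)"
  proof (rule countably_additiveI)
    fix B :: "nat \<Rightarrow> _"
    assume B: "range B \<subseteq> sets (lin_comb X I w \<mu>)" "disjoint_family B"
    have "(\<Sum>n. \<Sum>i\<in>I. ennreal (w i) * emeasure (\<mu> i) (B n))
        = (\<Sum>i\<in>I. \<Sum>n. ennreal (w i) * emeasure (\<mu> i) (B n))"
      by (rule suminf_sum) simp
    also have "\<dots> = (\<Sum>i\<in>I. ennreal (w i) * emeasure (\<mu> i) (\<Union> (range B)))"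
      using B assms(1) by (intro sum.cong refl) (simp add: suminf_emeasure)
    finally show "(\<Sum>n. \<Sum>i\<in>I. ennreal (w i) * emeasure (\<mu> i) (B n))
        = (\<Sum>i\<in>I. ennreal (w i) * emeasure (\<mu> i) (\<Union> (range B)))" .
  qed
qed (use assms in simp)

end

theory Submission
  imports Defs
begin

text \<open>The bootstrapped measure is the average of the \<open>k\<close> marginals of the empirical measure of
  \<open>m = n / k\<close> tuples drawn independently and uniformly from the \<open>n\<close> blocks of the array. Averaging
  marginals is weakly continuous, so the theorem follows by contraction from Sanov's theorem for a
  triangular array whose sampling law converges weakly to \<open>\<mu>\<close>.

  Sanov's theorem is proved without tightness arguments. Every probability measure is viewed as a
  finitely additive set function on the algebra of \<open>\<mu>\<close>-continuity sets, which is a point of a compact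
  cube. A set function that satisfies the Donsker--Varadhan bound \<open>H \<le> c\<close> on step functions over
  this algebra assigns little mass to sets of small \<open>\<mu>\<close>-measure, hence extends to a measure by
  Caratheodory's theorem. This makes the entropy balls weakly compact, and it lets a weakly closed
  set that misses an entropy ball be covered by finitely many half-spaces, to each of which
  Chernoff's inequality applies. For the lower bound a neighbourhood is described by a finite
  partition into continuity sets, on which the draws are tilted and Chebyshev's inequality is used.\<close>

section \<open>The Donsker--Varadhan formula\<close>

text \<open>Weak convergence of the sampling laws controls averages of bounded continuous functions
  and, by squeezing, of indicators of \<mu>-continuity sets. The estimates are therefore run on step
  functions over that algebra, and the variational formula carries them to and from relative
  entropy. The key inequality is
  \<open>t * \<psi> A \<le> c + (exp t - 1) * measure \<mu> A\<close>: taking t large first and the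
  \<mu>-measure small afterwards makes a set function with entropy bound c continuous at the empty
  set. Limits in the cube that keep the bound are thus genuine measures. The draws are uniform on a
  finite set, so each probability is a count of maps from m draws to n indices, divided by
  \<open>n ^ m\<close>; exponential moments and the tilted law become finite sums that factor over
  the draws. The factor 1/k of the rate is the ratio of the number m = n/k of draws to the speed n.
  The moving and the circular scheme differ by a rotation of the indices modulo n, which leaves the
  multiset of sampled tuples unchanged.\<close>

lemma rel_entropy_density:
  assumes "prob_space \<nu>" and "prob_space \<mu>" and sets: "sets \<nu> = sets \<mu>"
    and ac: "absolutely_continuous \<mu> \<nu>"
  obtains D where "D \<in> borel_measurable \<mu>" and "\<And>x. 0 \<le> D x"
    and "density \<mu> (\<lambda>x. ennreal (D x)) = \<nu>" and "AE x in \<nu>. 0 < D x"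
    and "rel_entropy \<nu> \<mu>
      = enn2ereal (\<integral>\<^sup>+x. ennreal (ln (D x)) \<partial>\<nu>) - enn2ereal (\<integral>\<^sup>+x. ennreal (- ln (D x)) \<partial>\<nu>)"
    and "(\<integral>\<^sup>+x. ennreal (- ln (D x)) \<partial>\<nu>) \<le> 1"
proof -
  interpret N: prob_space \<nu> by fact
  interpret M: prob_space \<mu> by fact
  obtain D where D: "D \<in> borel_measurable \<mu>" "AE x in \<mu>. RN_deriv \<mu> \<nu> x = ennreal (D x)"
    "AE x in \<nu>. 0 < D x" "\<And>x. 0 \<le> D x"
    by (rule M.real_RN_deriv[OF _ ac sets]) (use N.finite_measure_axioms in auto)
  have dens: "density \<mu> (\<lambda>x. ennreal (D x)) = \<nu>"
  proof -
    have "density \<mu> (\<lambda>x. ennreal (D x)) = density \<mu> (RN_deriv \<mu> \<nu>)"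
      by (rule density_cong) (use D in auto)
    then show ?thesis using M.density_RN_deriv[OF ac sets] by simp
  qed
  have D\<nu>: "AE x in \<nu>. RN_deriv \<mu> \<nu> x = ennreal (D x)"
    using D(2) absolutely_continuous_AE[OF sets ac] by blast
  have e1: "(\<integral>\<^sup>+x. ennreal (ln (enn2real (RN_deriv \<mu> \<nu> x))) \<partial>\<nu>) = (\<integral>\<^sup>+x. ennreal (ln (D x)) \<partial>\<nu>)"
    by (rule nn_integral_cong_AE) (use D\<nu> D(4) in auto)
  have e2: "(\<integral>\<^sup>+x. ennreal (- ln (enn2real (RN_deriv \<mu> \<nu> x))) \<partial>\<nu>) = (\<integral>\<^sup>+x. ennreal (- ln (D x)) \<partial>\<nu>)"
    by (rule nn_integral_cong_AE) (use D\<nu> D(4) in auto)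
  have "(\<integral>\<^sup>+x. ennreal (- ln (D x)) \<partial>\<nu>) = (\<integral>\<^sup>+x. ennreal (D x) * ennreal (- ln (D x)) \<partial>\<mu>)"
    by (subst dens[symmetric], rule nn_integral_density) (use D in auto)
  also have "\<dots> \<le> (\<integral>\<^sup>+x. 1 \<partial>\<mu>)"
  proof (rule nn_integral_mono)
    fix x assume "x \<in> space \<mu>"
    \<comment> \<open>This is -t ln t \<le> 1 - t, that is, ln (1/t) \<le> 1/t - 1 multiplied by t.
      Integrated, it bounds the negative part of the entropy integral, so that the difference of the
      two parts is never \<infinity> - \<infinity>.\<close>
    have "D x * (- ln (D x)) \<le> 1"
    proof (cases "D x = 0")
      case False
      then have p: "D x > 0" using D(4)[of x] by linarith
      then have "ln (1 / D x) \<le> 1 / D x - 1" by (intro ln_le_minus_one) simp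
      then have "- ln (D x) \<le> 1 / D x - 1" using p by (simp add: ln_div)
      then have "D x * (- ln (D x)) \<le> D x * (1 / D x - 1)" using p by (intro mult_left_mono) auto
      also have "\<dots> \<le> 1" using p by (simp add: field_simps)
      finally show ?thesis .
    qed simp
    moreover have "ennreal (D x) * ennreal (- ln (D x)) = ennreal (D x * (- ln (D x)))"
      using D(4)[of x] by (subst ennreal_mult'[symmetric]) auto
    ultimately show "ennreal (D x) * ennreal (- ln (D x)) \<le> 1"
      by (metis ennreal_1 ennreal_leI)
  qed
  also have "\<dots> = 1" by (simp add: M.emeasure_space_1)
  finally have "(\<integral>\<^sup>+x. ennreal (- ln (D x)) \<partial>\<nu>) \<le> 1" .
  then show thesis
    using that[OF D(1,4) dens D(3)] e1 e2 ac
    by (simp add: rel_entropy_def extended_integral_def)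
qed

text \<open>With Z the \<mu>-integral of exp f, the inequality ln u \<le> u - 1 is applied to u =
  exp f / (D Z) and integrated against \<nu>. The density D cancels, so the integral of u is at most
  1.\<close>

lemma Donsker_Varadhan_le:
  fixes f :: "'a \<Rightarrow> real"
  assumes P: "prob_space \<nu>" "prob_space \<mu>" and sets: "sets \<nu> = sets \<mu>"
    and f: "f \<in> borel_measurable \<mu>" and B: "\<And>x. x \<in> space \<mu> \<Longrightarrow> \<bar>f x\<bar> \<le> B"
    and c: "rel_entropy \<nu> \<mu> \<le> ereal c"
  shows "(\<integral>x. f x \<partial>\<nu>) \<le> c + ln (\<integral>x. exp (f x) \<partial>\<mu>)"
proof -
  interpret N: prob_space \<nu> by fact
  interpret M: prob_space \<mu> by fact
  have ac: "absolutely_continuous \<mu> \<nu>"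
    using c by (auto simp: rel_entropy_def split: if_splits)
  obtain D where D: "D \<in> borel_measurable \<mu>" "\<And>x. 0 \<le> D x"
    "density \<mu> (\<lambda>x. ennreal (D x)) = \<nu>" "AE x in \<nu>. 0 < D x"
    "rel_entropy \<nu> \<mu>
      = enn2ereal (\<integral>\<^sup>+x. ennreal (ln (D x)) \<partial>\<nu>) - enn2ereal (\<integral>\<^sup>+x. ennreal (- ln (D x)) \<partial>\<nu>)"
    "(\<integral>\<^sup>+x. ennreal (- ln (D x)) \<partial>\<nu>) \<le> 1"
    using rel_entropy_density[OF P sets ac] by blast
  have spc: "space \<nu> = space \<mu>" using sets by (rule sets_eq_imp_space_eq)
  have D\<nu>: "D \<in> borel_measurable \<nu>" and f\<nu>: "f \<in> borel_measurable \<nu>"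
    using D(1) f sets by (auto simp: measurable_cong_sets[OF sets refl])
  let ?p = "\<integral>\<^sup>+x. ennreal (ln (D x)) \<partial>\<nu>" and ?q = "\<integral>\<^sup>+x. ennreal (- ln (D x)) \<partial>\<nu>"
  obtain q where q: "?q = ennreal q" "q \<ge> 0" using D(6) by (cases ?q) (auto simp: top_unique)
  have pf: "?p \<noteq> \<infinity>"
  proof
    assume "?p = \<infinity>"
    then have "rel_entropy \<nu> \<mu> = \<infinity>" using D(5) q by simp
    then show False using c by simp
  qed
  then obtain p where p: "?p = ennreal p" "p \<ge> 0" by (cases ?p) auto
  have pqc: "p - q \<le> c" using c D(5) p q by simp
  have int: "integrable \<nu> (\<lambda>x. ln (D x))"
    unfolding real_integrable_def using D\<nu> p q by (auto)
  have "(\<integral>x. ln (D x) \<partial>\<nu>) = p - q"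
    using int p q by (simp add: real_lebesgue_integral_def)
  then have lnD: "(\<integral>x. ln (D x) \<partial>\<nu>) \<le> c" using pqc by simp
  define Z where "Z = (\<integral>x. exp (f x) \<partial>\<mu>)"
  have fint: "integrable \<nu> f"
    by (rule N.integrable_const_bound[where B=B]) (use B spc f\<nu> in auto)
  have eint: "integrable \<mu> (\<lambda>x. exp (f x))"
    by (rule M.integrable_const_bound[where B="exp B"]) (use B f in \<open>auto simp: abs_le_iff\<close>)
  have "exp (- B) = (\<integral>x. exp (- B) \<partial>\<mu>)" by (simp add: M.prob_space)
  also have "\<dots> \<le> Z" unfolding Z_def
    by (rule integral_mono) (use eint B in \<open>auto simp: abs_le_iff minus_le_iff\<close>)
  finally have Z: "Z > 0" using exp_gt_zero[of "- B"] by linarith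
  have r: "integrable \<nu> (\<lambda>x. exp (f x) / (D x * Z))"
    "(\<integral>x. exp (f x) / (D x * Z) \<partial>\<nu>) \<le> 1"
  proof -
    have g: "(\<lambda>x. exp (f x) / (D x * Z)) \<in> borel_measurable \<mu>" using f D(1) by measurable
    have gi: "integrable \<mu> (\<lambda>x. exp (f x) / Z)" using eint by simp
    have di: "integrable \<mu> (\<lambda>x. D x * (exp (f x) / (D x * Z)))"
      by (rule Bochner_Integration.integrable_bound[OF gi]) (use f D(1) Z in \<open>auto simp: field_simps\<close>)
    then show "integrable \<nu> (\<lambda>x. exp (f x) / (D x * Z))"
      using integrable_density[OF g D(1)] D(2,3) by simp
    have "(\<integral>x. exp (f x) / (D x * Z) \<partial>\<nu>) = (\<integral>x. D x * (exp (f x) / (D x * Z)) \<partial>\<mu>)"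
      using integral_density[OF g D(1)] D(2,3) by simp
    \<comment> \<open>Where D vanishes the left integrand is 0 by the convention on division, so
      only an inequality holds here.\<close>
    also have "\<dots> \<le> (\<integral>x. exp (f x) / Z \<partial>\<mu>)"
      by (rule integral_mono[OF di gi]) (use Z in \<open>auto simp: field_simps\<close>)
    also have "\<dots> = 1" using Z by (simp add: Z_def)
    finally show "(\<integral>x. exp (f x) / (D x * Z) \<partial>\<nu>) \<le> 1" .
  qed
  have "(\<integral>x. f x - ln (D x) - ln Z \<partial>\<nu>) \<le> (\<integral>x. exp (f x) / (D x * Z) - 1 \<partial>\<nu>)"
  proof (rule integral_mono_AE)
    show "integrable \<nu> (\<lambda>x. f x - ln (D x) - ln Z)" using fint int by simp
    show "integrable \<nu> (\<lambda>x. exp (f x) / (D x * Z) - 1)" using r by simp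
    show "AE x in \<nu>. f x - ln (D x) - ln Z \<le> exp (f x) / (D x * Z) - 1"
      using D(4)
    proof (eventually_elim)
      case (elim x)
      have "ln (exp (f x) / (D x * Z)) = f x - ln (D x) - ln Z"
        using elim Z by (simp add: ln_div ln_mult)
      moreover have "ln (exp (f x) / (D x * Z)) \<le> exp (f x) / (D x * Z) - 1"
        by (intro ln_le_minus_one) (use elim Z in simp)
      ultimately show ?case by simp
    qed
  qed
  also have "\<dots> \<le> 0" using r by (simp add: N.prob_space)
  finally have "(\<integral>x. f x \<partial>\<nu>) - (\<integral>x. ln (D x) \<partial>\<nu>) - ln Z \<le> 0"
    using fint int by (simp add: N.prob_space)
  then show ?thesis using lnD unfolding Z_def by simp
qed

text \<open>The optimal test function is ln D, which is unbounded; D is clamped, the bound is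
  applied to the logarithm of the clamped density, and the clamp is released by Fatou's lemma.
  Multiples of the indicator of a null set give absolute continuity beforehand.\<close>

lemma rel_entropy_le_Donsker_Varadhan:
  assumes P: "prob_space \<nu>" "prob_space \<mu>" and sets: "sets \<nu> = sets \<mu>"
    and DV: "\<And>f B. f \<in> borel_measurable \<mu> \<Longrightarrow> (\<And>x. x \<in> space \<mu> \<Longrightarrow> \<bar>f x\<bar> \<le> B) \<Longrightarrow>
      (\<integral>x. f x \<partial>\<nu>) \<le> c + ln (\<integral>x. exp (f x) \<partial>\<mu>)"
  shows "rel_entropy \<nu> \<mu> \<le> ereal c"
proof -
  interpret N: prob_space \<nu> by fact
  interpret M: prob_space \<mu> by fact
  have spc: "space \<nu> = space \<mu>" using sets by (rule sets_eq_imp_space_eq)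
  have ac: "absolutely_continuous \<mu> \<nu>"
  proof (unfold absolutely_continuous_def, rule subsetI)
    fix A assume A: "A \<in> null_sets \<mu>"
    then have As: "A \<in> sets \<mu>" by auto
    \<comment> \<open>The test function t times the indicator of a \<mu>-null set has exponential
      equal to 1 almost everywhere, so the logarithm drops out; t is arbitrarily large.\<close>
    have bound: "t * measure \<nu> A \<le> c" if "t \<ge> 0" for t
    proof -
      have "(\<integral>x. exp (t * indicator A x) \<partial>\<mu>) = (\<integral>x. 1 \<partial>\<mu>)"
      proof (rule integral_cong_AE)
        show "AE x in \<mu>. exp (t * indicator A x) = 1"
          using AE_not_in[OF A] by eventually_elim simp
      qed (use As in auto)
      moreover have "A \<inter> space \<nu> = A"
        using sets.sets_into_space[OF As] spc by auto
      moreover have "(\<integral>x. t * indicator A x \<partial>\<nu>) \<le> c + ln (\<integral>x. exp (t * indicator A x) \<partial>\<mu>)"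
        by (rule DV[where B=t]) (use As that in \<open>auto simp: indicator_def\<close>)
      ultimately show ?thesis by (simp add: M.prob_space)
    qed
    have "measure \<nu> A = 0"
    proof (rule ccontr)
      assume "measure \<nu> A \<noteq> 0"
      then have p: "measure \<nu> A > 0" using zero_less_measure_iff by blast
      then show False using bound[of "(\<bar>c\<bar> + 1) / measure \<nu> A"] by simp
    qed
    then show "A \<in> null_sets \<nu>" using As sets by (simp add: N.emeasure_eq_measure null_sets_def)
  qed
  obtain D where D: "D \<in> borel_measurable \<mu>" "\<And>x. 0 \<le> D x"
    "density \<mu> (\<lambda>x. ennreal (D x)) = \<nu>" "AE x in \<nu>. 0 < D x"
    "rel_entropy \<nu> \<mu>
      = enn2ereal (\<integral>\<^sup>+x. ennreal (ln (D x)) \<partial>\<nu>) - enn2ereal (\<integral>\<^sup>+x. ennreal (- ln (D x)) \<partial>\<nu>)"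
    "(\<integral>\<^sup>+x. ennreal (- ln (D x)) \<partial>\<nu>) \<le> 1"
    using rel_entropy_density[OF P sets ac] by blast
  have D\<nu>[measurable]: "D \<in> borel_measurable \<nu>"
    using D(1) sets by (auto simp: measurable_cong_sets[OF sets refl])
  note D(1)[measurable]
  let ?p = "\<integral>\<^sup>+x. ennreal (ln (D x)) \<partial>\<nu>" and ?q = "\<integral>\<^sup>+x. ennreal (- ln (D x)) \<partial>\<nu>"
  obtain q where q: "?q = ennreal q" "q \<ge> 0" using D(6) by (cases ?q) (auto simp: top_unique)
  \<comment> \<open>D clamped to [1/(i+1), i+1]; its logarithm is an admissible bounded test
    function.\<close>
  define T where "T i x = max (min (D x) (real i + 1)) (1 / (real i + 1))" for i :: nat and x
  have Tb: "1 / (real i + 1) \<le> T i x" "T i x \<le> real i + 1" "0 < T i x" for i x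
  proof -
    show l: "1 / (real i + 1) \<le> T i x" by (simp add: T_def)
    have "1 / (real i + 1) \<le> real i + 1" by (rule order_trans[of _ 1]) (auto simp: field_simps)
    then show "T i x \<le> real i + 1" by (simp add: T_def)
    have "0 < 1 / (real i + 1)" by simp
    then show "0 < T i x" using l by linarith
  qed
  have Dint: "integrable \<mu> D" "(\<integral>x. D x \<partial>\<mu>) = 1"
  proof -
    have "(\<integral>\<^sup>+x. ennreal (D x) \<partial>\<mu>) = emeasure (density \<mu> (\<lambda>x. ennreal (D x))) (space \<mu>)"
      by (subst emeasure_density) (auto intro!: nn_integral_cong)
    also have "\<dots> = 1" using D(3) spc N.emeasure_space_1 by simp
    finally have e: "(\<integral>\<^sup>+x. ennreal (D x) \<partial>\<mu>) = ennreal 1" by simp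
    show "integrable \<mu> D" "(\<integral>x. D x \<partial>\<mu>) = 1"
      using nn_integral_eq_integrable[of D \<mu> 1] e D(2) by auto
  qed
  have lnT: "\<bar>ln (T i x)\<bar> \<le> ln (real i + 1)" for i x
  proof -
    have "ln (1 / (real i + 1)) \<le> ln (T i x)" by (subst ln_le_cancel_iff) (use Tb[of i x] in auto)
    moreover have "ln (T i x) \<le> ln (real i + 1)" by (subst ln_le_cancel_iff) (use Tb[of i x] in auto)
    ultimately show ?thesis by (simp add: ln_div abs_le_iff)
  qed
  have Tm[measurable]: "T i \<in> borel_measurable \<mu>" "T i \<in> borel_measurable \<nu>" for i
    unfolding T_def by measurable
  \<comment> \<open>Clamping from below adds at most 1/(i+1) to D, whose \<mu>-integral is 1. Hence
    the \<mu>-integral of \<open>T i\<close> is at most 1 + 1/(i+1), and its logarithm at most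
    1/(i+1).\<close>
  have bound: "(\<integral>x. ln (T i x) \<partial>\<nu>) \<le> c + 1 / (real i + 1)" for i
  proof -
    have "(\<integral>x. ln (T i x) \<partial>\<nu>) \<le> c + ln (\<integral>x. T i x \<partial>\<mu>)"
      using DV[of "\<lambda>x. ln (T i x)" "ln (real i + 1)"] lnT Tb(3) by simp
    moreover have Ti: "integrable \<mu> (T i)"
      by (rule M.integrable_const_bound[where B="real i + 1"]) (use Tb(2,3)[of i] in \<open>auto simp: less_imp_le\<close>)
    moreover have "T i x \<le> D x + 1 / (real i + 1)" for x
    proof -
      have "0 \<le> 1 / (real i + 1)" by simp
      then show ?thesis using D(2)[of x] unfolding T_def by linarith
    qed
    then have "(\<integral>x. T i x \<partial>\<mu>) \<le> (\<integral>x. D x + 1 / (real i + 1) \<partial>\<mu>)"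
      using Ti Dint by (intro integral_mono) auto
    moreover have "(\<integral>x. D x + 1 / (real i + 1) \<partial>\<mu>) = 1 + 1 / (real i + 1)"
      using Dint by (simp add: M.prob_space)
    moreover have "0 < (\<integral>x. T i x \<partial>\<mu>)"
    proof -
      have "1 / (real i + 1) = (\<integral>x. 1 / (real i + 1) \<partial>\<mu>)" by (simp add: M.prob_space)
      also have "\<dots> \<le> (\<integral>x. T i x \<partial>\<mu>)" by (rule integral_mono) (use Ti Tb in auto)
      finally show ?thesis by (smt (verit) divide_pos_pos of_nat_0_le_iff)
    qed
    ultimately show ?thesis using ln_le_minus_one[of "\<integral>x. T i x \<partial>\<mu>"] by linarith
  qed
  \<comment> \<open>Fatou's lemma wants nonnegative integrands, so only positive parts are passed to
    the limit. The negative part of \<open>ln (T i x)\<close> is dominated by that of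
    \<open>ln (D x)\<close>; its integral q is added here and subtracted again at the end.\<close>
  have pos: "(\<integral>\<^sup>+x. ennreal (ln (T i x)) \<partial>\<nu>) \<le> ennreal (c + 1 / (real i + 1) + q)" for i
  proof -
    have int: "integrable \<nu> (\<lambda>x. ln (T i x))"
      by (rule N.integrable_const_bound[where B="ln (real i + 1)"]) (use lnT in auto)
    let ?a = "\<integral>\<^sup>+x. ennreal (ln (T i x)) \<partial>\<nu>" and ?b = "\<integral>\<^sup>+x. ennreal (- ln (T i x)) \<partial>\<nu>"
    have ab: "(\<integral>x. ln (T i x) \<partial>\<nu>) = enn2real ?a - enn2real ?b"
      using int by (simp add: real_lebesgue_integral_def)
    have af: "?a \<noteq> \<infinity>" using int by (simp add: real_integrable_def)
    have "?b \<le> ?q"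
    proof (rule nn_integral_mono_AE, use D(4) in eventually_elim)
      case (elim x)
      have "- ln (T i x) \<le> max 0 (- ln (D x))"
      proof (cases "D x \<le> real i + 1")
        case True
        then have "ln (D x) \<le> ln (T i x)" using elim
          by (subst ln_le_cancel_iff) (auto simp: T_def)
        then show ?thesis by simp
      next
        case False
        then have "1 \<le> T i x" by (auto simp: T_def)
        then have "0 \<le> ln (T i x)" by (rule ln_ge_zero)
        then show ?thesis by linarith
      qed
      then show ?case
        by (metis ennreal_leI ennreal_max_0)
    qed
    then have "enn2real ?b \<le> q" using q by (metis enn2real_mono enn2real_ennreal ennreal_less_top)
    then have "enn2real ?a \<le> c + 1 / (real i + 1) + q" using bound[of i] ab by linarith
    then show ?thesis using af by (metis ennreal_enn2real_if ennreal_leI infinity_ennreal_def)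
  qed
  have conv: "?p \<le> ennreal (c + q)"
  proof -
    have inv0: "(\<lambda>i. 1 / (real i + 1)) \<longlonglongrightarrow> 0"
      using LIMSEQ_inverse_real_of_nat by (simp add: inverse_eq_divide add.commute)
    have "?p \<le> (\<integral>\<^sup>+x. liminf (\<lambda>i. ennreal (ln (T i x))) \<partial>\<nu>)"
    proof (rule nn_integral_mono_AE, use D(4) in eventually_elim)
      case (elim x)
      have "eventually (\<lambda>i. T i x = D x) sequentially"
      proof -
        obtain n where n: "real n > D x" "real n > 1 / D x"
          by (metis max_less_iff_conj reals_Archimedean2)
        have "T i x = D x" if "i \<ge> n" for i
        proof -
          have "real n \<le> real i" using that by simp
          then have "D x < real i + 1" "1 / D x < real i + 1" using n by linarith+
          moreover from this(2) have "1 / (real i + 1) < D x" using elim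
            by (simp add: field_simps)
          ultimately show ?thesis by (simp add: T_def)
        qed
        then show ?thesis unfolding eventually_sequentially by blast
      qed
      then have "eventually (\<lambda>i. ennreal (ln (T i x)) = ennreal (ln (D x))) sequentially"
        by eventually_elim simp
      then have "(\<lambda>i. ennreal (ln (T i x))) \<longlonglongrightarrow> ennreal (ln (D x))"
        by (rule tendsto_eventually)
      then show ?case by (simp add: lim_imp_Liminf)
    qed
    also have "\<dots> \<le> liminf (\<lambda>i. \<integral>\<^sup>+x. ennreal (ln (T i x)) \<partial>\<nu>)"
      by (rule nn_integral_liminf) measurable
    also have "\<dots> \<le> liminf (\<lambda>i. ennreal (c + 1 / (real i + 1) + q))"
      by (rule Liminf_mono) (use pos in auto)
    also have "\<dots> = ennreal (c + 0 + q)"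
      by (intro lim_imp_Liminf tendsto_ennrealI tendsto_add tendsto_const inv0) simp
    finally show ?thesis by simp
  qed
  \<comment> \<open>The test function 0. Nonnegativity matters because \<open>ennreal\<close> cuts
    negative numbers off at 0, so \<open>conv\<close> could not be read back as a bound by c +
    q.\<close>
  have cq: "0 \<le> c"
  proof -
    have "(\<integral>x. 0 \<partial>\<nu>) \<le> c + ln (\<integral>x. exp 0 \<partial>\<mu>)"
      using DV[where f="\<lambda>_. 0" and B=0] by simp
    then show ?thesis by (simp add: M.prob_space)
  qed
  have "enn2ereal ?p \<le> ereal (c + q)"
    using conv cq q(2) by (metis add_nonneg_nonneg enn2ereal_ennreal less_eq_ennreal.rep_eq)
  then have "enn2ereal ?p - ereal q \<le> ereal c"
    by (cases "enn2ereal ?p") auto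
  then show ?thesis using D(5) q by simp
qed

section \<open>Bounded continuous functions and the weak topology\<close>

definition bounded_continuous :: "'b topology \<Rightarrow> ('b \<Rightarrow> real) \<Rightarrow> bool" where
  "bounded_continuous X f \<longleftrightarrow> continuous_map X euclideanreal f \<and> bounded (f ` topspace X)"

lemma bounded_continuousI:
  assumes "continuous_map X euclideanreal f" and "\<And>x. x \<in> topspace X \<Longrightarrow> \<bar>f x\<bar> \<le> B"
  shows "bounded_continuous X f"
  unfolding bounded_continuous_def bounded_iff using assms by (intro conjI exI[of _ B]) auto

lemma bounded_continuousE:
  assumes "bounded_continuous X f"
  obtains B where "B > 0" and "\<And>x. x \<in> topspace X \<Longrightarrow> \<bar>f x\<bar> \<le> B"
  using assms that unfolding bounded_continuous_def bounded_pos by (metis imageI real_norm_def)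

lemma bounded_continuous_map: "bounded_continuous X f \<Longrightarrow> continuous_map X euclideanreal f"
  by (simp add: bounded_continuous_def)

lemma bounded_continuous_const: "bounded_continuous X (\<lambda>_. c)"
  by (rule bounded_continuousI[where B="\<bar>c\<bar>"]) auto

lemma bounded_continuous_add:
  assumes "bounded_continuous X f" "bounded_continuous X g"
  shows "bounded_continuous X (\<lambda>x. f x + g x)"
proof -
  obtain B where B: "B > 0" "\<And>x. x \<in> topspace X \<Longrightarrow> \<bar>f x\<bar> \<le> B"
    by (rule bounded_continuousE[OF assms(1)]) (rule that)
  obtain C where C: "C > 0" "\<And>x. x \<in> topspace X \<Longrightarrow> \<bar>g x\<bar> \<le> C"
    by (rule bounded_continuousE[OF assms(2)]) (rule that)
  have "\<bar>f x + g x\<bar> \<le> B + C" if "x \<in> topspace X" for x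
    using B(2)[OF that] C(2)[OF that] by linarith
  then show ?thesis
    by (intro bounded_continuousI[where B="B + C"] continuous_intros assms[THEN bounded_continuous_map])
qed

lemma bounded_continuous_mult:
  assumes "bounded_continuous X f" "bounded_continuous X g"
  shows "bounded_continuous X (\<lambda>x. f x * g x)"
proof -
  obtain B where B: "B > 0" "\<And>x. x \<in> topspace X \<Longrightarrow> \<bar>f x\<bar> \<le> B"
    by (rule bounded_continuousE[OF assms(1)]) (rule that)
  obtain C where C: "C > 0" "\<And>x. x \<in> topspace X \<Longrightarrow> \<bar>g x\<bar> \<le> C"
    by (rule bounded_continuousE[OF assms(2)]) (rule that)
  have "\<bar>f x * g x\<bar> \<le> B * C" if "x \<in> topspace X" for x
    using B(1) B(2)[OF that] C(2)[OF that] unfolding abs_mult by (intro mult_mono) auto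
  then show ?thesis
    by (intro bounded_continuousI[where B="B * C"] continuous_intros assms[THEN bounded_continuous_map])
qed

lemma bounded_continuous_max:
  assumes "bounded_continuous X f" "bounded_continuous X g"
  shows "bounded_continuous X (\<lambda>x. max (f x) (g x))"
proof -
  obtain B where B: "B > 0" "\<And>x. x \<in> topspace X \<Longrightarrow> \<bar>f x\<bar> \<le> B"
    by (rule bounded_continuousE[OF assms(1)]) (rule that)
  obtain C where C: "C > 0" "\<And>x. x \<in> topspace X \<Longrightarrow> \<bar>g x\<bar> \<le> C"
    by (rule bounded_continuousE[OF assms(2)]) (rule that)
  have "\<bar>max (f x) (g x)\<bar> \<le> max B C" if "x \<in> topspace X" for x
    using B(2)[OF that] C(2)[OF that] by linarith
  then show ?thesis
    by (intro bounded_continuousI[where B="max B C"] continuous_intros assms[THEN bounded_continuous_map])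
qed

lemma bounded_continuous_minus:
  assumes "bounded_continuous X f"
  shows "bounded_continuous X (\<lambda>x. - f x)"
  using bounded_continuous_mult[OF bounded_continuous_const[of X "-1"] assms] by simp

lemma bounded_continuous_diff:
  assumes "bounded_continuous X f" "bounded_continuous X g"
  shows "bounded_continuous X (\<lambda>x. f x - g x)"
  using bounded_continuous_add[OF assms(1) bounded_continuous_minus[OF assms(2)]] by simp

lemma bounded_continuous_min:
  assumes "bounded_continuous X f" "bounded_continuous X g"
  shows "bounded_continuous X (\<lambda>x. min (f x) (g x))"
proof -
  have "bounded_continuous X (\<lambda>x. - max (- f x) (- g x))"
    by (intro bounded_continuous_minus bounded_continuous_max assms)
  moreover have "- max (- f x) (- g x) = min (f x) (g x)" for x by simp
  ultimately show ?thesis by simp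
qed

lemmas bounded_continuous_intros = bounded_continuous_const bounded_continuous_add
  bounded_continuous_mult bounded_continuous_minus bounded_continuous_diff
  bounded_continuous_max bounded_continuous_min

lemma sets_borel_of: "sets (borel_of X) = sigma_sets (topspace X) {U. openin X U}"
  unfolding borel_of_def by (rule sets_measure_of) (auto dest: openin_subset)

lemma openin_sets_borel_of: "openin X U \<Longrightarrow> U \<in> sets (borel_of X)"
  by (auto simp: sets_borel_of)

lemma continuous_map_borel_measurable:
  assumes "continuous_map X euclideanreal f" "sets M = sets (borel_of X)"
  shows "f \<in> borel_measurable M"
proof (rule borel_measurableI)
  fix S :: "real set" assume "open S"
  then have "openin X {x \<in> topspace X. f x \<in> S}"
    using openin_continuous_map_preimage[OF assms(1)] by auto
  moreover have "f -` S \<inter> space M = {x \<in> topspace X. f x \<in> S}"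
    using sets_eq_imp_space_eq[OF assms(2)] by auto
  ultimately show "f -` S \<inter> space M \<in> sets M" using assms(2) openin_sets_borel_of by metis
qed

lemma borel_probsD:
  assumes "\<nu> \<in> borel_probs X"
  shows "prob_space \<nu>" "sets \<nu> = sets (borel_of X)" "space \<nu> = topspace X"
  using assms sets_eq_imp_space_eq[of \<nu> "borel_of X"] by (auto simp: borel_probs_def)

lemma bounded_continuous_measurable:
  assumes "bounded_continuous X f" "\<nu> \<in> borel_probs X"
  shows "f \<in> borel_measurable \<nu>"
  using assms by (intro continuous_map_borel_measurable borel_probsD(2) bounded_continuous_map)

lemma bounded_continuous_integrable:
  assumes "bounded_continuous X f" "\<nu> \<in> borel_probs X"
  shows "integrable \<nu> f"
proof -
  interpret prob_space \<nu> using assms borel_probsD by blast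
  obtain B where "B > 0" "\<And>x. x \<in> topspace X \<Longrightarrow> \<bar>f x\<bar> \<le> B"
    by (rule bounded_continuousE[OF assms(1)]) (rule that)
  then show ?thesis
    using assms borel_probsD(3)[OF assms(2)]
    by (intro integrable_const_bound[where B=B] bounded_continuous_measurable) auto
qed

lemma weak_topology_basis:
  assumes "bounded_continuous X f" "open U"
  shows "openin (weak_topology X) {\<nu> \<in> borel_probs X. (\<integral>x. f x \<partial>\<nu>) \<in> U}"
  unfolding weak_topology_def
  by (rule topology_generated_by_Basis) (use assms in \<open>auto simp: bounded_continuous_def\<close>)

lemma continuous_map_weak_topology_integral:
  assumes "bounded_continuous X f"
  shows "continuous_map (weak_topology X) euclideanreal (\<lambda>\<nu>. \<integral>x. f x \<partial>\<nu>)"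
  using weak_topology_basis[OF assms]
  by (auto simp: continuous_map_def topspace_weak_topology)

text \<open>The universal property of an initial topology. It serves both the averaging of marginals
  and the map from weight vectors to bootstrapped measures.\<close>

lemma continuous_map_into_weak_topology:
  assumes "\<And>z. z \<in> topspace Z \<Longrightarrow> h z \<in> borel_probs X"
    and "\<And>f. bounded_continuous X f \<Longrightarrow> continuous_map Z euclideanreal (\<lambda>z. \<integral>x. f x \<partial>(h z))"
  shows "continuous_map Z (weak_topology X) h"
  unfolding weak_topology_def continuous_on_generated_topo_iff
proof (intro conjI allI impI)
  have "\<Union> {{\<mu> \<in> borel_probs X. (\<integral>x. f x \<partial>\<mu>) \<in> U} |f U.
       continuous_map X euclideanreal f \<and> bounded (f ` topspace X) \<and> open U} = borel_probs X" (is "\<Union> ?S = _")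
    using topspace_weak_topology[of X] unfolding weak_topology_def topology_generated_by_topspace .
  then show "h ` topspace Z \<subseteq> \<Union> ?S"
    using assms(1) by (simp only: image_subset_iff) simp
  fix V assume "V \<in> {{\<mu> \<in> borel_probs X. (\<integral>x. f x \<partial>\<mu>) \<in> U} |f U.
       continuous_map X euclideanreal f \<and> bounded (f ` topspace X) \<and> open U}"
  then obtain f U where V: "V = {\<mu> \<in> borel_probs X. (\<integral>x. f x \<partial>\<mu>) \<in> U}"
    "bounded_continuous X f" "open U" unfolding bounded_continuous_def by auto
  have "openin Z {z \<in> topspace Z. (\<integral>x. f x \<partial>(h z)) \<in> U}"
    using openin_continuous_map_preimage[OF assms(2)[OF V(2)]] V(3) by auto
  moreover have "h -` V \<inter> topspace Z = {z \<in> topspace Z. (\<integral>x. f x \<partial>(h z)) \<in> U}"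
    using V(1) assms(1) by auto
  ultimately show "openin Z (h -` V \<inter> topspace Z)" by simp
qed

text \<open>A ramp of slope c at level t. For large c it approximates the indicator of {t < f} from
  below if a = 0 and from above if a = 1.\<close>

lemma bounded_continuous_clamp:
  assumes "bounded_continuous X f"
  shows "bounded_continuous X (\<lambda>x. max 0 (min 1 (a + c * (f x - t))))"
  by (intro bounded_continuous_intros assms)

text \<open>The consequence of metrizability through which continuous functions reach the Borel
  sets. It is stated for an abstract topology because the k-tuples live on extensional functions,
  which are not a whole type.\<close>

locale perfect_topology =
  fixes X :: "'b topology"
  assumes cozero: "openin X U \<Longrightarrow> \<exists>f. bounded_continuous X f \<and> (\<forall>x\<in>topspace X. 0 \<le> f x)
    \<and> U = {x \<in> topspace X. 0 < f x}"
begin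

text \<open>If U = {0 < f}, the ramps \<open>min 1 (j * f)\<close> increase to the indicator of U;
  dominated convergence identifies the measures of open sets, which form a generating system stable
  under intersection.\<close>

lemma integrals_determine_measure:
  assumes "\<nu>1 \<in> borel_probs X" "\<nu>2 \<in> borel_probs X"
    and eq: "\<And>f. bounded_continuous X f \<Longrightarrow> (\<integral>x. f x \<partial>\<nu>1) = (\<integral>x. f x \<partial>\<nu>2)"
  shows "\<nu>1 = \<nu>2"
proof (rule measure_eqI_generator_eq[where \<Omega>="topspace X" and E="{U. openin X U}" and A="\<lambda>_. topspace X"])
  show "Int_stable {U. openin X U}" by (auto simp: Int_stable_def)
  fix U assume "U \<in> {U. openin X U}"
  then have oU: "openin X U" by simp
  obtain f where f: "bounded_continuous X f" "\<forall>x\<in>topspace X. 0 \<le> f x" "U = {x \<in> topspace X. 0 < f x}"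
    using cozero[OF oU] by blast
  define g where "g j x = max 0 (min 1 (0 + real j * (f x - 0)))" for j x
  have g: "bounded_continuous X (g j)" for j unfolding g_def by (intro bounded_continuous_clamp f)
  have lim: "(\<lambda>j. \<integral>x. g j x \<partial>\<nu>) \<longlonglongrightarrow> measure \<nu> U" if \<nu>: "\<nu> \<in> borel_probs X" for \<nu>
  proof -
    interpret prob_space \<nu> using \<nu> borel_probsD by blast
    have Us: "U \<in> sets \<nu>" using \<nu> oU borel_probsD(2) openin_sets_borel_of by blast
    have "(\<lambda>j. \<integral>x. g j x \<partial>\<nu>) \<longlonglongrightarrow> (\<integral>x. indicator U x \<partial>\<nu>)"
    proof (rule integral_dominated_convergence[where w="\<lambda>_. 1"])
      show "AE x in \<nu>. (\<lambda>j. g j x) \<longlonglongrightarrow> indicator U x"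
      proof (rule AE_I2)
        fix x assume x: "x \<in> space \<nu>"
        show "(\<lambda>j. g j x) \<longlonglongrightarrow> indicator U x"
        proof (cases "x \<in> U")
          case True
          then have "0 < f x" using f by auto
          obtain n where n: "1 / f x < real n" using reals_Archimedean2 by blast
          have "g j x = 1" if "j \<ge> n" for j
          proof -
            have "1 / f x \<le> real j" using n that by linarith
            then have "1 \<le> real j * f x" using \<open>0 < f x\<close> by (simp add: field_simps)
            then show ?thesis by (simp add: g_def)
          qed
          then have "eventually (\<lambda>j. g j x = 1) sequentially"
            unfolding eventually_sequentially by blast
          then show ?thesis using True by (simp add: tendsto_eventually)
        next
          case False
          then have "f x = 0" using f x borel_probsD(3)[OF \<nu>] by force
          then show ?thesis using False by (simp add: g_def)
        qed
      qed
      show "g j \<in> borel_measurable \<nu>" for j using bounded_continuous_measurable[OF g \<nu>] .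
      show "AE x in \<nu>. norm (g j x) \<le> 1" for j by (auto simp: g_def)
    qed (use Us in auto)
    then show ?thesis using Us sets.sets_into_space[OF Us] by (simp add: Int_absorb2)
  qed
  have "measure \<nu>1 U = measure \<nu>2 U"
    using LIMSEQ_unique[OF lim[OF assms(1)]] lim[OF assms(2)] eq[OF g] by simp
  moreover interpret N1: prob_space \<nu>1 using assms borel_probsD by blast
  interpret N2: prob_space \<nu>2 using assms borel_probsD by blast
  show "emeasure \<nu>1 U = emeasure \<nu>2 U"
    using calculation by (simp add: N1.emeasure_eq_measure N2.emeasure_eq_measure)
next
  fix i :: nat
  interpret N1: prob_space \<nu>1 using assms borel_probsD by blast
  show "emeasure \<nu>1 (topspace X) \<noteq> \<infinity>" by simp
qed (use assms borel_probsD(2) in \<open>auto simp: sets_borel_of dest: openin_subset\<close>)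

text \<open>Needed to conclude that compact level sets of the rate are closed, which is its lower
  semicontinuity.\<close>

lemma Hausdorff_space_weak_topology: "Hausdorff_space (weak_topology X)"
  unfolding Hausdorff_space_def
proof (intro allI impI)
  fix \<nu>1 \<nu>2 assume A: "\<nu>1 \<in> topspace (weak_topology X) \<and> \<nu>2 \<in> topspace (weak_topology X) \<and> \<nu>1 \<noteq> \<nu>2"
  then obtain f where f: "bounded_continuous X f" "(\<integral>x. f x \<partial>\<nu>1) \<noteq> (\<integral>x. f x \<partial>\<nu>2)"
    using integrals_determine_measure by (metis topspace_weak_topology)
  then obtain U V where "open U" "open V" "(\<integral>x. f x \<partial>\<nu>1) \<in> U" "(\<integral>x. f x \<partial>\<nu>2) \<in> V" "U \<inter> V = {}"
    using hausdorff by metis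
  then show "\<exists>U V. openin (weak_topology X) U \<and> openin (weak_topology X) V \<and> \<nu>1 \<in> U \<and> \<nu>2 \<in> V \<and> disjnt U V"
    using A weak_topology_basis[OF f(1)]
    by (intro exI[of _ "{\<nu> \<in> borel_probs X. (\<integral>x. f x \<partial>\<nu>) \<in> U}"]
        exI[of _ "{\<nu> \<in> borel_probs X. (\<integral>x. f x \<partial>\<nu>) \<in> V}"])
      (auto simp: disjnt_def topspace_weak_topology)
qed

end

section \<open>Continuity sets\<close>

text \<open>A discrete layer-cake formula: f + B is nearly e times the number of thresholds below f.
  Each threshold may be chosen freely in an interval of length e, which is what makes superlevel
  sets in a mere algebra of continuity sets available.\<close>

lemma step_function_approximation:
  fixes f :: "'b \<Rightarrow> real"
  assumes levels: "\<And>a b. a < b \<Longrightarrow> \<exists>t. a < t \<and> t < b \<and> {x \<in> \<Omega>. t < f x} \<in> \<S>"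
    and "\<Omega> \<in> \<S>" and B: "\<And>x. x \<in> \<Omega> \<Longrightarrow> \<bar>f x\<bar> \<le> B" and e: "e > 0"
  obtains N :: nat and a A where "\<And>j. j < N \<Longrightarrow> A j \<in> \<S>"
    and "\<And>x. x \<in> \<Omega> \<Longrightarrow> \<bar>f x - (\<Sum>j<N. a j * indicator (A j) x)\<bar> \<le> e"
proof -
  have "\<exists>t. \<forall>j::nat. real j * e - B < t j \<and> t j < (real j + 1) * e - B \<and> {x \<in> \<Omega>. t j < f x} \<in> \<S>"
    by (rule choice, intro allI levels) (use e in \<open>simp add: field_simps\<close>)
  then obtain t where t: "\<And>j::nat. real j * e - B < t j" "\<And>j::nat. t j < (real j + 1) * e - B"
    "\<And>j::nat. {x \<in> \<Omega>. t j < f x} \<in> \<S>" by blast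
  obtain N :: nat where N: "2 * B / e \<le> real N" using real_arch_simple by blast
  \<comment> \<open>The index N carries the constant -B on the whole space; the indices below N
    carry the thresholds.\<close>
  define a where "a j = (if j = N then - B else e)" for j
  define A where "A j = (if j = N then \<Omega> else {x \<in> \<Omega>. t j < f x})" for j
  show thesis
  proof (rule that[of "Suc N" A a])
    show "A j \<in> \<S>" for j using t(3) \<open>\<Omega> \<in> \<S>\<close> by (simp add: A_def)
    fix x assume x: "x \<in> \<Omega>"
    define y where "y = f x + B"
    define S where "S = {j. j < N \<and> t j < f x}"
    have y: "0 \<le> y" "y / e \<le> real N"
    proof -
      show "0 \<le> y" using B[OF x] by (simp add: y_def abs_le_iff)
      have "y / e \<le> 2 * B / e" using B[OF x] e by (intro divide_right_mono) (auto simp: y_def)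
      then show "y / e \<le> real N" using N by linarith
    qed
    \<comment> \<open>All thresholds with index below p lie below \<open>f x\<close> and none with
      index above p does. The count is therefore p or p + 1, and y lies between p e and (p + 1)
      e.\<close>
    define p where "p = nat \<lfloor>y / e\<rfloor>"
    have p: "real p \<le> y / e" "y / e < real p + 1"
      using y e by (auto simp: p_def)
    have "{..<p} \<subseteq> S"
    proof
      fix j assume "j \<in> {..<p}"
      then have j: "real j + 1 \<le> real p" by auto
      then have "real j + 1 \<le> y / e" using p by linarith
      then have "(real j + 1) * e \<le> y" using e by (simp add: field_simps)
      then have "t j < f x" using t(2)[of j] unfolding y_def by linarith
      moreover have "real j < real N" using j p y by linarith
      ultimately show "j \<in> S" by (simp add: S_def)
    qed
    then have lo: "p \<le> card S" using card_mono[of S "{..<p}"] by (simp add: S_def)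
    have "S \<subseteq> {..<Suc p}"
    proof
      fix j assume "j \<in> S"
      then have "real j * e < y" using t(1)[of j] by (simp add: S_def y_def)
      then have "real j < y / e" using e by (simp add: field_simps)
      then have "real j < real (Suc p)" using p by simp
      then show "j \<in> {..<Suc p}" by simp
    qed
    then have hi: "card S \<le> Suc p" using card_mono[of "{..<Suc p}" S] by simp
    have "(\<Sum>j<Suc N. a j * indicator (A j) x) = (\<Sum>j<N. a j * indicator (A j) x) - B"
      using x by (simp add: a_def A_def)
    also have "(\<Sum>j<N. a j * indicator (A j) x) = (\<Sum>j<N. if t j < f x then e else 0)"
      by (rule sum.cong) (use x in \<open>auto simp: a_def A_def\<close>)
    also have "\<dots> = real (card S) * e"
      by (simp add: sum.If_cases S_def) (simp add: Int_def conj_commute)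
    finally have eq: "(\<Sum>j<Suc N. a j * indicator (A j) x) = real (card S) * e - B" .
    have "real p * e \<le> y" "y \<le> (real p + 1) * e"
      using p e by (auto simp: field_simps)
    moreover have "real p * e \<le> real (card S) * e" "real (card S) * e \<le> (real p + 1) * e"
      using lo hi e by (auto intro!: mult_right_mono)
    ultimately have "\<bar>y - real (card S) * e\<bar> \<le> e" by (simp add: abs_le_iff algebra_simps)
    then show "\<bar>f x - (\<Sum>j<Suc N. a j * indicator (A j) x)\<bar> \<le> e"
      unfolding eq y_def by (simp add: algebra_simps)
  qed
qed

text \<open>Approximability is preserved by complements and countable unions. It is proved for two
  measures at once because a single approximating set must serve both \<nu> and \<mu> later.\<close>

lemma approx_generating_algebra:
  assumes "algebra \<Omega> \<A>" and P: "finite_measure P" "sets P = sigma_sets \<Omega> \<A>"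
    and R: "finite_measure R" "sets R = sigma_sets \<Omega> \<A>"
    and B: "B \<in> sigma_sets \<Omega> \<A>" and "e > 0"
  shows "\<exists>A\<in>\<A>. measure P (A - B \<union> (B - A)) < e \<and> measure R (A - B \<union> (B - A)) < e"
  using B \<open>e > 0\<close>
proof (induction arbitrary: e rule: sigma_sets.induct)
  case (Basic a)
  then show ?case by (intro bexI[of _ a]) auto
next
  case Empty
  interpret algebra \<Omega> \<A> by fact
  show ?case using Empty by (intro bexI[of _ "{}"]) auto
next
  case (Compl a)
  interpret algebra \<Omega> \<A> by fact
  obtain A where A: "A \<in> \<A>" "measure P (A - a \<union> (a - A)) < e" "measure R (A - a \<union> (a - A)) < e"
    using Compl by blast
  have "a \<subseteq> \<Omega>" using sigma_sets_into_sp[OF _ Compl(1)] space_closed by blast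
  moreover have "A \<subseteq> \<Omega>" using A(1) sets_into_space by blast
  ultimately have "(\<Omega> - A) - (\<Omega> - a) \<union> ((\<Omega> - a) - (\<Omega> - A)) = A - a \<union> (a - A)" by blast
  then show ?case using A by (intro bexI[of _ "\<Omega> - A"]) auto
next
  case (Union a)
  interpret algebra \<Omega> \<A> by fact
  interpret P: finite_measure P by fact
  interpret R: finite_measure R by fact
  have aP: "a i \<in> sets P" for i using Union(1) P by simp
  have aR: "a i \<in> sets R" for i using Union(1) R by simp
  define U where "U K = (\<Union>i<K. a i)" for K
  have UP: "U K \<in> sets P" "U K \<in> sets R" for K using aP aR by (auto simp: U_def)
  have un: "(\<Union>K. U K) = (\<Union>i. a i)" unfolding U_def by blast
  have inc: "incseq U" unfolding U_def incseq_def by (auto intro: less_le_trans)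
  have "(\<lambda>K. measure P (U K)) \<longlonglongrightarrow> measure P (\<Union>i. a i)"
    using P.finite_Lim_measure_incseq[OF _ inc] UP un by auto
  then have evP: "eventually (\<lambda>K. measure P (\<Union>i. a i) - e / 2 < measure P (U K)) sequentially"
    using Union.prems by (intro order_tendstoD) auto
  have "(\<lambda>K. measure R (U K)) \<longlonglongrightarrow> measure R (\<Union>i. a i)"
    using R.finite_Lim_measure_incseq[OF _ inc] UP un by auto
  then have evR: "eventually (\<lambda>K. measure R (\<Union>i. a i) - e / 2 < measure R (U K)) sequentially"
    using Union.prems by (intro order_tendstoD) auto
  obtain K where K: "measure P (\<Union>i. a i) - e / 2 < measure P (U K)"
    "measure R (\<Union>i. a i) - e / 2 < measure R (U K)"
    using eventually_conj[OF evP evR] by (auto simp: eventually_sequentially)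
  \<comment> \<open>The tail beyond K costs less than e/2 by the choice of K, and the K
    approximation errors of size d together cost at most e/2.\<close>
  define d where "d = e / (2 * (real K + 1))"
  have d: "d > 0" using Union.prems by (simp add: d_def)
  have "\<exists>A. \<forall>i. A i \<in> \<A> \<and> measure P (A i - a i \<union> (a i - A i)) < d \<and> measure R (A i - a i \<union> (a i - A i)) < d"
    by (rule choice) (use Union.IH d in blast)
  then obtain A where A: "\<And>i. A i \<in> \<A>" "\<And>i. measure P (A i - a i \<union> (a i - A i)) < d"
    "\<And>i. measure R (A i - a i \<union> (a i - A i)) < d" by blast
  have mem: "(\<Union>i<K. A i) \<in> \<A>" using A by auto
  have small: "measure Q ((\<Union>i<K. A i) - (\<Union>i. a i) \<union> ((\<Union>i. a i) - (\<Union>i<K. A i))) < e"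
    if Q: "finite_measure Q" "sets Q = sigma_sets \<Omega> \<A>" "measure Q (\<Union>i. a i) - e / 2 < measure Q (U K)"
      and dQ: "\<And>i. measure Q (A i - a i \<union> (a i - A i)) < d" for Q
  proof -
    interpret Q: finite_measure Q by fact
    have aQ: "a i \<in> sets Q" "A i \<in> sets Q" for i using Union(1) Q A(1) by auto
    have UQ: "U K \<in> sets Q" "(\<Union>i. a i) \<in> sets Q" using aQ by (auto simp: U_def)
    let ?D = "\<Union>i<K. A i - a i \<union> (a i - A i)"
    have "measure Q ((\<Union>i<K. A i) - (\<Union>i. a i) \<union> ((\<Union>i. a i) - (\<Union>i<K. A i)))
        \<le> measure Q (((\<Union>i. a i) - U K) \<union> ?D)"
      by (rule Q.finite_measure_mono) (use aQ UQ in \<open>auto simp: U_def\<close>)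
    also have "\<dots> \<le> measure Q ((\<Union>i. a i) - U K) + measure Q ?D"
      by (rule measure_Un_le) (use aQ UQ in auto)
    also have "measure Q ((\<Union>i. a i) - U K) = measure Q (\<Union>i. a i) - measure Q (U K)"
      by (rule Q.finite_measure_Diff) (use UQ in \<open>auto simp: U_def\<close>)
    also have "measure Q ?D \<le> (\<Sum>i<K. measure Q (A i - a i \<union> (a i - A i)))"
      by (rule measure_UNION_le) (use aQ in auto)
    also have "(\<Sum>i<K. measure Q (A i - a i \<union> (a i - A i))) \<le> (\<Sum>i<K. d)"
      by (rule sum_mono) (use dQ less_imp_le in blast)
    also have "(\<Sum>i<K. d) \<le> e / 2" using Union.prems by (simp add: d_def field_simps)
    finally show ?thesis using Q(3) by linarith
  qed
  show ?case
    by (intro bexI[OF _ mem] conjI small P R K A)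
qed

locale continuity_algebra = perfect_topology X for X :: "'b topology" +
  fixes \<mu> :: "'b measure"
  assumes mu: "\<mu> \<in> borel_probs X"
begin

sublocale M: prob_space \<mu> using mu by (rule borel_probsD)

text \<open>The \<open>\<mu>\<close>-continuity sets, described by the existence of continuous functions that squeeze the
  indicator.\<close>
definition cont_sets :: "'b set set" where
  "cont_sets = {A \<in> sets (borel_of X). \<forall>e>0. \<exists>g h. bounded_continuous X g \<and> bounded_continuous X h
     \<and> (\<forall>x\<in>topspace X. g x \<le> indicator A x \<and> indicator A x \<le> h x)
     \<and> (\<integral>x. h x \<partial>\<mu>) - (\<integral>x. g x \<partial>\<mu>) < e}"

lemma cont_setsE:
  assumes "A \<in> cont_sets" "e > 0"
  obtains g h where "bounded_continuous X g" "bounded_continuous X h"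
    "\<And>x. x \<in> topspace X \<Longrightarrow> g x \<le> indicator A x" "\<And>x. x \<in> topspace X \<Longrightarrow> indicator A x \<le> h x"
    "(\<integral>x. h x \<partial>\<mu>) - (\<integral>x. g x \<partial>\<mu>) < e"
  using assms unfolding cont_sets_def by blast

lemma cont_sets_borel: "A \<in> cont_sets \<Longrightarrow> A \<in> sets (borel_of X)"
  by (simp add: cont_sets_def)

text \<open>Brackets g \<le> h of A pass to 1 - h \<le> 1 - g for the complement and to the
  pointwise maxima for a union; the gap of the maxima is at most the sum of the gaps.\<close>

lemma algebra_cont_sets: "algebra (topspace X) cont_sets"
  unfolding algebra_iff_Un
proof (intro conjI ballI)
  show "cont_sets \<subseteq> Pow (topspace X)"
    using cont_sets_borel sets.sets_into_space[of _ "borel_of X"] by auto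
  show "{} \<in> cont_sets" unfolding cont_sets_def
    by (auto intro!: exI[of _ "\<lambda>_. 0"] bounded_continuous_const)
  fix A assume A: "A \<in> cont_sets"
  show "topspace X - A \<in> cont_sets"
    unfolding cont_sets_def
  proof (intro CollectI conjI allI impI)
    show "topspace X - A \<in> sets (borel_of X)"
      using sets.compl_sets[OF cont_sets_borel[OF A]] by simp
    fix e :: real assume "e > 0"
    then obtain g h where gh: "bounded_continuous X g" "bounded_continuous X h"
    "\<And>x. x \<in> topspace X \<Longrightarrow> g x \<le> indicator A x" "\<And>x. x \<in> topspace X \<Longrightarrow> indicator A x \<le> h x"
    "(\<integral>x. h x \<partial>\<mu>) - (\<integral>x. g x \<partial>\<mu>) < e"
      using cont_setsE[OF A] by metis
    have lt: "(\<integral>x. 1 - g x \<partial>\<mu>) - (\<integral>x. 1 - h x \<partial>\<mu>) < e"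
      using gh(1,2,5) bounded_continuous_integrable[OF _ mu] by (simp add: M.prob_space)
    show "\<exists>g h. bounded_continuous X g \<and> bounded_continuous X h \<and>
       (\<forall>x\<in>topspace X. g x \<le> indicator (topspace X - A) x \<and> indicator (topspace X - A) x \<le> h x) \<and>
       (\<integral>x. h x \<partial>\<mu>) - (\<integral>x. g x \<partial>\<mu>) < e"
    proof (rule exI[of _ "\<lambda>x. 1 - h x"], rule exI[of _ "\<lambda>x. 1 - g x"], intro conjI ballI)
      fix x assume x: "x \<in> topspace X"
      have "indicator (topspace X - A) x = 1 - (indicator A x :: real)"
        using x by (simp add: indicator_def)
      then show "1 - h x \<le> indicator (topspace X - A) x" "indicator (topspace X - A) x \<le> 1 - g x"
        using gh(3,4)[OF x] by auto
    qed (use gh(1,2) lt in \<open>auto intro!: bounded_continuous_intros\<close>)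
  qed
  fix B assume B: "B \<in> cont_sets"
  show "A \<union> B \<in> cont_sets"
    unfolding cont_sets_def
  proof (intro CollectI conjI allI impI)
    show "A \<union> B \<in> sets (borel_of X)"
      using cont_sets_borel A B by blast
    fix e :: real assume "e > 0"
    then have e2: "e / 2 > 0" by simp
    obtain g h where gh: "bounded_continuous X g" "bounded_continuous X h"
    "\<And>x. x \<in> topspace X \<Longrightarrow> g x \<le> indicator A x" "\<And>x. x \<in> topspace X \<Longrightarrow> indicator A x \<le> h x"
    "(\<integral>x. h x \<partial>\<mu>) - (\<integral>x. g x \<partial>\<mu>) < e / 2"
      using cont_setsE[OF A e2] by metis
    obtain g' h' where gh': "bounded_continuous X g'" "bounded_continuous X h'"
    "\<And>x. x \<in> topspace X \<Longrightarrow> g' x \<le> indicator B x" "\<And>x. x \<in> topspace X \<Longrightarrow> indicator B x \<le> h' x"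
    "(\<integral>x. h' x \<partial>\<mu>) - (\<integral>x. g' x \<partial>\<mu>) < e / 2"
      using cont_setsE[OF B e2] by metis
    note int = bounded_continuous_integrable[OF _ mu]
    let ?g = "\<lambda>x. max (g x) (g' x)" and ?h = "\<lambda>x. max (h x) (h' x)"
    have bc: "bounded_continuous X ?g" "bounded_continuous X ?h"
      by (intro bounded_continuous_intros gh gh')+
    have "(\<integral>x. ?h x - ?g x \<partial>\<mu>) \<le> (\<integral>x. (h x - g x) + (h' x - g' x) \<partial>\<mu>)"
    proof (rule integral_mono)
      fix x assume "x \<in> space \<mu>"
      then have x: "x \<in> topspace X" using borel_probsD(3)[OF mu] by simp
      show "?h x - ?g x \<le> (h x - g x) + (h' x - g' x)"
        using gh(3,4)[OF x] gh'(3,4)[OF x] by linarith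
    qed (use int gh gh' bc in auto)
    then have "(\<integral>x. ?h x \<partial>\<mu>) - (\<integral>x. ?g x \<partial>\<mu>) < e"
      using gh(5) gh'(5) int gh(1,2) gh'(1,2) bc by simp
    moreover have "?g x \<le> indicator (A \<union> B) x \<and> indicator (A \<union> B) x \<le> ?h x" if "x \<in> topspace X" for x
      using gh(3,4)[OF that] gh'(3,4)[OF that] by (auto simp: indicator_def split: if_splits)
    ultimately show "\<exists>g h. bounded_continuous X g \<and> bounded_continuous X h \<and>
       (\<forall>x\<in>topspace X. g x \<le> indicator (A \<union> B) x \<and> indicator (A \<union> B) x \<le> h x) \<and>
       (\<integral>x. h x \<partial>\<mu>) - (\<integral>x. g x \<partial>\<mu>) < e"
      using bc by (intro exI[of _ ?g] exI[of _ ?h]) auto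
  qed
qed

text \<open>Lower and upper ramps of slope j at level t differ by exactly 1 where f = t and agree
  elsewhere once j is large. Their gap thus tends to the measure of {f = t}, which vanishes.\<close>

lemma superlevel_cont_sets:
  assumes f: "bounded_continuous X f" and t: "measure \<mu> {x \<in> topspace X. f x = t} = 0"
  shows "{x \<in> topspace X. t < f x} \<in> cont_sets"
  unfolding cont_sets_def
proof (intro CollectI conjI allI impI)
  have fm: "f \<in> borel_measurable \<mu>" using bounded_continuous_measurable[OF f mu] .
  have spc: "space \<mu> = topspace X" using borel_probsD(3)[OF mu] .
  have "{x \<in> space \<mu>. t < f x} \<in> sets \<mu>" using fm by simp
  then show "{x \<in> topspace X. t < f x} \<in> sets (borel_of X)"
    using borel_probsD[OF mu] by simp
  define h where "h j x = max 0 (min 1 (1 + real j * (f x - t)))" for j x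
  define g where "g j x = max 0 (min 1 (0 + real j * (f x - t)))" for j x
  have bc: "bounded_continuous X (g j)" "bounded_continuous X (h j)" for j
    unfolding g_def h_def by (intro bounded_continuous_clamp f)+
  let ?E = "{x \<in> topspace X. f x = t}"
  have Es: "?E \<in> sets \<mu>"
  proof -
    have "{x \<in> space \<mu>. f x = t} \<in> sets \<mu>" using fm by simp
    then show ?thesis by (simp add: spc)
  qed
  have "(\<lambda>j. \<integral>x. h j x - g j x \<partial>\<mu>) \<longlonglongrightarrow> (\<integral>x. indicator ?E x \<partial>\<mu>)"
  proof (rule integral_dominated_convergence[where w="\<lambda>_. 1"])
    show "AE x in \<mu>. (\<lambda>j. h j x - g j x) \<longlonglongrightarrow> indicator ?E x"
    proof (rule AE_I2)
      fix x assume "x \<in> space \<mu>"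
      then have x: "x \<in> topspace X" using spc by simp
      show "(\<lambda>j. h j x - g j x) \<longlonglongrightarrow> indicator ?E x"
      proof (cases "f x = t")
        case True
        then show ?thesis using x by (simp add: h_def g_def)
      next
        case False
        obtain n where n: "1 / \<bar>f x - t\<bar> < real n" using reals_Archimedean2 by blast
        have "h j x - g j x = 0" if "j \<ge> n" for j
        proof -
          have "1 / \<bar>f x - t\<bar> \<le> real j" using n that by linarith
          then have "1 \<le> real j * \<bar>f x - t\<bar>" using False by (simp add: field_simps)
          then have "1 \<le> \<bar>real j * (f x - t)\<bar>" by (simp add: abs_mult)
          then show ?thesis unfolding h_def g_def by linarith
        qed
        then have "eventually (\<lambda>j. h j x - g j x = 0) sequentially"
          unfolding eventually_sequentially by blast
        then show ?thesis using False by (simp add: tendsto_eventually)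
      qed
    qed
    show "(\<lambda>x. h j x - g j x) \<in> borel_measurable \<mu>" for j
      by (intro borel_measurable_diff bounded_continuous_measurable[OF _ mu] bc)
    show "AE x in \<mu>. norm (h j x - g j x) \<le> 1" for j by (auto simp: g_def h_def)
  qed (use Es in auto)
  moreover have "?E \<inter> space \<mu> = ?E" using spc by auto
  then have "(\<integral>x. indicator ?E x \<partial>\<mu>) = (0 :: real)"
    by (simp only: Bochner_Integration.integral_indicator t)
  ultimately have lim: "(\<lambda>j. (\<integral>x. h j x \<partial>\<mu>) - (\<integral>x. g j x \<partial>\<mu>)) \<longlonglongrightarrow> 0"
    using bounded_continuous_integrable[OF _ mu] bc
    by (simp only: Bochner_Integration.integral_diff)
  fix e :: real assume "e > 0"
  then have "eventually (\<lambda>j. (\<integral>x. h j x \<partial>\<mu>) - (\<integral>x. g j x \<partial>\<mu>) < e) sequentially"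
    using order_tendstoD(2)[OF lim] by blast
  then obtain j where j: "(\<integral>x. h j x \<partial>\<mu>) - (\<integral>x. g j x \<partial>\<mu>) < e"
    by (auto simp: eventually_sequentially)
  have "g j x \<le> indicator {x \<in> topspace X. t < f x} x \<and> indicator {x \<in> topspace X. t < f x} x \<le> h j x"
    if "x \<in> topspace X" for x
  proof (cases "t < f x")
    case True
    then have "0 \<le> real j * (f x - t)" by simp
    then show ?thesis using True that by (auto simp: g_def h_def)
  next
    case False
    then have "real j * (f x - t) \<le> 0" by (simp add: mult_nonneg_nonpos)
    then show ?thesis using False that by (auto simp: g_def h_def)
  qed
  then show "\<exists>g h. bounded_continuous X g \<and> bounded_continuous X h \<and>
      (\<forall>x\<in>topspace X. g x \<le> indicator {x \<in> topspace X. t < f x} x \<and> indicator {x \<in> topspace X. t < f x} x \<le> h x) \<and>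
      (\<integral>x. h x \<partial>\<mu>) - (\<integral>x. g x \<partial>\<mu>) < e"
    using bc j by (intro exI[of _ "g j"] exI[of _ "h j"]) auto
qed

text \<open>The image of \<mu> under f has countably many atoms, whereas an open interval is
  uncountable.\<close>

lemma superlevel_cont_sets_dense:
  assumes f: "bounded_continuous X f" and "a < b"
  shows "\<exists>t. a < t \<and> t < b \<and> {x \<in> topspace X. t < f x} \<in> cont_sets"
proof -
  have fm: "f \<in> borel_measurable \<mu>" using bounded_continuous_measurable[OF f mu] .
  interpret D: prob_space "distr \<mu> borel f" by (rule M.prob_space_distr[OF fm])
  have "\<not> {a<..<b} \<subseteq> {t. measure (distr \<mu> borel f) {t} \<noteq> 0}"
    using countable_subset[OF _ D.countable_support] uncountable_open_interval \<open>a < b\<close> by blast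
  then obtain t where t: "a < t" "t < b" "measure (distr \<mu> borel f) {t} = 0" by auto
  have "f -` {t} \<inter> space \<mu> = {x \<in> topspace X. f x = t}" using borel_probsD(3)[OF mu] by auto
  then have "measure \<mu> {x \<in> topspace X. f x = t} = 0"
    using t(3) fm by (simp add: measure_distr)
  then show ?thesis using superlevel_cont_sets[OF f] t by blast
qed

text \<open>An open set {0 < f} is the union of the sets {t j < f} over good levels
  \<open>t j\<close> that tend to 0.\<close>

lemma sigma_sets_cont_sets: "sigma_sets (topspace X) cont_sets = sets (borel_of X)"
proof (rule antisym)
  have "sigma_sets (space (borel_of X)) cont_sets \<subseteq> sets (borel_of X)"
    by (rule sets.sigma_sets_subset) (use cont_sets_borel in auto)
  then show "sigma_sets (topspace X) cont_sets \<subseteq> sets (borel_of X)" by simp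
  show "sets (borel_of X) \<subseteq> sigma_sets (topspace X) cont_sets"
    unfolding sets_borel_of
  proof (rule sigma_sets_mono, rule subsetI)
    fix U assume "U \<in> {U. openin X U}"
    then obtain f where f: "bounded_continuous X f" "\<forall>x\<in>topspace X. 0 \<le> f x" "U = {x \<in> topspace X. 0 < f x}"
      using cozero by blast
    have "\<exists>t. \<forall>j::nat. 0 < t j \<and> t j < inverse (real (Suc j)) \<and> {x \<in> topspace X. t j < f x} \<in> cont_sets"
      by (rule choice, intro allI superlevel_cont_sets_dense[OF f(1)]) simp
    then obtain t where t: "\<And>j::nat. 0 < t j" "\<And>j. t j < inverse (real (Suc j))"
      "\<And>j. {x \<in> topspace X. t j < f x} \<in> cont_sets" by blast
    have "U = (\<Union>j. {x \<in> topspace X. t j < f x})"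
    proof (rule set_eqI)
      fix x
      show "x \<in> U \<longleftrightarrow> x \<in> (\<Union>j. {x \<in> topspace X. t j < f x})"
      proof
        assume "x \<in> U"
        then have x: "x \<in> topspace X" "0 < f x" using f by auto
        obtain j where "inverse (real (Suc j)) < f x" using reals_Archimedean[OF x(2)] by blast
        then have "t j < f x" using t(2)[of j] by linarith
        then show "x \<in> (\<Union>j. {x \<in> topspace X. t j < f x})" using x by auto
      next
        assume "x \<in> (\<Union>j. {x \<in> topspace X. t j < f x})"
        then obtain j where "x \<in> topspace X" "t j < f x" by auto
        then show "x \<in> U" using t(1)[of j] f(3) by auto
      qed
    qed
    then show "U \<in> sigma_sets (topspace X) cont_sets"
      using t(3) by (auto intro: sigma_sets.Union)
  qed
qed

end

section \<open>Entropy bounds tested on continuity sets\<close>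

lemma abs_exp_diff_le:
  fixes u v :: real
  assumes "u \<le> M" "v \<le> M"
  shows "\<bar>exp u - exp v\<bar> \<le> exp M * \<bar>u - v\<bar>"
proof -
  have *: "exp u - exp v \<le> exp M * \<bar>u - v\<bar>" if "u \<le> M" for u v :: real
  proof -
    have "1 + (v - u) \<le> exp (v - u)" by (rule exp_ge_add_one_self)
    then have "exp u * (1 + (v - u)) \<le> exp u * exp (v - u)" by (intro mult_left_mono) auto
    then have "exp u - exp v \<le> exp u * (u - v)" by (simp add: exp_add[symmetric] algebra_simps)
    also have "\<dots> \<le> exp u * \<bar>u - v\<bar>" by (intro mult_left_mono) auto
    also have "\<dots> \<le> exp M * \<bar>u - v\<bar>" using that by (intro mult_right_mono) auto
    finally show ?thesis .
  qed
  show ?thesis using *[OF assms(1), of v] *[OF assms(2), of u] by (simp add: abs_le_iff abs_minus_commute)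
qed

lemma abs_step_function_le:
  "\<bar>\<Sum>j<N. a j * indicator (A j) x\<bar> \<le> (\<Sum>j<N. \<bar>a j\<bar> :: real)"
proof -
  have "\<bar>\<Sum>j<N. a j * indicator (A j) x\<bar> \<le> (\<Sum>j<N. \<bar>a j * indicator (A j) x\<bar>)" by (rule sum_abs)
  also have "\<dots> \<le> (\<Sum>j<N. \<bar>a j\<bar>)" by (rule sum_mono) (auto simp: indicator_def)
  finally show ?thesis .
qed

lemma (in prob_space) integral_step_function:
  assumes "\<And>j. j < N \<Longrightarrow> A j \<in> sets M"
  shows "integrable M (\<lambda>x. \<Sum>j<N. a j * indicator (A j) x :: real)"
    and "(\<integral>x. (\<Sum>j<N. a j * indicator (A j) x) \<partial>M) = (\<Sum>j<N. a j * measure M (A j))"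
proof -
  have i: "integrable M (\<lambda>x. a j * indicator (A j) x :: real)" if "j < N" for j
    using assms[OF that] by (intro integrable_mult_right integrable_real_indicator) (auto simp: less_top[symmetric])
  then show "integrable M (\<lambda>x. \<Sum>j<N. a j * indicator (A j) x :: real)" by auto
  have "(\<integral>x. (\<Sum>j<N. a j * indicator (A j) x) \<partial>M) = (\<Sum>j<N. \<integral>x. a j * indicator (A j) x \<partial>M)"
    using i by (intro Bochner_Integration.integral_sum) auto
  also have "\<dots> = (\<Sum>j<N. a j * measure M (A j))"
    using assms sets.sets_into_space[of _ M] by (intro sum.cong refl) (simp add: Int_absorb2)
  finally show "(\<integral>x. (\<Sum>j<N. a j * indicator (A j) x) \<partial>M) = (\<Sum>j<N. a j * measure M (A j))" .
qed

lemma (in finite_measure) abs_measure_diff_le: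
  assumes "A \<in> sets M" "B \<in> sets M"
  shows "\<bar>measure M A - measure M B\<bar> \<le> measure M (A - B \<union> (B - A))"
proof -
  let ?D = "A - B \<union> (B - A)"
  have "measure M A \<le> measure M (B \<union> ?D)" "measure M B \<le> measure M (A \<union> ?D)"
    using assms by (auto intro!: finite_measure_mono)
  moreover have "measure M (B \<union> ?D) \<le> measure M B + measure M ?D" "measure M (A \<union> ?D) \<le> measure M A + measure M ?D"
    using assms by (auto intro!: measure_Un_le)
  ultimately show ?thesis by (simp add: abs_le_iff)
qed

context continuity_algebra
begin

text \<open>The log-Laplace functional of \<mu> at a step function. Step functions are coded by
  triples (N, a, A), so that later a finite set of them can be extracted by compactness.\<close>

definition pressure :: "nat \<Rightarrow> (nat \<Rightarrow> real) \<Rightarrow> (nat \<Rightarrow> 'b set) \<Rightarrow> real" where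
  "pressure N a A = ln (\<integral>x. exp (\<Sum>j<N. a j * indicator (A j) x) \<partial>\<mu>)"

text \<open>The Donsker--Varadhan bound \<open>H(\<psi>|\<mu>) \<le> c\<close>, tested on step functions over continuity sets only
  and therefore meaningful for a set function \<open>\<psi>\<close>.\<close>
definition entropy_bounded :: "real \<Rightarrow> ('b set \<Rightarrow> real) \<Rightarrow> bool" where
  "entropy_bounded c \<psi> \<longleftrightarrow> (\<forall>N a A. (\<forall>j<N. A j \<in> cont_sets) \<longrightarrow>
     (\<Sum>j<N. a j * \<psi> (A j)) \<le> c + pressure N a A)"

definition entropy_ball :: "real \<Rightarrow> 'b measure set" where
  "entropy_ball c = {\<nu> \<in> borel_probs X. rel_entropy \<nu> \<mu> \<le> ereal c}"

lemma cont_sets_events: "\<nu> \<in> borel_probs X \<Longrightarrow> A \<in> cont_sets \<Longrightarrow> A \<in> sets \<nu>"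
  using cont_sets_borel borel_probsD(2) by blast

lemma sets_mu: "sets \<mu> = sets (borel_of X)"
  by (rule borel_probsD(2)[OF mu])

lemma exp_step_function_integral:
  assumes "\<And>j. j < N \<Longrightarrow> A j \<in> sets \<mu>"
  shows "integrable \<mu> (\<lambda>x. exp (\<Sum>j<N. a j * indicator (A j) x :: real))"
    and "exp (- (\<Sum>j<N. \<bar>a j\<bar>)) \<le> (\<integral>x. exp (\<Sum>j<N. a j * indicator (A j) x) \<partial>\<mu>)"
proof -
  let ?s = "\<lambda>x. \<Sum>j<N. a j * indicator (A j) x :: real"
  have m: "?s \<in> borel_measurable \<mu>" using M.integral_step_function(1)[where N=N and A=A and a=a, OF assms] by auto
  have b: "- (\<Sum>j<N. \<bar>a j\<bar>) \<le> ?s x" "?s x \<le> (\<Sum>j<N. \<bar>a j\<bar>)" for x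
    using abs_step_function_le[where N=N and a=a and A=A and x=x] by (auto simp: abs_le_iff)
  show i: "integrable \<mu> (\<lambda>x. exp (?s x))"
    by (rule M.integrable_const_bound[where B="exp (\<Sum>j<N. \<bar>a j\<bar>)"]) (use b m in auto)
  have "(\<integral>x. exp (- (\<Sum>j<N. \<bar>a j\<bar>)) \<partial>\<mu>) \<le> (\<integral>x. exp (?s x) \<partial>\<mu>)"
    by (rule integral_mono) (use i b in auto)
  then show "exp (- (\<Sum>j<N. \<bar>a j\<bar>)) \<le> (\<integral>x. exp (?s x) \<partial>\<mu>)" by (simp add: M.prob_space)
qed

lemma exp_step_function_integral_pos:
  assumes "\<And>j. j < N \<Longrightarrow> A j \<in> sets \<mu>"
  shows "0 < (\<integral>x. exp (\<Sum>j<N. a j * indicator (A j) x :: real) \<partial>\<mu>)"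
  using exp_step_function_integral(2)[where N=N and A=A and a=a, OF assms]
    exp_gt_zero[of "- (\<Sum>j<N. \<bar>a j\<bar>)"] by linarith

lemma entropy_ball_imp_bounded:
  assumes "\<nu> \<in> entropy_ball c"
  shows "entropy_bounded c (measure \<nu>)"
  unfolding entropy_bounded_def
proof (intro allI impI)
  fix N a and A :: "nat \<Rightarrow> 'b set" assume A: "\<forall>j<N. A j \<in> cont_sets"
  have \<nu>: "\<nu> \<in> borel_probs X" "rel_entropy \<nu> \<mu> \<le> ereal c"
    using assms by (auto simp: entropy_ball_def)
  interpret N: prob_space \<nu> using \<nu> borel_probsD by blast
  have "(\<integral>x. (\<Sum>j<N. a j * indicator (A j) x) \<partial>\<nu>) \<le> c + ln (\<integral>x. exp (\<Sum>j<N. a j * indicator (A j) x) \<partial>\<mu>)"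
  proof (rule Donsker_Varadhan_le)
    show "\<bar>\<Sum>j<N. a j * indicator (A j) x\<bar> \<le> (\<Sum>j<N. \<bar>a j\<bar>)" for x by (rule abs_step_function_le)
    show "(\<lambda>x. \<Sum>j<N. a j * indicator (A j) x) \<in> borel_measurable \<mu>"
      using M.integral_step_function(1)[of N A a] A cont_sets_events[OF mu] by auto
  qed (use \<nu> borel_probsD(2)[OF \<nu>(1)] sets_mu N.prob_space_axioms M.prob_space_axioms in auto)
  moreover have "(\<integral>x. (\<Sum>j<N. a j * indicator (A j) x) \<partial>\<nu>) = (\<Sum>j<N. a j * measure \<nu> (A j))"
    by (rule N.integral_step_function(2)) (use A cont_sets_events[OF \<nu>(1)] in auto)
  ultimately show "(\<Sum>j<N. a j * measure \<nu> (A j)) \<le> c + pressure N a A" by (simp add: pressure_def)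
qed

text \<open>Passage from continuity sets to Borel sets: each \<open>B j\<close> is approximated
  within 1/(i+1) by a continuity set, simultaneously for \<nu> on the left side and \<mu> on the
  right, and both sides converge.\<close>

lemma entropy_bounded_step_function:
  fixes B :: "nat \<Rightarrow> 'b set"
  assumes \<nu>: "\<nu> \<in> borel_probs X" and c: "entropy_bounded c (measure \<nu>)"
    and B: "\<And>j. j < N \<Longrightarrow> B j \<in> sets (borel_of X)"
  shows "(\<Sum>j<N. a j * measure \<nu> (B j)) \<le> c + pressure N a B"
proof -
  interpret N: prob_space \<nu> using \<nu> borel_probsD by blast
  have s\<nu>: "sets \<nu> = sets (borel_of X)" using borel_probsD(2)[OF \<nu>] .
  have ex: "\<exists>A. j < N \<longrightarrow> A \<in> cont_sets \<and> measure \<nu> (A - B j \<union> (B j - A)) < 1 / (real i + 1)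
      \<and> measure \<mu> (A - B j \<union> (B j - A)) < 1 / (real i + 1)" for i j
  proof (cases "j < N")
    case True
    have "\<exists>A\<in>cont_sets. measure \<nu> (A - B j \<union> (B j - A)) < 1 / (real i + 1)
      \<and> measure \<mu> (A - B j \<union> (B j - A)) < 1 / (real i + 1)"
      by (rule approx_generating_algebra[OF algebra_cont_sets])
        (use s\<nu> sets_mu sigma_sets_cont_sets B[OF True] N.finite_measure_axioms M.finite_measure_axioms in auto)
    then show ?thesis by blast
  qed simp
  have "\<exists>A. \<forall>i j. j < N \<longrightarrow> A i j \<in> cont_sets \<and> measure \<nu> (A i j - B j \<union> (B j - A i j)) < 1 / (real i + 1)
      \<and> measure \<mu> (A i j - B j \<union> (B j - A i j)) < 1 / (real i + 1)"
    by (rule choice, rule allI, rule choice, rule allI) (rule ex)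
  then obtain A where A: "\<And>i j. j < N \<Longrightarrow> A i j \<in> cont_sets"
    "\<And>i j. j < N \<Longrightarrow> measure \<nu> (A i j - B j \<union> (B j - A i j)) < 1 / (real i + 1)"
    "\<And>i j. j < N \<Longrightarrow> measure \<mu> (A i j - B j \<union> (B j - A i j)) < 1 / (real i + 1)"
    by blast
  have inv0: "(\<lambda>i. 1 / (real i + 1)) \<longlonglongrightarrow> 0"
    using LIMSEQ_inverse_real_of_nat by (simp add: inverse_eq_divide add.commute)
  have ev: "A i j \<in> sets \<nu>" "A i j \<in> sets \<mu>" "B j \<in> sets \<nu>" "B j \<in> sets \<mu>" if "j < N" for i j
    using A(1)[OF that] B[OF that] cont_sets_borel s\<nu> sets_mu by auto
  have l1: "(\<lambda>i. measure \<nu> (A i j)) \<longlonglongrightarrow> measure \<nu> (B j)" if "j < N" for j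
  proof (rule Lim_transform_bound[OF _ inv0, THEN LIM_zero_cancel])
    show "\<forall>\<^sub>F i in sequentially. norm (measure \<nu> (A i j) - measure \<nu> (B j)) \<le> norm (1 / (real i + 1))"
    proof (intro always_eventually allI)
      fix i
      have "\<bar>measure \<nu> (A i j) - measure \<nu> (B j)\<bar> \<le> 1 / (real i + 1)"
        using N.abs_measure_diff_le[OF ev(1)[OF that] ev(3)[OF that]] A(2)[OF that]
        by (rule order_trans[OF _ less_imp_le])
      then show "norm (measure \<nu> (A i j) - measure \<nu> (B j)) \<le> norm (1 / (real i + 1))" by simp
    qed
  qed
  \<comment> \<open>A uniform bound for all step functions involved; below m the exponential is
    Lipschitz with constant exp m.\<close>
  define m where "m = (\<Sum>j<N. \<bar>a j\<bar>)"
  let ?s = "\<lambda>B x. \<Sum>j<N. a j * indicator (B j) x :: real"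
  have l2: "(\<lambda>i. \<integral>x. exp (?s (A i) x) \<partial>\<mu>) \<longlonglongrightarrow> (\<integral>x. exp (?s B x) \<partial>\<mu>)"
  proof (rule Lim_transform_bound[THEN LIM_zero_cancel])
    show "(\<lambda>i. exp m * (m * (1 / (real i + 1)))) \<longlonglongrightarrow> 0"
      by (rule tendsto_eq_intros inv0 | simp)+
    show "\<forall>\<^sub>F i in sequentially. norm ((\<integral>x. exp (?s (A i) x) \<partial>\<mu>) - (\<integral>x. exp (?s B x) \<partial>\<mu>))
        \<le> norm (exp m * (m * (1 / (real i + 1))))"
    proof (intro always_eventually allI)
      fix i
      have iA: "integrable \<mu> (\<lambda>x. exp (?s (A i) x))" and iB: "integrable \<mu> (\<lambda>x. exp (?s B x))"
        using exp_step_function_integral(1)[where N=N and a=a] ev by auto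
      let ?D = "\<lambda>j. A i j - B j \<union> (B j - A i j)"
      let ?t = "\<lambda>x. \<Sum>j<N. \<bar>a j\<bar> * indicator (?D j) x :: real"
      have tD: "integrable \<mu> ?t" "(\<integral>x. ?t x \<partial>\<mu>) = (\<Sum>j<N. \<bar>a j\<bar> * measure \<mu> (?D j))"
        using M.integral_step_function[where N=N and a="\<lambda>j. \<bar>a j\<bar>" and A="?D"] ev by auto
      have "norm ((\<integral>x. exp (?s (A i) x) \<partial>\<mu>) - (\<integral>x. exp (?s B x) \<partial>\<mu>))
          = norm (\<integral>x. exp (?s (A i) x) - exp (?s B x) \<partial>\<mu>)"
        using iA iB by simp
      also have "\<dots> \<le> (\<integral>x. norm (exp (?s (A i) x) - exp (?s B x)) \<partial>\<mu>)" by (rule integral_norm_bound)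
      also have "\<dots> \<le> (\<integral>x. exp m * ?t x \<partial>\<mu>)"
      proof (rule integral_mono)
        fix x
        have "norm (exp (?s (A i) x) - exp (?s B x)) \<le> exp m * \<bar>?s (A i) x - ?s B x\<bar>"
          using abs_step_function_le[where N=N and a=a and A="A i" and x=x]
            abs_step_function_le[where N=N and a=a and A=B and x=x]
          unfolding real_norm_def by (intro abs_exp_diff_le) (auto simp: m_def abs_le_iff)
        also have "\<bar>?s (A i) x - ?s B x\<bar> \<le> (\<Sum>j<N. \<bar>a j * indicator (A i j) x - a j * indicator (B j) x\<bar>)"
          unfolding sum_subtractf[symmetric] by (rule sum_abs)
        also have "\<dots> \<le> ?t x" by (rule sum_mono) (auto simp: indicator_def)
        finally show "norm (exp (?s (A i) x) - exp (?s B x)) \<le> exp m * ?t x" by simp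
      qed (use iA iB tD in auto)
      also have "\<dots> = exp m * (\<Sum>j<N. \<bar>a j\<bar> * measure \<mu> (?D j))" using tD by simp
      also have "\<dots> \<le> exp m * (\<Sum>j<N. \<bar>a j\<bar> * (1 / (real i + 1)))"
        by (intro mult_left_mono sum_mono) (use A(3) in \<open>auto intro: less_imp_le\<close>)
      also have "\<dots> = exp m * (m * (1 / (real i + 1)))" by (simp add: m_def sum_divide_distrib)
      also have "\<dots> \<le> norm (exp m * (m * (1 / (real i + 1))))"
        by (simp only: real_norm_def abs_ge_self)
      finally show "norm ((\<integral>x. exp (?s (A i) x) \<partial>\<mu>) - (\<integral>x. exp (?s B x) \<partial>\<mu>))
        \<le> norm (exp m * (m * (1 / (real i + 1))))" .
    qed
  qed
  have pos: "(\<integral>x. exp (?s B x) \<partial>\<mu>) \<noteq> 0"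
    using exp_step_function_integral_pos[where N=N and a=a and A=B] ev by force
  have "(\<lambda>i. c + pressure N a (A i)) \<longlonglongrightarrow> c + pressure N a B"
    unfolding pressure_def by (intro tendsto_intros l2 pos)
  moreover have "(\<lambda>i. \<Sum>j<N. a j * measure \<nu> (A i j)) \<longlonglongrightarrow> (\<Sum>j<N. a j * measure \<nu> (B j))"
    by (intro tendsto_intros l1) auto
  moreover have "(\<Sum>j<N. a j * measure \<nu> (A i j)) \<le> c + pressure N a (A i)" for i
    using c A(1) unfolding entropy_bounded_def by blast
  ultimately show ?thesis by (intro LIMSEQ_le) auto
qed

text \<open>A bounded measurable function is uniformly within e/2 of a step function. This costs e/2
  in the integral and another e/2 in the logarithm, after which the converse variational formula
  applies.\<close>

lemma entropy_bounded_imp_ball: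
  assumes \<nu>: "\<nu> \<in> borel_probs X" and c: "entropy_bounded c (measure \<nu>)"
  shows "\<nu> \<in> entropy_ball c"
proof -
  interpret N: prob_space \<nu> using \<nu> borel_probsD by blast
  have s\<nu>: "sets \<nu> = sets (borel_of X)" using borel_probsD(2)[OF \<nu>] .
  have spc: "space \<nu> = topspace X" "space \<mu> = topspace X" using borel_probsD(3) \<nu> mu by auto
  have "rel_entropy \<nu> \<mu> \<le> ereal c"
  proof (rule rel_entropy_le_Donsker_Varadhan)
    fix f :: "'b \<Rightarrow> real" and B assume f: "f \<in> borel_measurable \<mu>" and B: "\<And>x. x \<in> space \<mu> \<Longrightarrow> \<bar>f x\<bar> \<le> B"
    have f\<nu>: "f \<in> borel_measurable \<nu>" using f s\<nu> sets_mu by (auto simp: measurable_def spc)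
    have fi: "integrable \<nu> f"
      by (rule N.integrable_const_bound[where B=B]) (use B f\<nu> spc in auto)
    have ei: "integrable \<mu> (\<lambda>x. exp (f x))"
      by (rule M.integrable_const_bound[where B="exp B"]) (use B f in \<open>auto simp: abs_le_iff\<close>)
    have "exp (- B) = (\<integral>x. exp (- B) \<partial>\<mu>)" by (simp add: M.prob_space)
    also have "\<dots> \<le> (\<integral>x. exp (f x) \<partial>\<mu>)"
      by (rule integral_mono) (use ei B in \<open>auto simp: abs_le_iff minus_le_iff\<close>)
    finally have Z: "0 < (\<integral>x. exp (f x) \<partial>\<mu>)" using exp_gt_zero[of "- B"] by linarith
    show "(\<integral>x. f x \<partial>\<nu>) \<le> c + ln (\<integral>x. exp (f x) \<partial>\<mu>)"
    proof (rule field_le_epsilon)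
      fix e :: real assume "e > 0"
      then have e2: "e / 2 > 0" by simp
      obtain N a and A :: "nat \<Rightarrow> 'b set" where A: "\<And>j. j < N \<Longrightarrow> A j \<in> sets \<mu>"
        "\<And>x. x \<in> space \<mu> \<Longrightarrow> \<bar>f x - (\<Sum>j<N. a j * indicator (A j) x)\<bar> \<le> e / 2"
      proof (rule step_function_approximation[of "space \<mu>" f "sets \<mu>" B "e / 2"])
        show "\<exists>t>a. t < b \<and> {x \<in> space \<mu>. t < f x} \<in> M.events" if "a < b" for a b
          using dense[OF that] f by auto
      qed (use B e2 in auto)
      define s where "s x = (\<Sum>j<N. a j * indicator (A j) x)" for x
      have A\<nu>: "\<And>j. j < N \<Longrightarrow> A j \<in> sets \<nu>" using A(1) s\<nu> sets_mu by auto
      have near: "f x \<le> s x + e / 2" "s x \<le> e / 2 + f x" if "x \<in> topspace X" for x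
      proof -
        have "\<bar>f x - s x\<bar> \<le> e / 2" unfolding s_def by (rule A(2)) (use that spc in simp)
        then show "f x \<le> s x + e / 2" "s x \<le> e / 2 + f x" by linarith+
      qed
      have si: "integrable \<nu> s" "(\<integral>x. s x \<partial>\<nu>) = (\<Sum>j<N. a j * measure \<nu> (A j))"
        unfolding s_def using N.integral_step_function[where N=N and A=A and a=a, OF A\<nu>] by blast+
      have es: "integrable \<mu> (\<lambda>x. exp (s x))"
        unfolding s_def using exp_step_function_integral(1)[where N=N and A=A and a=a, OF A(1)] .
      have "(\<integral>x. f x \<partial>\<nu>) \<le> (\<integral>x. s x + e / 2 \<partial>\<nu>)"
        by (rule integral_mono) (use fi si near spc in auto)
      also have "\<dots> = (\<Sum>j<N. a j * measure \<nu> (A j)) + e / 2"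
        using si by (simp add: N.prob_space)
      also have "(\<Sum>j<N. a j * measure \<nu> (A j)) \<le> c + pressure N a A"
        by (rule entropy_bounded_step_function[OF \<nu> c]) (use A sets_mu in auto)
      also have "pressure N a A \<le> ln (exp (e / 2) * (\<integral>x. exp (f x) \<partial>\<mu>))"
        unfolding pressure_def s_def[symmetric]
      proof (subst ln_le_cancel_iff)
        show p: "0 < (\<integral>x. exp (s x) \<partial>\<mu>)"
          unfolding s_def by (rule exp_step_function_integral_pos[OF A(1)])
        show "0 < exp (e / 2) * (\<integral>x. exp (f x) \<partial>\<mu>)" using Z by simp
        have "(\<integral>x. exp (s x) \<partial>\<mu>) \<le> (\<integral>x. exp (e / 2) * exp (f x) \<partial>\<mu>)"
        proof (rule integral_mono)
          fix x assume "x \<in> space \<mu>"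
          then show "exp (s x) \<le> exp (e / 2) * exp (f x)" using near(2)[of x] spc by (simp flip: exp_add)
        qed (use ei es in auto)
        then show "(\<integral>x. exp (s x) \<partial>\<mu>) \<le> exp (e / 2) * (\<integral>x. exp (f x) \<partial>\<mu>)" by simp
      qed
      also have "ln (exp (e / 2) * (\<integral>x. exp (f x) \<partial>\<mu>)) = e / 2 + ln (\<integral>x. exp (f x) \<partial>\<mu>)"
        using Z by (simp add: ln_mult)
      finally show "(\<integral>x. f x \<partial>\<nu>) \<le> c + ln (\<integral>x. exp (f x) \<partial>\<mu>) + e" by simp
    qed
  qed (use s\<nu> sets_mu N.prob_space_axioms M.prob_space_axioms in auto)
  then show ?thesis using \<nu> by (simp add: entropy_ball_def)
qed

end

section \<open>Compactness of entropy balls\<close>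

context continuity_algebra
begin

text \<open>Finitely additive probabilities on \<open>cont_sets\<close>. The values on all sets are
  confined to [0, 1], although additivity concerns the algebra only, so that this is a closed part
  of a full cube.\<close>

definition charges :: "('b set \<Rightarrow> real) set" where
  "charges = {\<psi>. (\<forall>A. \<psi> A \<in> {0..1}) \<and> \<psi> (topspace X) = 1 \<and>
     (\<forall>A\<in>cont_sets. \<forall>B\<in>cont_sets. A \<inter> B = {} \<longrightarrow> \<psi> (A \<union> B) = \<psi> A + \<psi> B)}"

lemma measure_in_charges:
  assumes "\<nu> \<in> borel_probs X"
  shows "measure \<nu> \<in> charges"
proof -
  interpret N: prob_space \<nu> using assms borel_probsD by blast
  show ?thesis
    unfolding charges_def using N.prob_space borel_probsD(3)[OF assms] cont_sets_events[OF assms]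
    by (auto intro!: N.finite_measure_Union)
qed

lemma entropy_boundedD:
  assumes "entropy_bounded c \<psi>" and "\<And>j. j < N \<Longrightarrow> A j \<in> cont_sets"
  shows "(\<Sum>j<N. a j * \<psi> (A j)) \<le> c + pressure N a A"
  using assms unfolding entropy_bounded_def by blast

text \<open>The bound for the single test function t times an indicator, with ln (1 + u) \<le> u. It
  yields absolute continuity with respect to \<mu> that is uniform over all \<psi> with the same
  c.\<close>

lemma entropy_bounded_small_sets:
  assumes "entropy_bounded c \<psi>" "A \<in> cont_sets" "t > 0"
  shows "t * \<psi> A \<le> c + (exp t - 1) * measure \<mu> A"
proof -
  have A: "A \<in> sets \<mu>" using assms cont_sets_events[OF mu] by blast
  have "(\<Sum>j<1::nat. t * \<psi> A) \<le> c + pressure 1 (\<lambda>_. t) (\<lambda>_. A)"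
    by (rule entropy_boundedD[OF assms(1)]) (rule assms(2))
  moreover have "(\<integral>x. exp (\<Sum>j<1::nat. t * indicator A x) \<partial>\<mu>) = (\<integral>x. 1 + (exp t - 1) * indicator A x \<partial>\<mu>)"
    by (intro Bochner_Integration.integral_cong) (auto simp: indicator_def)
  moreover have "\<dots> = 1 + (exp t - 1) * measure \<mu> A"
  proof -
    have "integrable \<mu> (\<lambda>x. (exp t - 1) * indicator A x :: real)"
      using A by (intro integrable_mult_right integrable_real_indicator) (auto simp: less_top[symmetric])
    then show ?thesis
      using A sets.sets_into_space[OF A] by (simp add: M.prob_space Int_absorb2)
  qed
  moreover have "ln (1 + (exp t - 1) * measure \<mu> A) \<le> (exp t - 1) * measure \<mu> A"
    using assms(3) by (intro ln_add_one_self_le_self) simp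
  ultimately show ?thesis unfolding pressure_def by simp
qed

text \<open>Caratheodory's theorem asks for continuity at the empty set. Along a decreasing sequence
  with empty intersection the \<mu>-measures tend to 0 because \<mu> is a measure, and the entropy
  bound transfers this to \<psi>.\<close>

lemma charge_extends:
  assumes \<psi>: "\<psi> \<in> charges" and c: "entropy_bounded c \<psi>"
  shows "\<exists>\<nu>\<in>borel_probs X. \<forall>A\<in>cont_sets. measure \<nu> A = \<psi> A"
proof -
  interpret A: algebra "topspace X" cont_sets by (rule algebra_cont_sets)
  have range: "0 \<le> \<psi> A" "\<psi> A \<le> 1" for A using \<psi> by (auto simp: charges_def)
  have add: "\<psi> (A \<union> B) = \<psi> A + \<psi> B" if "A \<in> cont_sets" "B \<in> cont_sets" "A \<inter> B = {}" for A B
    using \<psi> that by (auto simp: charges_def)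
  have empty: "\<psi> {} = 0" using add[of "{}" "{}"] by simp
  have "\<exists>m :: 'b set \<Rightarrow> ennreal. (\<forall>s\<in>cont_sets. m s = ennreal (\<psi> s)) \<and>
      measure_space (topspace X) (sigma_sets (topspace X) cont_sets) m"
  proof (rule A.caratheodory_empty_continuous)
    show "positive cont_sets (\<lambda>s. ennreal (\<psi> s))" using empty by (simp add: positive_def)
    show "additive cont_sets (\<lambda>s. ennreal (\<psi> s))"
      unfolding additive_def using add range by (simp add: ennreal_plus)
    fix S :: "nat \<Rightarrow> 'b set" assume S: "range S \<subseteq> cont_sets" "decseq S" "(\<Inter>i. S i) = {}"
    have "(\<lambda>i. measure \<mu> (S i)) \<longlonglongrightarrow> measure \<mu> (\<Inter>i. S i)"
      by (rule M.finite_Lim_measure_decseq) (use S cont_sets_events[OF mu] in auto)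
    then have l0: "(\<lambda>i. measure \<mu> (S i)) \<longlonglongrightarrow> 0" using S(3) by simp
    have "(\<lambda>i. \<psi> (S i)) \<longlonglongrightarrow> 0"
    proof (rule LIMSEQ_I)
      fix r :: real assume r: "r > 0"
      \<comment> \<open>Chosen so that (\<bar>c\<bar> + 1) / t = r / 2; a \<mu>-measure below exp
        (-t) then keeps the exponential term below 1.\<close>
      define t where "t = 2 * (\<bar>c\<bar> + 1) / r"
      have t: "t > 0" using r by (simp add: t_def)
      have "eventually (\<lambda>i. measure \<mu> (S i) < 1 / (exp t)) sequentially"
        using order_tendstoD(2)[OF l0] by simp
      then obtain n where n: "\<And>i. i \<ge> n \<Longrightarrow> measure \<mu> (S i) < 1 / exp t"
        by (auto simp: eventually_sequentially)
      have "norm (\<psi> (S i) - 0) < r" if "i \<ge> n" for i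
      proof -
        have "t * \<psi> (S i) \<le> c + (exp t - 1) * measure \<mu> (S i)"
          by (rule entropy_bounded_small_sets[OF c _ t]) (use S in auto)
        also have "(exp t - 1) * measure \<mu> (S i) \<le> exp t * measure \<mu> (S i)"
          by (intro mult_right_mono) auto
        also have "exp t * measure \<mu> (S i) \<le> 1" using n[OF that] by (simp add: field_simps)
        finally have "t * \<psi> (S i) \<le> \<bar>c\<bar> + 1" by simp
        then have "t * \<psi> (S i) \<le> t * (r / 2)" using r by (simp add: t_def)
        then have "\<psi> (S i) \<le> r / 2" using t by simp
        then show ?thesis using range[of "S i"] r by simp
      qed
      then show "\<exists>n. \<forall>i\<ge>n. norm (\<psi> (S i) - 0) < r" by blast
    qed
    then have "(\<lambda>i. ennreal (\<psi> (S i))) \<longlonglongrightarrow> ennreal 0" by (rule tendsto_ennrealI)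
    then show "(\<lambda>i. ennreal (\<psi> (S i))) \<longlonglongrightarrow> 0" by simp
  qed auto
  then obtain m :: "'b set \<Rightarrow> ennreal" where m: "\<And>s. s \<in> cont_sets \<Longrightarrow> m s = ennreal (\<psi> s)"
    "measure_space (topspace X) (sets (borel_of X)) m"
    unfolding sigma_sets_cont_sets by blast
  define \<nu> where "\<nu> = measure_of (topspace X) (sets (borel_of X)) m"
  have s\<nu>: "sets \<nu> = sets (borel_of X)"
    unfolding \<nu>_def using sets.sigma_sets_eq[of "borel_of X"] sets.space_closed[of "borel_of X"]
    by simp
  have e: "emeasure \<nu> A = m A" if "A \<in> sets (borel_of X)" for A
    unfolding \<nu>_def by (rule emeasure_measure_of_sigma) (use m(2) that in \<open>auto simp: measure_space_def\<close>)
  have "emeasure \<nu> (topspace X) = 1"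
    using e[OF cont_sets_borel[OF A.top]] m(1)[OF A.top] \<psi> by (simp add: charges_def)
  moreover have "space \<nu> = topspace X" using sets_eq_imp_space_eq[OF s\<nu>] by simp
  ultimately have "prob_space \<nu>" by (intro prob_spaceI) simp
  then have "\<nu> \<in> borel_probs X" using s\<nu> by (simp add: borel_probs_def)
  moreover have "measure \<nu> A = \<psi> A" if "A \<in> cont_sets" for A
    using e[OF cont_sets_borel[OF that]] m(1)[OF that] range by (simp add: measure_def)
  ultimately show ?thesis by blast
qed

lemma entropy_bounded_cong:
  assumes "entropy_bounded c \<psi>" and "\<And>A. A \<in> cont_sets \<Longrightarrow> \<psi>' A = \<psi> A"
  shows "entropy_bounded c \<psi>'"
  unfolding entropy_bounded_def
proof (intro allI impI)
  fix N a and A :: "nat \<Rightarrow> 'b set" assume A: "\<forall>j<N. A j \<in> cont_sets"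
  have "(\<Sum>j<N. a j * \<psi>' (A j)) = (\<Sum>j<N. a j * \<psi> (A j))"
    using assms(2) A by (intro sum.cong) auto
  then show "(\<Sum>j<N. a j * \<psi>' (A j)) \<le> c + pressure N a A"
    using entropy_boundedD[OF assms(1)] A by simp
qed

lemma charge_extends_entropy_ball:
  assumes "\<psi> \<in> charges" and "entropy_bounded c \<psi>"
  shows "\<exists>\<nu>\<in>entropy_ball c. \<forall>A\<in>cont_sets. measure \<nu> A = \<psi> A"
proof -
  obtain \<nu> where \<nu>: "\<nu> \<in> borel_probs X" "\<And>A. A \<in> cont_sets \<Longrightarrow> measure \<nu> A = \<psi> A"
    using charge_extends[OF assms] by blast
  then have "entropy_bounded c (measure \<nu>)" using entropy_bounded_cong[OF assms(2)] by blast
  then show ?thesis using entropy_bounded_imp_ball[OF \<nu>(1)] \<nu>(2) by blast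
qed

text \<open>A bounded continuous function is uniformly close to a step function over
  \<open>cont_sets\<close>. Uniformity lets the approximation serve every probability measure at
  once, although the sets are adapted to \<mu> and not to \<nu>.\<close>

lemma weak_nhd_cont_sets:
  assumes "openin (weak_topology X) U" "\<nu> \<in> U"
  shows "\<exists>F e. finite F \<and> F \<subseteq> cont_sets \<and> e > 0 \<and>
    (\<forall>\<nu>'\<in>borel_probs X. (\<forall>A\<in>F. \<bar>measure \<nu>' A - measure \<nu> A\<bar> < e) \<longrightarrow> \<nu>' \<in> U)"
proof -
  have "generate_topology_on {{\<mu> \<in> borel_probs X. (\<integral>x. f x \<partial>\<mu>) \<in> U} | f U.
        continuous_map X euclideanreal f \<and> bounded (f ` topspace X) \<and> open U} U"
    using assms(1) unfolding weak_topology_def by (rule openin_topology_generated_by)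
  then show ?thesis
    using assms(2)
  proof (induction arbitrary: \<nu> rule: generate_topology_on.induct)
    case Empty
    then show ?case by simp
  next
    case (Int a b)
    obtain F e where F: "finite F" "F \<subseteq> cont_sets" "e > 0"
      "\<And>\<nu>'. \<nu>' \<in> borel_probs X \<Longrightarrow> \<forall>A\<in>F. \<bar>measure \<nu>' A - measure \<nu> A\<bar> < e \<Longrightarrow> \<nu>' \<in> a"
      using Int.IH(1)[of \<nu>] Int.prems by blast
    obtain F' e' where F': "finite F'" "F' \<subseteq> cont_sets" "e' > 0"
      "\<And>\<nu>'. \<nu>' \<in> borel_probs X \<Longrightarrow> \<forall>A\<in>F'. \<bar>measure \<nu>' A - measure \<nu> A\<bar> < e' \<Longrightarrow> \<nu>' \<in> b"
      using Int.IH(2)[of \<nu>] Int.prems by blast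
    show ?case
      by (rule exI[of _ "F \<union> F'"], rule exI[of _ "min e e'"]) (use F F' in auto)
  next
    case (UN K)
    then obtain k where k: "k \<in> K" "\<nu> \<in> k" by blast
    obtain F e where F: "finite F" "F \<subseteq> cont_sets" "e > 0"
      "\<And>\<nu>'. \<nu>' \<in> borel_probs X \<Longrightarrow> \<forall>A\<in>F. \<bar>measure \<nu>' A - measure \<nu> A\<bar> < e \<Longrightarrow> \<nu>' \<in> k"
      using UN.IH[OF k] by blast
    show ?case
      by (rule exI[of _ F], rule exI[of _ e]) (use F k in auto)
  next
    case (Basis S)
    then obtain f O' where S: "S = {\<mu> \<in> borel_probs X. (\<integral>x. f x \<partial>\<mu>) \<in> O'}"
      and f: "bounded_continuous X f" and O': "open O'"
      unfolding bounded_continuous_def by blast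
    have \<nu>: "\<nu> \<in> borel_probs X" "(\<integral>x. f x \<partial>\<nu>) \<in> O'" using Basis.prems S by auto
    obtain d where d: "d > 0" "\<And>y. \<bar>y - (\<integral>x. f x \<partial>\<nu>)\<bar> < d \<Longrightarrow> y \<in> O'"
      using O' \<nu>(2) by (auto simp: open_dist dist_real_def)
    obtain B where B: "B > 0" "\<And>x. x \<in> topspace X \<Longrightarrow> \<bar>f x\<bar> \<le> B"
      by (rule bounded_continuousE[OF f]) (rule that)
    \<comment> \<open>Three errors of at most d/4 will be added: the approximation under each of the
      two measures, and the difference of the two step integrals.\<close>
    obtain N a and A :: "nat \<Rightarrow> 'b set" where A: "\<And>j. j < N \<Longrightarrow> A j \<in> cont_sets"
      "\<And>x. x \<in> topspace X \<Longrightarrow> \<bar>f x - (\<Sum>j<N. a j * indicator (A j) x)\<bar> \<le> d / 4"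
    proof (rule step_function_approximation[of "topspace X" f cont_sets B "d / 4"])
      show "topspace X \<in> cont_sets" using algebra.top[OF algebra_cont_sets] .
    qed (use superlevel_cont_sets_dense[OF f] B d in auto)
    define s where "s x = (\<Sum>j<N. a j * indicator (A j) x)" for x
    have near: "\<bar>(\<integral>x. f x \<partial>\<nu>') - (\<Sum>j<N. a j * measure \<nu>' (A j))\<bar> \<le> d / 4"
      if \<nu>': "\<nu>' \<in> borel_probs X" for \<nu>'
    proof -
      interpret N: prob_space \<nu>' using \<nu>' borel_probsD by blast
      have si: "integrable \<nu>' s" "(\<integral>x. s x \<partial>\<nu>') = (\<Sum>j<N. a j * measure \<nu>' (A j))"
        unfolding s_def using N.integral_step_function[where N=N and A=A and a=a] A(1)
          cont_sets_events[OF \<nu>'] by blast+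
      have fi: "integrable \<nu>' f" by (rule bounded_continuous_integrable[OF f \<nu>'])
      have "\<bar>\<integral>x. f x - s x \<partial>\<nu>'\<bar> \<le> (\<integral>x. \<bar>f x - s x\<bar> \<partial>\<nu>')" by (rule integral_abs_bound)
      also have "\<dots> \<le> (\<integral>x. d / 4 \<partial>\<nu>')"
      proof (rule integral_mono)
        fix x assume "x \<in> space \<nu>'"
        then have "x \<in> topspace X" using borel_probsD(3)[OF \<nu>'] by simp
        then show "\<bar>f x - s x\<bar> \<le> d / 4" unfolding s_def by (rule A(2))
      qed (use fi si in auto)
      finally show ?thesis using fi si by (simp add: N.prob_space)
    qed
    \<comment> \<open>The summand 1 keeps m positive when all coefficients vanish.\<close>
    define m where "m = 1 + (\<Sum>j<N. \<bar>a j\<bar>)"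
    define e where "e = d / (4 * m)"
    have pos: "0 < m"
      unfolding m_def by (intro add_pos_nonneg sum_nonneg) auto
    have e: "e > 0" using d pos by (simp add: e_def)
    have "\<nu>' \<in> S" if \<nu>': "\<nu>' \<in> borel_probs X" and c: "\<forall>A\<in>A ` {..<N}. \<bar>measure \<nu>' A - measure \<nu> A\<bar> < e" for \<nu>'
    proof -
      have "\<bar>(\<Sum>j<N. a j * measure \<nu>' (A j)) - (\<Sum>j<N. a j * measure \<nu> (A j))\<bar>
          = \<bar>\<Sum>j<N. a j * (measure \<nu>' (A j) - measure \<nu> (A j))\<bar>"
        by (simp add: sum_subtractf right_diff_distrib)
      also have "\<dots> \<le> (\<Sum>j<N. \<bar>a j\<bar> * e)"
        by (intro order_trans[OF sum_abs] sum_mono) (use c in \<open>simp add: abs_mult mult_left_mono less_imp_le\<close>)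
      also have "\<dots> \<le> m * e"
        using e by (simp add: m_def sum_distrib_right[symmetric] distrib_right)
      also have "\<dots> = d / 4" using pos by (simp add: e_def)
      finally have "\<bar>(\<integral>x. f x \<partial>\<nu>') - (\<integral>x. f x \<partial>\<nu>)\<bar> < d"
        using near[OF \<nu>'] near[OF \<nu>(1)] d(1) by linarith
      then show ?thesis using d(2) \<nu>' S by simp
    qed
    then show ?case
      by (intro exI[of _ "A ` {..<N}"] exI[of _ e]) (use A(1) e in auto)
  qed
qed

text \<open>Tychonoff's theorem for the cube; each additivity equation involves finitely many
  coordinates and is therefore a closed condition.\<close>

lemma compact_charges: "compact charges"
proof -
  have "compactin (product_topology (\<lambda>_::'b set. euclideanreal) UNIV) (\<Pi>\<^sub>E A\<in>UNIV. {0..1})"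
    by (subst compactin_PiE) auto
  then have "compact (\<Pi>\<^sub>E A\<in>(UNIV::'b set set). {0..1::real})"
    by (simp only: euclidean_product_topology compactin_euclidean_iff)
  moreover have "closed {\<psi>::'b set \<Rightarrow> real. \<psi> (topspace X) = 1 \<and>
     (\<forall>A\<in>cont_sets. \<forall>B\<in>cont_sets. A \<inter> B = {} \<longrightarrow> \<psi> (A \<union> B) = \<psi> A + \<psi> B)}"
    unfolding Ball_def
    by (intro closed_Collect_conj closed_Collect_all closed_Collect_imp open_Collect_const
        closed_Collect_eq continuous_intros continuous_on_product_coordinates)
  ultimately have "compact ((\<Pi>\<^sub>E A\<in>(UNIV::'b set set). {0..1::real}) \<inter> {\<psi>. \<psi> (topspace X) = 1 \<and>
     (\<forall>A\<in>cont_sets. \<forall>B\<in>cont_sets. A \<inter> B = {} \<longrightarrow> \<psi> (A \<union> B) = \<psi> A + \<psi> B)})"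
    by (rule compact_Int_closed)
  also have "(\<Pi>\<^sub>E A\<in>(UNIV::'b set set). {0..1::real}) \<inter> {\<psi>. \<psi> (topspace X) = 1 \<and>
     (\<forall>A\<in>cont_sets. \<forall>B\<in>cont_sets. A \<inter> B = {} \<longrightarrow> \<psi> (A \<union> B) = \<psi> A + \<psi> B)} = charges"
    unfolding charges_def by (auto simp: PiE_iff)
  finally show ?thesis .
qed

lemma open_charge_nhd: "finite F \<Longrightarrow> open {\<psi>'::'b set \<Rightarrow> real. \<forall>A\<in>F. \<bar>\<psi>' A - \<psi> A\<bar> < e}"
proof -
  assume "finite F"
  then have "open (\<Inter>A\<in>F. {\<psi>'::'b set \<Rightarrow> real. \<bar>\<psi>' A - \<psi> A\<bar> < e})"
    by (intro open_INT ballI open_Collect_less continuous_intros continuous_on_product_coordinates)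
  moreover have "(\<Inter>A\<in>F. {\<psi>'::'b set \<Rightarrow> real. \<bar>\<psi>' A - \<psi> A\<bar> < e}) = {\<psi>'. \<forall>A\<in>F. \<bar>\<psi>' A - \<psi> A\<bar> < e}" by auto
  ultimately show ?thesis by simp
qed

text \<open>The charges that obey the entropy bound form a compact set, being cut out by closed
  conditions. Extension to measures is continuous on it, since weak neighbourhoods contain those
  given by finitely many continuity sets, and its image is the ball.\<close>

lemma compactin_entropy_ball: "compactin (weak_topology X) (entropy_ball c)"
proof -
  define Q where "Q = charges \<inter> {\<psi>. entropy_bounded c \<psi>}"
  have "closed {\<psi>. entropy_bounded c \<psi>}"
    unfolding entropy_bounded_def
    by (intro closed_Collect_all closed_Collect_imp open_Collect_const closed_Collect_le
        continuous_intros continuous_on_product_coordinates)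
  then have Q: "compact Q" unfolding Q_def by (intro compact_Int_closed compact_charges)
  have "\<exists>\<Phi>. \<forall>\<psi>. \<psi> \<in> Q \<longrightarrow> \<Phi> \<psi> \<in> entropy_ball c \<and> (\<forall>A\<in>cont_sets. measure (\<Phi> \<psi>) A = \<psi> A)"
    by (rule choice) (use charge_extends_entropy_ball in \<open>unfold Q_def, blast\<close>)
  then obtain \<Phi> where \<Phi>: "\<And>\<psi>. \<psi> \<in> Q \<Longrightarrow> \<Phi> \<psi> \<in> entropy_ball c"
    "\<And>\<psi> A. \<psi> \<in> Q \<Longrightarrow> A \<in> cont_sets \<Longrightarrow> measure (\<Phi> \<psi>) A = \<psi> A" by blast
  have "continuous_map (top_of_set Q) (weak_topology X) \<Phi>"
    unfolding continuous_map_def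
  proof (intro conjI allI impI)
    show "\<Phi> \<in> topspace (top_of_set Q) \<rightarrow> topspace (weak_topology X)"
      using \<Phi>(1) by (auto simp: topspace_weak_topology entropy_ball_def)
    fix U assume U: "openin (weak_topology X) U"
    show "openin (top_of_set Q) {\<psi> \<in> topspace (top_of_set Q). \<Phi> \<psi> \<in> U}"
    proof (subst openin_subopen, intro ballI)
      fix \<psi> assume "\<psi> \<in> {\<psi> \<in> topspace (top_of_set Q). \<Phi> \<psi> \<in> U}"
      then have \<psi>: "\<psi> \<in> Q" "\<Phi> \<psi> \<in> U" by auto
      obtain F e where F: "finite F" "F \<subseteq> cont_sets" "e > 0"
        "\<And>\<nu>'. \<nu>' \<in> borel_probs X \<Longrightarrow> \<forall>A\<in>F. \<bar>measure \<nu>' A - measure (\<Phi> \<psi>) A\<bar> < e \<Longrightarrow> \<nu>' \<in> U"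
        using weak_nhd_cont_sets[OF U \<psi>(2)] by blast
      let ?T = "{\<psi>'. \<forall>A\<in>F. \<bar>\<psi>' A - \<psi> A\<bar> < e}"
      have "Q \<inter> ?T \<subseteq> {\<psi> \<in> topspace (top_of_set Q). \<Phi> \<psi> \<in> U}"
      proof
        fix \<psi>' assume \<psi>': "\<psi>' \<in> Q \<inter> ?T"
        then have "\<Phi> \<psi>' \<in> borel_probs X" using \<Phi>(1) by (auto simp: entropy_ball_def)
        moreover have "\<forall>A\<in>F. \<bar>measure (\<Phi> \<psi>') A - measure (\<Phi> \<psi>) A\<bar> < e"
          using \<psi>' \<psi> \<Phi>(2) F(2) by auto
        ultimately show "\<psi>' \<in> {\<psi> \<in> topspace (top_of_set Q). \<Phi> \<psi> \<in> U}" using F(4) \<psi>' by auto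
      qed
      moreover have "openin (top_of_set Q) (Q \<inter> ?T)"
        using open_charge_nhd[OF F(1)] by (auto simp: openin_open)
      moreover have "\<psi> \<in> Q \<inter> ?T" using \<psi> F(3) by auto
      ultimately show "\<exists>T. openin (top_of_set Q) T \<and> \<psi> \<in> T \<and> T \<subseteq> {\<psi> \<in> topspace (top_of_set Q). \<Phi> \<psi> \<in> U}"
        by blast
    qed
  qed
  moreover have "compactin (top_of_set Q) Q" using Q by (simp add: compactin_subtopology)
  ultimately have "compactin (weak_topology X) (\<Phi> ` Q)" by (rule image_compactin[rotated])
  moreover have "\<Phi> ` Q = entropy_ball c"
  proof
    show "\<Phi> ` Q \<subseteq> entropy_ball c" using \<Phi>(1) by auto
    show "entropy_ball c \<subseteq> \<Phi> ` Q"
    proof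
      fix \<nu> assume \<nu>: "\<nu> \<in> entropy_ball c"
      then have b: "\<nu> \<in> borel_probs X" by (simp add: entropy_ball_def)
      have q: "measure \<nu> \<in> Q"
        using entropy_ball_imp_bounded[OF \<nu>] measure_in_charges[OF b] by (simp add: Q_def)
      have b': "\<Phi> (measure \<nu>) \<in> borel_probs X" using \<Phi>(1)[OF q] by (simp add: entropy_ball_def)
      \<comment> \<open>The extension was merely chosen, so its uniqueness is needed: a measure is
        determined by its values on the generating algebra.\<close>
      have "\<Phi> (measure \<nu>) = \<nu>"
      proof (rule measure_eqI_generator_eq[where \<Omega>="topspace X" and E=cont_sets and A="\<lambda>_. topspace X"])
        interpret A: algebra "topspace X" cont_sets by (rule algebra_cont_sets)
        show "Int_stable cont_sets" by (auto simp: Int_stable_def)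
        show "cont_sets \<subseteq> Pow (topspace X)" by (rule A.space_closed)
        show "range (\<lambda>_. topspace X) \<subseteq> cont_sets" using A.top by auto
        interpret N: prob_space \<nu> using b borel_probsD by blast
        interpret N': prob_space "\<Phi> (measure \<nu>)" using b' borel_probsD by blast
        show "emeasure (\<Phi> (measure \<nu>)) A = emeasure \<nu> A" if "A \<in> cont_sets" for A
          using \<Phi>(2)[OF q that] by (simp add: N.emeasure_eq_measure N'.emeasure_eq_measure)
        show "emeasure (\<Phi> (measure \<nu>)) (topspace X) \<noteq> \<infinity>" by simp
      qed (use b b' borel_probsD(2) sigma_sets_cont_sets in auto)
      then show "\<nu> \<in> \<Phi> ` Q" using q by (metis imageI)
    qed
  qed
  ultimately show ?thesis by simp
qed

text \<open>C is merely closed, so compactness is taken from the closure of its charges. A limit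
  charge outside all half-spaces would satisfy the entropy bound and extend to a measure \<nu> of
  the ball. As \<nu> is not in C, a neighbourhood of \<nu> avoids C, whereas charges of C come
  arbitrarily close to that of \<nu> on finitely many continuity sets.\<close>

lemma closed_disjoint_entropy_ball_cover:
  assumes C: "closedin (weak_topology X) C" and disj: "C \<inter> entropy_ball c = {}"
  obtains J :: "(nat \<times> (nat \<Rightarrow> real) \<times> (nat \<Rightarrow> 'b set)) set"
  where "finite J" and "\<And>N a A j. (N, a, A) \<in> J \<Longrightarrow> j < N \<Longrightarrow> A j \<in> cont_sets"
    and "\<And>\<nu>. \<nu> \<in> C \<Longrightarrow> \<exists>(N, a, A)\<in>J. c + pressure N a A < (\<Sum>j<N. a j * measure \<nu> (A j))"
proof -
  have Cb: "C \<subseteq> borel_probs X" using closedin_subset[OF C] by (simp add: topspace_weak_topology)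
  define K where "K = charges \<inter> closure (measure ` C)"
  have K: "compact K" unfolding K_def by (intro compact_Int_closed compact_charges closed_closure)
  define T :: "(nat \<times> (nat \<Rightarrow> real) \<times> (nat \<Rightarrow> 'b set)) set"
    where "T = {(N, a, A). \<forall>j<N. A j \<in> cont_sets}"
  define V where "V = (\<lambda>(N, a, A). {\<psi>. c + pressure N a A < (\<Sum>j<N. a j * \<psi> (A j))})"
  have "open (V t)" for t unfolding V_def
    by (cases t) (auto intro!: open_Collect_less continuous_intros continuous_on_product_coordinates)
  moreover have "K \<subseteq> (\<Union>t\<in>T. V t)"
  proof (rule ccontr)
    assume "\<not> K \<subseteq> (\<Union>t\<in>T. V t)"
    then obtain \<psi> where \<psi>: "\<psi> \<in> charges" "\<psi> \<in> closure (measure ` C)" "\<psi> \<notin> (\<Union>t\<in>T. V t)"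
      by (auto simp: K_def)
    have "entropy_bounded c \<psi>"
      unfolding entropy_bounded_def
    proof (intro allI impI)
      fix N a and A :: "nat \<Rightarrow> 'b set" assume "\<forall>j<N. A j \<in> cont_sets"
      then have "(N, a, A) \<in> T" by (simp add: T_def)
      then have "\<psi> \<notin> V (N, a, A)" using \<psi>(3) by blast
      then show "(\<Sum>j<N. a j * \<psi> (A j)) \<le> c + pressure N a A" by (simp add: V_def)
    qed
    then obtain \<nu> where \<nu>: "\<nu> \<in> entropy_ball c" "\<And>A. A \<in> cont_sets \<Longrightarrow> measure \<nu> A = \<psi> A"
      using charge_extends_entropy_ball[OF \<psi>(1)] by blast
    have "openin (weak_topology X) (borel_probs X - C)"
      using C by (simp add: closedin_def topspace_weak_topology)
    moreover have "\<nu> \<in> borel_probs X - C" using \<nu>(1) disj by (auto simp: entropy_ball_def)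
    ultimately obtain F e where F: "finite F" "F \<subseteq> cont_sets" "e > 0"
      "\<And>\<nu>'. \<nu>' \<in> borel_probs X \<Longrightarrow> \<forall>A\<in>F. \<bar>measure \<nu>' A - measure \<nu> A\<bar> < e \<Longrightarrow> \<nu>' \<in> borel_probs X - C"
      using weak_nhd_cont_sets by meson
    let ?W = "{\<psi>'. \<forall>A\<in>F. \<bar>\<psi>' A - \<psi> A\<bar> < e}"
    have "?W \<inter> measure ` C \<noteq> {}"
    proof -
      have "\<psi> \<in> ?W" using F(3) by simp
      then show ?thesis
        using \<psi>(2) open_Int_closure_eq_empty[OF open_charge_nhd[OF F(1)], of \<psi> e "measure ` C"] by blast
    qed
    then obtain \<nu>' where "\<nu>' \<in> C" "\<forall>A\<in>F. \<bar>measure \<nu>' A - \<psi> A\<bar> < e" by auto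
    then show False using F(2,4) Cb \<nu>(2) by (metis DiffD2 subsetD)
  qed
  ultimately obtain J where J: "J \<subseteq> T" "finite J" "K \<subseteq> (\<Union>t\<in>J. V t)"
    using compactE_image[OF K, of T V] by metis
  show thesis
  proof (rule that[OF J(2)])
    show "A j \<in> cont_sets" if "(N, a, A) \<in> J" "j < N" for N a A j
      using J(1) that by (auto simp: T_def)
    fix \<nu> assume "\<nu> \<in> C"
    then have "measure \<nu> \<in> K"
      using measure_in_charges Cb closure_subset[of "measure ` C"] by (auto simp: K_def)
    then obtain t where "t \<in> J" "measure \<nu> \<in> V t" using J(3) by blast
    then show "\<exists>(N, a, A)\<in>J. c + pressure N a A < (\<Sum>j<N. a j * measure \<nu> (A j))"
      by (intro bexI[of _ t]) (auto simp: V_def split: prod.splits)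
  qed
qed

end

section \<open>Counting estimates\<close>

text \<open>Chernoff's inequality in counting form; the exponential of a sum over the draws factors
  when summed over all draws.\<close>

lemma card_exponential_bound:
  fixes f :: "'i \<Rightarrow> real"
  assumes "finite S"
  shows "real (card {b \<in> PiE {..<m} (\<lambda>_. S). real m * t < (\<Sum>l<m. f (b l))})
    \<le> exp (- real m * t) * (\<Sum>i\<in>S. exp (f i)) ^ m"
proof -
  let ?P = "PiE {..<m} (\<lambda>_. S)" and ?E = "{b \<in> PiE {..<m} (\<lambda>_. S). real m * t < (\<Sum>l<m. f (b l))}"
  have fin: "finite ?P" using assms by (intro finite_PiE) auto
  have "real (card ?E) * exp (real m * t) = (\<Sum>b\<in>?E. exp (real m * t))" by simp
  also have "\<dots> \<le> (\<Sum>b\<in>?E. exp (\<Sum>l<m. f (b l)))" by (rule sum_mono) simp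
  also have "\<dots> \<le> (\<Sum>b\<in>?P. exp (\<Sum>l<m. f (b l)))"
    by (rule sum_mono2) (use fin in auto)
  also have "\<dots> = (\<Sum>b\<in>?P. \<Prod>l<m. exp (f (b l)))" by (simp add: exp_sum)
  also have "\<dots> = (\<Prod>l<m. \<Sum>i\<in>S. exp (f i))"
    by (rule prod_sum_PiE[symmetric]) (use assms in auto)
  also have "\<dots> = (\<Sum>i\<in>S. exp (f i)) ^ m" by simp
  finally show ?thesis by (simp add: exp_minus field_simps)
qed

text \<open>The variance of a sum of independent centred variables with law w: the mixed terms
  vanish because one centred factor splits off.\<close>

lemma weighted_second_moment:
  fixes w \<phi> :: "'i \<Rightarrow> real"
  assumes "finite S" and w: "sum w S = 1" and \<phi>: "(\<Sum>i\<in>S. w i * \<phi> i) = 0"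
  shows "(\<Sum>b\<in>PiE {..<m} (\<lambda>_. S). (\<Prod>l<m. w (b l)) * (\<Sum>l<m. \<phi> (b l))\<^sup>2) = real m * (\<Sum>i\<in>S. w i * (\<phi> i)\<^sup>2)"
proof -
  let ?P = "PiE {..<m} (\<lambda>_. S)"
  have pair: "(\<Sum>b\<in>?P. (\<Prod>l<m. w (b l)) * (\<phi> (b l1) * \<phi> (b l2))) = (if l1 = l2 then \<Sum>i\<in>S. w i * (\<phi> i)\<^sup>2 else 0)"
    if l: "l1 < m" "l2 < m" for l1 l2
  proof -
    \<comment> \<open>The factor \<phi> is attached at the coordinates \<open>l1\<close> and
      \<open>l2\<close>, twice if they coincide, so that the summand is a product over coordinates
      and the sum factors.\<close>
    let ?g = "\<lambda>l i. w i * ((if l = l1 then \<phi> i else 1) * (if l = l2 then \<phi> i else 1))"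
    have "(\<Prod>l<m. ?g l (b l)) = (\<Prod>l<m. w (b l)) * (\<phi> (b l1) * \<phi> (b l2))" for b
      using l by (simp add: prod.distrib)
    then have "(\<Sum>b\<in>?P. (\<Prod>l<m. w (b l)) * (\<phi> (b l1) * \<phi> (b l2))) = (\<Sum>b\<in>?P. \<Prod>l<m. ?g l (b l))" by simp
    also have "\<dots> = (\<Prod>l<m. \<Sum>i\<in>S. ?g l i)"
      by (rule prod_sum_PiE[symmetric]) (use assms in auto)
    also have "\<dots> = (if l1 = l2 then \<Sum>i\<in>S. w i * (\<phi> i)\<^sup>2 else 0)"
    proof (cases "l1 = l2")
      case True
      have "(\<Prod>l<m. \<Sum>i\<in>S. ?g l i) = (\<Prod>l<m. if l = l1 then \<Sum>i\<in>S. w i * (\<phi> i)\<^sup>2 else 1)"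
        by (rule prod.cong) (use True w in \<open>auto simp: power2_eq_square\<close>)
      then show ?thesis using True l by simp
    next
      case False
      have "\<exists>l\<in>{..<m}. (\<Sum>i\<in>S. ?g l i) = 0" using False \<phi> l by (intro bexI[of _ l1]) auto
      then have "(\<Prod>l<m. \<Sum>i\<in>S. ?g l i) = 0" by (rule prod_zero[rotated]) simp
      then show ?thesis using False by simp
    qed
    finally show ?thesis .
  qed
  have "(\<Sum>b\<in>?P. (\<Prod>l<m. w (b l)) * (\<Sum>l<m. \<phi> (b l))\<^sup>2)
      = (\<Sum>b\<in>?P. \<Sum>l1<m. \<Sum>l2<m. (\<Prod>l<m. w (b l)) * (\<phi> (b l1) * \<phi> (b l2)))"
    by (simp only: power2_eq_square sum_product) (simp only: sum_distrib_left)
  also have "\<dots> = (\<Sum>l1<m. \<Sum>l2<m. \<Sum>b\<in>?P. (\<Prod>l<m. w (b l)) * (\<phi> (b l1) * \<phi> (b l2)))"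
    by (subst sum.swap) (intro sum.cong refl sum.swap)
  also have "\<dots> = (\<Sum>l1<m. \<Sum>l2<m. if l1 = l2 then \<Sum>i\<in>S. w i * (\<phi> i)\<^sup>2 else 0)"
    by (intro sum.cong refl) (use pair in auto)
  also have "\<dots> = real m * (\<Sum>i\<in>S. w i * (\<phi> i)\<^sup>2)" by simp
  finally show ?thesis .
qed

text \<open>Since \<bar>\<phi>\<bar> \<le> 1, the second moment of the sum is at most m, to be
  compared with the square of m e.\<close>

lemma weighted_Chebyshev:
  fixes w \<phi> :: "'i \<Rightarrow> real"
  assumes "finite S" and w0: "\<And>i. i \<in> S \<Longrightarrow> 0 \<le> w i" and w: "sum w S = 1"
    and \<phi>: "(\<Sum>i\<in>S. w i * \<phi> i) = 0" and \<phi>1: "\<And>i. i \<in> S \<Longrightarrow> \<bar>\<phi> i\<bar> \<le> 1"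
    and m: "m > 0" and e: "e > 0"
  shows "(\<Sum>b\<in>{b \<in> PiE {..<m} (\<lambda>_. S). real m * e \<le> \<bar>\<Sum>l<m. \<phi> (b l)\<bar>}. \<Prod>l<m. w (b l)) \<le> 1 / (real m * e\<^sup>2)"
proof -
  let ?P = "PiE {..<m} (\<lambda>_. S)"
  let ?E = "{b \<in> PiE {..<m} (\<lambda>_. S). real m * e \<le> \<bar>\<Sum>l<m. \<phi> (b l)\<bar>}"
  have fin: "finite ?P" using assms by (intro finite_PiE) auto
  have pr: "0 \<le> (\<Prod>l<m. w (b l))" if "b \<in> ?P" for b
    using that by (intro prod_nonneg) (auto intro!: w0 dest: PiE_mem)
  have "(\<Sum>b\<in>?E. \<Prod>l<m. w (b l)) * (real m * e)\<^sup>2 = (\<Sum>b\<in>?E. (\<Prod>l<m. w (b l)) * (real m * e)\<^sup>2)"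
    by (simp add: sum_distrib_right)
  also have "\<dots> \<le> (\<Sum>b\<in>?E. (\<Prod>l<m. w (b l)) * (\<Sum>l<m. \<phi> (b l))\<^sup>2)"
  proof (rule sum_mono)
    fix b assume b: "b \<in> ?E"
    then have "(real m * e)\<^sup>2 \<le> \<bar>\<Sum>l<m. \<phi> (b l)\<bar>\<^sup>2" using m e by (intro power_mono) auto
    then show "(\<Prod>l<m. w (b l)) * (real m * e)\<^sup>2 \<le> (\<Prod>l<m. w (b l)) * (\<Sum>l<m. \<phi> (b l))\<^sup>2"
      using pr[of b] b by (intro mult_left_mono) auto
  qed
  also have "\<dots> \<le> (\<Sum>b\<in>?P. (\<Prod>l<m. w (b l)) * (\<Sum>l<m. \<phi> (b l))\<^sup>2)"
    by (rule sum_mono2) (use fin pr in auto)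
  also have "\<dots> = real m * (\<Sum>i\<in>S. w i * (\<phi> i)\<^sup>2)"
    by (rule weighted_second_moment) fact+
  also have "\<dots> \<le> real m * (\<Sum>i\<in>S. w i)"
  proof (intro mult_left_mono sum_mono)
    fix i assume i: "i \<in> S"
    have "(\<phi> i)\<^sup>2 \<le> 1" using \<phi>1[OF i] by (simp add: abs_square_le_1)
    then show "w i * (\<phi> i)\<^sup>2 \<le> w i" using w0[OF i] by (simp add: mult_left_le)
  qed simp
  also have "\<dots> = real m" using w by simp
  finally have "(\<Sum>b\<in>?E. \<Prod>l<m. w (b l)) * (real m * e)\<^sup>2 \<le> real m" .
  then have "(\<Sum>b\<in>?E. \<Prod>l<m. w (b l)) \<le> real m / (real m * e)\<^sup>2"
    using m e by (simp add: pos_le_divide_eq)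
  also have "\<dots> = 1 / (real m * e\<^sup>2)" using m by (simp add: power2_eq_square)
  finally show ?thesis .
qed

text \<open>The weights \<open>\<theta>\<close> tilt the uniform law so that the sequences counted here become typical.\<close>
lemma card_tilted_lower_bound:
  fixes \<theta> :: "'i \<Rightarrow> real" and T :: "'c \<Rightarrow> 'i set"
  assumes "finite S" and "finite I" and \<theta>: "\<And>i. i \<in> S \<Longrightarrow> 0 \<le> \<theta> i" and Z: "Z = sum \<theta> S" "Z > 0"
    and p: "\<And>c. c \<in> I \<Longrightarrow> p c = (\<Sum>i\<in>S. \<theta> i * indicator (T c) i) / Z"
    and m: "m > 0" and e: "e > 0"
    and G: "G = {b \<in> PiE {..<m} (\<lambda>_. S). \<forall>c\<in>I. \<bar>real (card {l \<in> {..<m}. b l \<in> T c}) / real m - p c\<bar> < e}"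
    and \<eta>: "\<And>b. b \<in> G \<Longrightarrow> (\<forall>l<m. 0 < \<theta> (b l)) \<Longrightarrow> (\<Prod>l<m. \<theta> (b l)) \<le> exp (real m * \<eta>)"
  shows "Z ^ m * (1 - real (card I) / (real m * e\<^sup>2)) * exp (- real m * \<eta>) \<le> real (card G)"
proof -
  let ?P = "PiE {..<m} (\<lambda>_. S)"
  have fin: "finite ?P" using assms by (intro finite_PiE) auto
  have finG: "finite G" using fin G by simp
  \<comment> \<open>The tilted law of a single draw; \<open>p c\<close> is its probability of
    falling into \<open>T c\<close>.\<close>
  define w where "w i = \<theta> i / Z" for i
  have w0: "0 \<le> w i" if "i \<in> S" for i using \<theta>[OF that] Z by (simp add: w_def)
  have w1: "sum w S = 1" using Z by (simp add: w_def sum_divide_distrib[symmetric])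
  define \<phi> where "\<phi> c i = indicator (T c) i - p c" for c i
  have wT: "(\<Sum>i\<in>S. w i * indicator (T c) i) = p c" if "c \<in> I" for c
    using p[OF that] by (simp add: w_def sum_divide_distrib)
  have \<phi>0: "(\<Sum>i\<in>S. w i * \<phi> c i) = 0" if "c \<in> I" for c
  proof -
    have "(\<Sum>i\<in>S. w i * \<phi> c i) = (\<Sum>i\<in>S. w i * indicator (T c) i) - (\<Sum>i\<in>S. w i) * p c"
      by (simp only: \<phi>_def right_diff_distrib sum_subtractf sum_distrib_right)
    then show ?thesis using wT[OF that] w1 by simp
  qed
  have p01: "0 \<le> p c" "p c \<le> 1" if "c \<in> I" for c
  proof -
    show "0 \<le> p c" unfolding wT[OF that, symmetric] by (intro sum_nonneg mult_nonneg_nonneg) (use w0 in auto)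
    have "p c \<le> sum w S" unfolding wT[OF that, symmetric]
      by (intro sum_mono) (use w0 in \<open>auto simp: indicator_def\<close>)
    then show "p c \<le> 1" using w1 by simp
  qed
  have \<phi>1: "\<bar>\<phi> c i\<bar> \<le> 1" if "c \<in> I" for c i
    using p01[OF that] by (auto simp: \<phi>_def indicator_def)
  define E where "E c = {b \<in> ?P. real m * e \<le> \<bar>\<Sum>l<m. \<phi> c (b l)\<bar>}" for c
  have pr: "0 \<le> (\<Prod>l<m. w (b l))" if "b \<in> ?P" for b
    using that by (intro prod_nonneg) (auto intro!: w0 dest: PiE_mem)
  have "1 = (\<Prod>l<m. \<Sum>i\<in>S. w i)" using w1 by simp
  also have "\<dots> = (\<Sum>b\<in>?P. \<Prod>l<m. w (b l))" by (rule prod_sum_PiE) (use assms in auto)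
  also have "\<dots> \<le> (\<Sum>b\<in>G \<union> (\<Union>c\<in>I. E c). \<Prod>l<m. w (b l))"
  proof (rule sum_mono2)
    show "finite (G \<union> (\<Union>c\<in>I. E c))" using finG fin \<open>finite I\<close> by (auto simp: E_def)
    show "?P \<subseteq> G \<union> (\<Union>c\<in>I. E c)"
    proof
      fix b assume b: "b \<in> ?P"
      show "b \<in> G \<union> (\<Union>c\<in>I. E c)"
      proof (rule ccontr)
        assume n: "b \<notin> G \<union> (\<Union>c\<in>I. E c)"
        have "\<bar>real (card {l \<in> {..<m}. b l \<in> T c}) / real m - p c\<bar> < e" if c: "c \<in> I" for c
        proof -
          have "\<bar>\<Sum>l<m. \<phi> c (b l)\<bar> < real m * e" using n c b by (auto simp: E_def not_le)
          moreover have "(\<Sum>l<m. \<phi> c (b l)) = real (card {l \<in> {..<m}. b l \<in> T c}) - real m * p c"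
          proof -
            have "(\<Sum>l<m. indicator (T c) (b l)) = (\<Sum>l<m. if b l \<in> T c then 1 else 0 :: real)"
              by (rule sum.cong) auto
            also have "\<dots> = real (card {l \<in> {..<m}. b l \<in> T c})" by (simp add: sum.If_cases Int_def)
            finally show ?thesis by (simp only: \<phi>_def sum_subtractf) simp
          qed
          moreover have "real (card {l \<in> {..<m}. b l \<in> T c}) / real m - p c
              = (real (card {l \<in> {..<m}. b l \<in> T c}) - real m * p c) / real m"
            using m by (simp add: field_simps)
          ultimately show ?thesis using m by (simp add: abs_divide pos_divide_less_eq mult.commute)
        qed
        then show False using n b G by auto
      qed
    qed
    show "0 \<le> (\<Prod>l<m. w (b l))" if "b \<in> G \<union> (\<Union>c\<in>I. E c) - ?P" for b
      using that G by (auto simp: E_def)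
  qed
  also have "\<dots> \<le> (\<Sum>b\<in>G. \<Prod>l<m. w (b l)) + (\<Sum>b\<in>(\<Union>c\<in>I. E c). \<Prod>l<m. w (b l))"
  proof -
    have "(\<Sum>b\<in>G \<union> (\<Union>c\<in>I. E c). \<Prod>l<m. w (b l)) + (\<Sum>b\<in>G \<inter> (\<Union>c\<in>I. E c). \<Prod>l<m. w (b l))
       = (\<Sum>b\<in>G. \<Prod>l<m. w (b l)) + (\<Sum>b\<in>(\<Union>c\<in>I. E c). \<Prod>l<m. w (b l))"
      by (rule sum.union_inter) (use finG fin \<open>finite I\<close> in \<open>auto simp: E_def\<close>)
    moreover have "0 \<le> (\<Sum>b\<in>G \<inter> (\<Union>c\<in>I. E c). \<Prod>l<m. w (b l))"
      by (rule sum_nonneg) (use pr G in auto)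
    ultimately show ?thesis by linarith
  qed
  also have "(\<Sum>b\<in>(\<Union>c\<in>I. E c). \<Prod>l<m. w (b l)) \<le> (\<Sum>c\<in>I. \<Sum>b\<in>E c. \<Prod>l<m. w (b l))"
  proof -
    \<comment> \<open>The union bound: the union is the image of the disjoint sum of the events
      under the second projection.\<close>
    have "(\<Sum>b\<in>(\<Union>c\<in>I. E c). \<Prod>l<m. w (b l)) \<le> (\<Sum>b\<in>snd ` (SIGMA c:I. E c). \<Prod>l<m. w (b l))"
      by (rule sum_mono2) (use fin \<open>finite I\<close> pr in \<open>auto simp: E_def image_iff\<close>)
    also have "\<dots> \<le> (\<Sum>x\<in>(SIGMA c:I. E c). \<Prod>l<m. w (snd x l))"
      using sum_image_le[of "SIGMA c:I. E c" "\<lambda>b. \<Prod>l<m. w (b l)" snd] fin \<open>finite I\<close> pr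
      by (auto simp: E_def o_def)
    also have "\<dots> = (\<Sum>c\<in>I. \<Sum>b\<in>E c. \<Prod>l<m. w (b l))"
      by (subst sum.Sigma) (use fin \<open>finite I\<close> in \<open>auto simp: E_def case_prod_beta\<close>)
    finally show ?thesis .
  qed
  also have "(\<Sum>c\<in>I. \<Sum>b\<in>E c. \<Prod>l<m. w (b l)) \<le> (\<Sum>c\<in>I. 1 / (real m * e\<^sup>2))"
    unfolding E_def by (rule sum_mono, rule weighted_Chebyshev) (use assms w0 w1 \<phi>0 \<phi>1 in auto)
  also have "\<dots> = real (card I) / (real m * e\<^sup>2)" by simp
  finally have "1 - real (card I) / (real m * e\<^sup>2) \<le> (\<Sum>b\<in>G. \<Prod>l<m. w (b l))" by simp
  \<comment> \<open>The change of measure: every member of G has tilted weight at most exp (m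
    \<eta>) / Z^m, so a lower bound on the tilted mass of G turns into one on its
    cardinality.\<close>
  also have "\<dots> \<le> (\<Sum>b\<in>G. exp (real m * \<eta>) / Z ^ m)"
  proof (rule sum_mono)
    fix b assume b: "b \<in> G"
    have bS: "b l \<in> S" if "l < m" for l using b G that by (auto dest: PiE_mem)
    have "(\<Prod>l<m. \<theta> (b l)) \<le> exp (real m * \<eta>)"
    proof (cases "\<forall>l<m. 0 < \<theta> (b l)")
      case True
      then show ?thesis by (rule \<eta>[OF b])
    next
      \<comment> \<open>The bound by \<eta> will come from logarithms and is assumed for positive
        tilts only; with a vanishing tilt the product is 0.\<close>
      case False
      then obtain l where "l < m" "\<theta> (b l) = 0" using \<theta>[OF bS] by force
      then have z: "(\<Prod>l<m. \<theta> (b l)) = 0" by (intro prod_zero) auto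
      show ?thesis unfolding z by simp
    qed
    then show "(\<Prod>l<m. w (b l)) \<le> exp (real m * \<eta>) / Z ^ m"
      using Z by (simp add: w_def prod_dividef divide_right_mono)
  qed
  also have "\<dots> = real (card G) * exp (real m * \<eta>) / Z ^ m" by simp
  finally show ?thesis using Z by (simp add: exp_minus field_simps)
qed

section \<open>Sanov bounds for triangular arrays\<close>

definition empirical_measure :: "'b topology \<Rightarrow> nat \<Rightarrow> (nat \<Rightarrow> 'b) \<Rightarrow> 'b measure" where
  "empirical_measure X m z = lin_comb X {..<m} (\<lambda>_. 1 / real m) (\<lambda>l. dirac X (z l))"

lemma emeasure_empirical_measure:
  assumes "A \<in> sets (borel_of X)" "m > 0"
  shows "emeasure (empirical_measure X m z) A = ennreal (real (card {l \<in> {..<m}. z l \<in> A}) / real m)"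
proof -
  have "emeasure (empirical_measure X m z) A = (\<Sum>l<m. ennreal (1 / real m) * indicator A (z l))"
    unfolding empirical_measure_def using assms
    by (subst emeasure_lin_comb) auto
  also have "\<dots> = (\<Sum>l<m. ennreal (if z l \<in> A then 1 / real m else 0))"
    by (rule sum.cong) auto
  also have "\<dots> = ennreal (\<Sum>l<m. if z l \<in> A then 1 / real m else 0)"
    by (rule sum_ennreal) auto
  also have "(\<Sum>l<m. if z l \<in> A then 1 / real m else 0) = real (card {l \<in> {..<m}. z l \<in> A}) / real m"
    by (simp add: sum.If_cases Int_def)
  finally show ?thesis .
qed

lemma measure_empirical_measure:
  assumes "A \<in> sets (borel_of X)" "m > 0"
  shows "measure (empirical_measure X m z) A = real (card {l \<in> {..<m}. z l \<in> A}) / real m"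
  using emeasure_empirical_measure[OF assms, of z] by (simp add: measure_def)

lemma empirical_measure_borel_probs:
  assumes "m > 0" and "\<And>l. l < m \<Longrightarrow> z l \<in> topspace X"
  shows "empirical_measure X m z \<in> borel_probs X"
proof -
  have "{l \<in> {..<m}. z l \<in> topspace X} = {..<m}" using assms by auto
  then have "emeasure (empirical_measure X m z) (topspace X) = 1"
    using sets.top[of "borel_of X"] assms(1) by (subst emeasure_empirical_measure) auto
  then show ?thesis
    unfolding borel_probs_def empirical_measure_def by (auto intro!: prob_spaceI)
qed

lemma average_empirical_measure:
  assumes "A \<in> sets (borel_of X)" "m > 0"
  shows "measure (empirical_measure X m z) A = (\<Sum>l<m. indicator A (z l)) / real m"
proof -
  have "(\<Sum>l<m. indicator A (z l)) = (\<Sum>l<m. if z l \<in> A then 1 else 0 :: real)" by (rule sum.cong) auto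
  also have "\<dots> = real (card {l \<in> {..<m}. z l \<in> A})" by (simp add: sum.If_cases Int_def)
  finally show ?thesis using measure_empirical_measure[OF assms, of z] by simp
qed

text \<open>These are the atoms of the finite algebra generated by F, indexed by the members of F
  that contain the point. Members are intersected one at a time.\<close>

lemma (in algebra) label_set_in_algebra:
  assumes "finite F" "F \<subseteq> M" "c \<subseteq> F"
  shows "{x \<in> \<Omega>. {A \<in> F. x \<in> A} = c} \<in> M"
proof -
  have "{x \<in> \<Omega>. \<forall>A\<in>F'. x \<in> A \<longleftrightarrow> A \<in> c} \<in> M" if "F' \<subseteq> F" for F'
    using finite_subset[OF that \<open>finite F\<close>] that
  proof (induction rule: finite_induct)
    case empty
    then show ?case by simp
  next
    case (insert A F')
    have "{x \<in> \<Omega>. \<forall>B\<in>insert A F'. x \<in> B \<longleftrightarrow> B \<in> c}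
      = {x \<in> \<Omega>. \<forall>B\<in>F'. x \<in> B \<longleftrightarrow> B \<in> c} \<inter> (if A \<in> c then A else \<Omega> - A)" by auto
    moreover have "A \<in> M" using insert.prems assms(2) by auto
    ultimately show ?case using insert by auto
  qed
  from this[of F] have "{x \<in> \<Omega>. \<forall>A\<in>F. x \<in> A \<longleftrightarrow> A \<in> c} \<in> M" by simp
  moreover have "{x \<in> \<Omega>. {A \<in> F. x \<in> A} = c} = {x \<in> \<Omega>. \<forall>A\<in>F. x \<in> A \<longleftrightarrow> A \<in> c}"
    using assms(3) by auto
  ultimately show ?thesis by simp
qed

text \<open>\<open>y n\<close> lists the n points of the population and \<open>m n\<close> is the
  number of draws from it. Both the filter and m stay abstract; in the application F runs through
  the multiples of k, m n = n div k, and the population consists of k-tuples.\<close>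

locale triangular_array = continuity_algebra X \<mu> for X :: "'b topology" and \<mu> +
  fixes F :: "nat filter" and m :: "nat \<Rightarrow> nat" and y :: "nat \<Rightarrow> nat \<Rightarrow> 'b"
  assumes y: "\<And>n i. i \<in> {1..n} \<Longrightarrow> y n i \<in> topspace X"
    and n_pos: "\<forall>\<^sub>F n in F. n > 0"
    and m_at_top: "filterlim m at_top F"
    and averages: "\<And>f. bounded_continuous X f \<Longrightarrow>
      ((\<lambda>n. (\<Sum>i\<in>{1..n}. f (y n i)) / real n) \<longlongrightarrow> (\<integral>x. f x \<partial>\<mu>)) F"
begin

definition draws :: "nat \<Rightarrow> (nat \<Rightarrow> nat) set" where
  "draws n = PiE {..<m n} (\<lambda>_. {1..n})"

definition empirical :: "nat \<Rightarrow> (nat \<Rightarrow> nat) \<Rightarrow> 'b measure" where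
  "empirical n b = empirical_measure X (m n) (\<lambda>l. y n (b l))"

text \<open>The probability that the empirical measure of \<open>m n\<close> uniform draws lies in
  U. As a ratio of counts it has a value for every U, before any measurability on the space of
  measures is discussed.\<close>

definition frequency :: "nat \<Rightarrow> 'b measure set \<Rightarrow> real" where
  "frequency n U = real (card {b \<in> draws n. empirical n b \<in> U}) / real n ^ m n"

definition avg :: "nat \<Rightarrow> ('b \<Rightarrow> real) \<Rightarrow> real" where
  "avg n f = (\<Sum>i\<in>{1..n}. f (y n i)) / real n"

lemma m_eventually_gt: "\<forall>\<^sub>F n in F. c < real (m n)"
proof -
  have "filterlim (\<lambda>n. real (m n)) at_top F"
    by (rule filterlim_compose[OF filterlim_real_sequentially m_at_top])
  then show ?thesis by (simp add: filterlim_at_top_dense)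
qed

lemma m_eventually_pos: "\<forall>\<^sub>F n in F. m n > 0"
  using m_eventually_gt[of 0] by simp

lemma finite_draws: "finite (draws n)"
  unfolding draws_def by (intro finite_PiE) auto

lemma empirical_borel_probs: "m n > 0 \<Longrightarrow> b \<in> draws n \<Longrightarrow> empirical n b \<in> borel_probs X"
  unfolding empirical_def draws_def by (intro empirical_measure_borel_probs y) (auto dest!: PiE_mem)

text \<open>The portmanteau theorem: the continuous brackets of A have convergent averages, and the
  gap of their limits is below e/2.\<close>

lemma avg_cont_sets:
  assumes A: "A \<in> cont_sets"
  shows "((\<lambda>n. avg n (indicator A)) \<longlongrightarrow> measure \<mu> A) F"
proof (rule tendstoI)
  fix e :: real assume "e > 0"
  then have e2: "e / 2 > 0" by simp
  obtain g h where gh: "bounded_continuous X g" "bounded_continuous X h"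
    "\<And>x. x \<in> topspace X \<Longrightarrow> g x \<le> indicator A x" "\<And>x. x \<in> topspace X \<Longrightarrow> indicator A x \<le> h x"
    "(\<integral>x. h x \<partial>\<mu>) - (\<integral>x. g x \<partial>\<mu>) < e / 2"
    using cont_setsE[OF A e2] by metis
  have As: "A \<in> sets \<mu>" using cont_sets_events[OF mu A] .
  have ind: "integrable \<mu> (indicator A :: 'b \<Rightarrow> real)" "(\<integral>x. indicator A x \<partial>\<mu>) = measure \<mu> A"
    using As sets.sets_into_space[OF As] by (auto simp: Int_absorb2 less_top[symmetric])
  have spc: "space \<mu> = topspace X" by (rule borel_probsD(3)[OF mu])
  have lo: "(\<integral>x. g x \<partial>\<mu>) \<le> measure \<mu> A" unfolding ind(2)[symmetric]
    by (rule integral_mono) (use ind gh spc bounded_continuous_integrable[OF _ mu] in auto)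
  have hi: "measure \<mu> A \<le> (\<integral>x. h x \<partial>\<mu>)" unfolding ind(2)[symmetric]
    by (rule integral_mono) (use ind gh spc bounded_continuous_integrable[OF _ mu] in auto)
  have "\<forall>\<^sub>F n in F. (\<integral>x. g x \<partial>\<mu>) - e / 2 < avg n g"
    using averages[OF gh(1)] e2 unfolding avg_def by (intro order_tendstoD) auto
  moreover have "\<forall>\<^sub>F n in F. avg n h < (\<integral>x. h x \<partial>\<mu>) + e / 2"
    using averages[OF gh(2)] e2 unfolding avg_def by (intro order_tendstoD) auto
  ultimately show "\<forall>\<^sub>F n in F. dist (avg n (indicator A)) (measure \<mu> A) < e"
  proof eventually_elim
    case (elim n)
    have "avg n g \<le> avg n (indicator A)" "avg n (indicator A) \<le> avg n h"
      unfolding avg_def by (intro divide_right_mono sum_mono gh y; simp)+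
    then show ?case using elim lo hi gh(5) unfolding dist_real_def by linarith
  qed
qed

text \<open>Induction by exp (a 1_A) = 1 + (exp a - 1) 1_A. The extra factor, the indicator of B,
  absorbs 1_A as the indicator of the intersection and so keeps the induction inside the
  algebra.\<close>

lemma avg_exp_step_function_aux:
  fixes N :: nat
  assumes "\<And>j. j < N \<Longrightarrow> A j \<in> cont_sets" and "B \<in> cont_sets"
  shows "((\<lambda>n. avg n (\<lambda>x. indicator B x * exp (\<Sum>j<N. a j * indicator (A j) x)))
      \<longlongrightarrow> (\<integral>x. indicator B x * exp (\<Sum>j<N. a j * indicator (A j) x) \<partial>\<mu>)) F"
  using assms
proof (induction N arbitrary: B)
  case 0
  have "(\<integral>x. indicator B x \<partial>\<mu>) = measure \<mu> B"
    using cont_sets_events[OF mu 0(2)] sets.sets_into_space by (simp add: Int_absorb2)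
  then show ?case using avg_cont_sets[OF 0(2)] by simp
next
  case (Suc N)
  interpret A: algebra "topspace X" cont_sets by (rule algebra_cont_sets)
  define E where "E x = exp (\<Sum>j<N. a j * indicator (A j) x)" for x
  have AN: "A N \<in> cont_sets" "B \<inter> A N \<in> cont_sets" using Suc.prems by auto
  have I1: "((\<lambda>n. avg n (\<lambda>x. indicator C x * E x)) \<longlongrightarrow> (\<integral>x. indicator C x * E x \<partial>\<mu>)) F"
    if "C \<in> cont_sets" for C
    unfolding E_def by (rule Suc.IH[OF _ that]) (use Suc.prems in auto)
  have Ei: "integrable \<mu> (\<lambda>x. indicator C x * E x)" if "C \<in> cont_sets" for C
    using integrable_real_mult_indicator[OF cont_sets_events[OF mu that], of E]
      exp_step_function_integral(1)[of N A a] Suc.prems cont_sets_events[OF mu]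
    unfolding E_def by (simp add: mult.commute)
  have split: "indicator B x * exp (\<Sum>j<Suc N. a j * indicator (A j) x)
      = indicator B x * E x + (exp (a N) - 1) * (indicator (B \<inter> A N) x * E x)" for x
    by (auto simp: E_def exp_add indicator_def algebra_simps)
  have "((\<lambda>n. avg n (\<lambda>x. indicator B x * E x) + (exp (a N) - 1) * avg n (\<lambda>x. indicator (B \<inter> A N) x * E x))
     \<longlongrightarrow> (\<integral>x. indicator B x * E x \<partial>\<mu>) + (exp (a N) - 1) * (\<integral>x. indicator (B \<inter> A N) x * E x \<partial>\<mu>)) F"
    by (intro tendsto_intros I1 AN Suc.prems)
  moreover have "avg n (\<lambda>x. indicator B x * E x) + (exp (a N) - 1) * avg n (\<lambda>x. indicator (B \<inter> A N) x * E x)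
      = avg n (\<lambda>x. indicator B x * E x + (exp (a N) - 1) * (indicator (B \<inter> A N) x * E x))" for n
    by (simp only: avg_def sum.distrib sum_distrib_left[symmetric] add_divide_distrib times_divide_eq_right)
  moreover have "(\<integral>x. indicator B x * E x \<partial>\<mu>) + (exp (a N) - 1) * (\<integral>x. indicator (B \<inter> A N) x * E x \<partial>\<mu>)
      = (\<integral>x. indicator B x * E x + (exp (a N) - 1) * (indicator (B \<inter> A N) x * E x) \<partial>\<mu>)"
    using Ei[OF Suc.prems(2)] Ei[OF AN(2)]
    by (simp only: Bochner_Integration.integral_add Bochner_Integration.integral_mult_right_zero integrable_mult_right)
  ultimately show ?case unfolding split by simp
qed

lemma avg_exp_step_function:
  fixes N :: nat
  assumes "\<And>j. j < N \<Longrightarrow> A j \<in> cont_sets"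
  shows "((\<lambda>n. avg n (\<lambda>x. exp (\<Sum>j<N. a j * indicator (A j) x)))
      \<longlongrightarrow> (\<integral>x. exp (\<Sum>j<N. a j * indicator (A j) x) \<partial>\<mu>)) F"
proof -
  let ?E = "\<lambda>x. exp (\<Sum>j<N. a j * indicator (A j) x)"
  have "(\<integral>x. indicator (topspace X) x * ?E x \<partial>\<mu>) = (\<integral>x. ?E x \<partial>\<mu>)"
    by (rule Bochner_Integration.integral_cong) (use borel_probsD(3)[OF mu] in auto)
  moreover have "avg n (\<lambda>x. indicator (topspace X) x * ?E x) = avg n ?E" for n
    unfolding avg_def using y by simp
  ultimately show ?thesis
    using avg_exp_step_function_aux[where N=N and A=A and a=a, OF assms algebra.top[OF algebra_cont_sets]]
    by simp
qed

text \<open>A step integral against the empirical measure is an average over the draws, so the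
  Chernoff count applies; the exponential moment of the population tends to that of \<mu>.\<close>

lemma frequency_halfspace:
  assumes A: "\<And>j. j < N \<Longrightarrow> A j \<in> cont_sets" and "c' < c"
  shows "\<forall>\<^sub>F n in F. real (card {b \<in> draws n. c + pressure N a A < (\<Sum>j<N. a j * measure (empirical n b) (A j))})
    / real n ^ m n \<le> exp (- real (m n) * c')"
proof -
  define f where "f x = (\<Sum>j<N. a j * indicator (A j) x)" for x
  define Z where "Z = (\<integral>x. exp (f x) \<partial>\<mu>)"
  have Z: "Z > 0" unfolding Z_def f_def
    by (rule exp_step_function_integral_pos) (use A cont_sets_events[OF mu] in auto)
  have "((\<lambda>n. avg n (\<lambda>x. exp (f x))) \<longlongrightarrow> Z) F"
    unfolding Z_def f_def by (rule avg_exp_step_function[OF A])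
  \<comment> \<open>The gap between c' and c absorbs the error of the finite population, which
    enters with power \<open>m n\<close>.\<close>
  moreover have "Z < Z * exp (c - c')" using Z \<open>c' < c\<close> by simp
  ultimately have "\<forall>\<^sub>F n in F. avg n (\<lambda>x. exp (f x)) < Z * exp (c - c')" by (rule order_tendstoD)
  then show ?thesis
    using n_pos m_eventually_pos
  proof eventually_elim
    case (elim n)
    let ?t = "c + pressure N a A"
    have eq: "(\<Sum>j<N. a j * measure (empirical n b) (A j)) = (\<Sum>l<m n. f (y n (b l))) / real (m n)" for b
    proof -
      have "(\<Sum>j<N. a j * measure (empirical n b) (A j))
          = (\<Sum>j<N. a j * ((\<Sum>l<m n. indicator (A j) (y n (b l))) / real (m n)))"
        unfolding empirical_def
        by (intro sum.cong refl) (use A cont_sets_borel elim in \<open>simp add: average_empirical_measure\<close>)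
      also have "\<dots> = (\<Sum>j<N. \<Sum>l<m n. a j * indicator (A j) (y n (b l))) / real (m n)"
        by (simp only: sum_distrib_left sum_divide_distrib times_divide_eq_right)
      also have "(\<Sum>j<N. \<Sum>l<m n. a j * indicator (A j) (y n (b l))) = (\<Sum>l<m n. f (y n (b l)))"
        unfolding f_def by (rule sum.swap)
      finally show ?thesis .
    qed
    have "real (card {b \<in> draws n. ?t < (\<Sum>j<N. a j * measure (empirical n b) (A j))})
        = real (card {b \<in> PiE {..<m n} (\<lambda>_. {1..n}). real (m n) * ?t < (\<Sum>l<m n. f (y n (b l)))})"
      unfolding eq draws_def using elim by (simp add: pos_less_divide_eq mult.commute)
    also have "\<dots> \<le> exp (- real (m n) * ?t) * (\<Sum>i\<in>{1..n}. exp (f (y n i))) ^ m n"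
      by (rule card_exponential_bound) simp
    also have "(\<Sum>i\<in>{1..n}. exp (f (y n i))) = real n * avg n (\<lambda>x. exp (f x))"
      using elim by (simp add: avg_def)
    also have "(real n * avg n (\<lambda>x. exp (f x))) ^ m n \<le> (real n * (Z * exp (c - c'))) ^ m n"
      using elim by (intro power_mono mult_left_mono) (auto simp: avg_def intro!: sum_nonneg divide_nonneg_nonneg)
    also have "exp (- real (m n) * ?t) * (real n * (Z * exp (c - c'))) ^ m n
        = real n ^ m n * exp (- real (m n) * c')"
    proof -
      have "exp (- real (m n) * ?t) = exp (- c) ^ m n / Z ^ m n"
      proof -
        have "exp ?t = exp c * Z" using Z unfolding pressure_def f_def[symmetric] Z_def[symmetric]
          by (simp add: exp_add)
        then have "exp (- ?t) = inverse (exp c * Z)" by (simp only: exp_minus)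
        then have "exp (- ?t) = exp (- c) / Z" by (simp add: exp_minus field_simps)
        then show ?thesis
          by (metis exp_of_nat_mult mult_minus_left mult_minus_right power_divide)
      qed
      moreover have "exp (- c) ^ m n / Z ^ m n * (real n * (Z * exp (c - c'))) ^ m n
          = real n ^ m n * (exp (- c) * exp (c - c')) ^ m n"
        using Z unfolding power_mult_distrib by simp
      moreover have "exp (- c) * exp (c - c') = exp (- c')" by (simp flip: exp_add)
      moreover have "exp (- real (m n) * c') = exp (- c') ^ m n"
        by (metis exp_of_nat_mult mult_minus_left mult_minus_right)
      ultimately show ?thesis by (simp only:)
    qed
    finally show ?case using elim by (simp add: pos_divide_le_eq mult.commute mult_left_mono)
  qed
qed

theorem frequency_upper_bound:
  assumes C: "closedin (weak_topology X) C" and disj: "C \<inter> entropy_ball c = {}" and "c' < c"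
  shows "\<forall>\<^sub>F n in F. frequency n C \<le> exp (- real (m n) * c')"
proof -
  obtain J :: "(nat \<times> (nat \<Rightarrow> real) \<times> (nat \<Rightarrow> 'b set)) set" where J: "finite J"
    "\<And>N a A j. (N, a, A) \<in> J \<Longrightarrow> j < N \<Longrightarrow> A j \<in> cont_sets"
    "\<And>\<nu>. \<nu> \<in> C \<Longrightarrow> \<exists>(N, a, A)\<in>J. c + pressure N a A < (\<Sum>j<N. a j * measure \<nu> (A j))"
    by (rule closed_disjoint_entropy_ball_cover[OF C disj]) blast
  define E where "E n = (\<lambda>(N, a, A). {b \<in> draws n. c + pressure N a A < (\<Sum>j<N. a j * measure (empirical n b) (A j))})" for n
  \<comment> \<open>Half of the gap is spent in Chernoff's inequality, the other half on the number
    of half-spaces.\<close>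
  define d where "d = (c + c') / 2"
  have d: "d < c" "c' < d" using \<open>c' < c\<close> by (auto simp: d_def)
  have "\<forall>\<^sub>F n in F. \<forall>t\<in>J. real (card (E n t)) / real n ^ m n \<le> exp (- real (m n) * d)"
  proof (rule eventually_ball_finite[OF J(1)], rule ballI)
    fix t assume t: "t \<in> J"
    obtain N a A where tt: "t = (N, a, A)" by (cases t)
    have "\<And>j. j < N \<Longrightarrow> A j \<in> cont_sets" using J(2) t tt by blast
    from frequency_halfspace[OF this d(1)]
    show "\<forall>\<^sub>F n in F. real (card (E n t)) / real n ^ m n \<le> exp (- real (m n) * d)"
      by (simp add: E_def tt)
  qed
  \<comment> \<open>Eventually exp (m (d - c')) exceeds the number of half-spaces; the summand 1
    covers an empty family.\<close>
  moreover have "\<forall>\<^sub>F n in F. ln (real (card J) + 1) / (d - c') < real (m n)" by (rule m_eventually_gt)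
  ultimately show ?thesis
    using n_pos
  proof eventually_elim
    case (elim n)
    have "{b \<in> draws n. empirical n b \<in> C} \<subseteq> (\<Union>t\<in>J. E n t)"
    proof
      fix b assume b: "b \<in> {b \<in> draws n. empirical n b \<in> C}"
      then obtain t where "t \<in> J" "case t of (N, a, A) \<Rightarrow> c + pressure N a A < (\<Sum>j<N. a j * measure (empirical n b) (A j))"
        using J(3)[of "empirical n b"] by blast
      then show "b \<in> (\<Union>t\<in>J. E n t)" using b by (auto simp: E_def)
    qed
    then have "card {b \<in> draws n. empirical n b \<in> C} \<le> card (\<Union>t\<in>J. E n t)"
      using J(1) finite_draws by (intro card_mono finite_UN_I) (auto simp: E_def split: prod.splits)
    also have "\<dots> \<le> (\<Sum>t\<in>J. card (E n t))" using J(1) by (rule card_UN_le)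
    finally have "frequency n C \<le> (\<Sum>t\<in>J. real (card (E n t))) / real n ^ m n"
      unfolding frequency_def by (intro divide_right_mono) (simp_all flip: of_nat_sum)
    also have "\<dots> = (\<Sum>t\<in>J. real (card (E n t)) / real n ^ m n)" by (rule sum_divide_distrib)
    also have "\<dots> \<le> (\<Sum>t\<in>J. exp (- real (m n) * d))" using elim by (intro sum_mono) auto
    also have "\<dots> \<le> (real (card J) + 1) * exp (- real (m n) * d)" by (simp add: distrib_right)
    also have "\<dots> \<le> exp (real (m n) * (d - c')) * exp (- real (m n) * d)"
    proof (intro mult_right_mono)
      have l: "ln (real (card J) + 1) \<le> real (m n) * (d - c')"
        using elim d by (simp add: pos_divide_less_eq)
      have "real (card J) + 1 = exp (ln (real (card J) + 1))" by simp
      also have "\<dots> \<le> exp (real (m n) * (d - c'))" by (simp only: exp_le_cancel_iff l)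
      finally show "real (card J) + 1 \<le> exp (real (m n) * (d - c'))" .
    qed simp
    also have "\<dots> = exp (- real (m n) * c')" by (simp flip: exp_add add: algebra_simps)
    finally show ?case .
  qed
qed

end

section \<open>Lower bound: finite partitions and tilting\<close>

lemma sum_indicator_label:
  fixes g :: "'c \<Rightarrow> real"
  assumes "finite I" "lab x \<in> I" "x \<in> \<Omega>"
  shows "(\<Sum>i\<in>I. g i * indicator {z \<in> \<Omega>. lab z = i} x) = g (lab x)"
proof -
  have "(\<Sum>i\<in>I. g i * indicator {z \<in> \<Omega>. lab z = i} x) = (\<Sum>i\<in>I. if i = lab x then g i else 0)"
    by (rule sum.cong) (use assms in \<open>auto simp: indicator_def\<close>)
  then show ?thesis using assms by simp
qed

context continuity_algebra
begin

lemma entropy_bounded_finite: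
  assumes "entropy_bounded c \<psi>" and "finite I" and A: "\<And>i. i \<in> I \<Longrightarrow> A i \<in> cont_sets"
  shows "(\<Sum>i\<in>I. a i * \<psi> (A i)) \<le> c + ln (\<integral>x. exp (\<Sum>i\<in>I. a i * indicator (A i) x) \<partial>\<mu>)"
proof -
  obtain h where h: "bij_betw h {0..<card I} I" using ex_bij_betw_nat_finite[OF \<open>finite I\<close>] by blast
  then have h: "bij_betw h {..<card I} I" by (simp add: atLeast0LessThan)
  have "(\<Sum>j<card I. a (h j) * \<psi> (A (h j))) \<le> c + pressure (card I) (a \<circ> h) (A \<circ> h)"
    using entropy_boundedD[OF assms(1), where N="card I" and A="A \<circ> h" and a="a \<circ> h"] A
      bij_betwE[OF h] by simp
  then show ?thesis
    unfolding pressure_def using sum.reindex_bij_betw[OF h, of "\<lambda>i. a i * \<psi> (A i)"]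
      sum.reindex_bij_betw[OF h, of "\<lambda>i. a i * indicator (A i) x" for x] by simp
qed

lemma measure_zero_if_entropy_bounded:
  assumes "entropy_bounded c \<psi>" "A \<in> cont_sets" "measure \<mu> A = 0"
  shows "\<psi> A \<le> 0"
proof (rule ccontr)
  assume "\<not> \<psi> A \<le> 0"
  then have p: "\<psi> A > 0" by simp
  have "(\<bar>c\<bar> + 1) / \<psi> A * \<psi> A \<le> c"
    using entropy_bounded_small_sets[OF assms(1,2), of "(\<bar>c\<bar> + 1) / \<psi> A"] p assms(3) by simp
  then show False using p by simp
qed

text \<open>Relative entropy does not increase when the space is reduced to finitely many cells. The
  test function is the log-density ln (p i / q i) of the cell probabilities, whose exponential
  moment under \<mu> is essentially 1.\<close>

lemma relative_entropy_partition:
  fixes lab :: "'b \<Rightarrow> 'c"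
  assumes \<nu>: "\<nu> \<in> entropy_ball h" and I: "finite I" "\<And>i. i \<in> I \<Longrightarrow> B i \<in> cont_sets"
    and lab: "\<And>x. lab x \<in> I" and B: "\<And>i. B i = {x \<in> topspace X. lab x = i}"
  shows "(\<Sum>i\<in>I. measure \<nu> (B i) * ln (measure \<nu> (B i) / measure \<mu> (B i))) \<le> h"
proof (rule field_le_epsilon)
  fix e :: real assume e: "e > 0"
  define p where "p i = measure \<nu> (B i)" for i
  define q where "q i = measure \<mu> (B i)" for i
  have \<nu>b: "\<nu> \<in> borel_probs X" using \<nu> by (simp add: entropy_ball_def)
  interpret N: prob_space \<nu> using \<nu>b borel_probsD by blast
  have ents: "B i \<in> sets \<nu>" "B i \<in> sets \<mu>" if "i \<in> I" for i
    using I(2)[OF that] cont_sets_events \<nu>b mu by auto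
  have spc: "space \<nu> = topspace X" "space \<mu> = topspace X" using borel_probsD(3) \<nu>b mu by auto
  have one: "(\<Sum>i\<in>I. g i * indicator (B i) x) = g (lab x)" if "x \<in> topspace X" for x and g :: "'c \<Rightarrow> real"
    unfolding B using I(1) lab that by (rule sum_indicator_label)
  have total: "(\<Sum>i\<in>I. measure \<rho> (B i)) = 1" if "\<rho> \<in> borel_probs X" for \<rho>
  proof -
    interpret R: prob_space \<rho> using that borel_probsD by blast
    have "(\<Sum>i\<in>I. measure \<rho> (B i)) = measure \<rho> (\<Union>i\<in>I. B i)"
      by (rule measure_finite_Union[symmetric])
        (use I cont_sets_events[OF that] in \<open>auto simp: disjoint_family_on_def B\<close>)
    also have "(\<Union>i\<in>I. B i) = space \<rho>"
      using lab borel_probsD(3)[OF that] by (auto simp: B)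
    finally show ?thesis using R.prob_space by simp
  qed
  have pq: "p i = 0" if "i \<in> I" "q i = 0" for i
    using measure_zero_if_entropy_bounded[OF entropy_ball_imp_bounded[OF \<nu>] I(2)[OF that(1)]] that(2)
    unfolding p_def q_def by (simp add: measure_le_0_iff)
  \<comment> \<open>The ideal coefficient of a cell with p i = 0 is minus infinity; ln e stands in
    for it and contributes at most e q i to the exponential moment. Such a cell adds nothing to
    either linear sum.\<close>
  define a where "a i = (if p i = 0 then ln e else ln (p i / q i))" for i
  have ea: "exp (a i) = (if p i = 0 then e else p i / q i)" if "i \<in> I" for i
  proof (cases "p i = 0")
    case False
    then have "p i > 0" "q i > 0" using pq[OF that] by (auto simp: p_def q_def less_le)
    then show ?thesis using False by (simp add: a_def)
  qed (use e in \<open>simp add: a_def\<close>)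
  have "(\<Sum>i\<in>I. a i * measure \<nu> (B i)) \<le> h + ln (\<integral>x. exp (\<Sum>i\<in>I. a i * indicator (B i) x) \<partial>\<mu>)"
    by (rule entropy_bounded_finite[OF entropy_ball_imp_bounded[OF \<nu>] I])
  also have "(\<Sum>i\<in>I. a i * measure \<nu> (B i)) = (\<Sum>i\<in>I. p i * ln (p i / q i))"
    by (rule sum.cong) (auto simp: a_def p_def)
  also have "(\<integral>x. exp (\<Sum>i\<in>I. a i * indicator (B i) x) \<partial>\<mu>) = (\<integral>x. (\<Sum>i\<in>I. exp (a i) * indicator (B i) x) \<partial>\<mu>)"
    by (rule Bochner_Integration.integral_cong) (use one spc in auto)
  also have "\<dots> = (\<Sum>i\<in>I. \<integral>x. exp (a i) * indicator (B i) x \<partial>\<mu>)"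
    by (rule Bochner_Integration.integral_sum)
      (use ents in \<open>auto intro!: integrable_mult_right integrable_real_indicator simp: less_top[symmetric]\<close>)
  also have "\<dots> = (\<Sum>i\<in>I. exp (a i) * q i)"
    by (rule sum.cong) (use ents sets.sets_into_space in \<open>auto simp: q_def Int_absorb2\<close>)
  \<comment> \<open>The total is at most 1 + e, and ln u \<le> u - 1 turns this into the error
    e.\<close>
  also have "ln (\<Sum>i\<in>I. exp (a i) * q i) \<le> (\<Sum>i\<in>I. exp (a i) * q i) - 1"
  proof (rule ln_le_minus_one)
    have "\<exists>i\<in>I. q i \<noteq> 0" using total[OF mu] unfolding q_def by (metis sum.neutral zero_neq_one)
    then obtain i where i: "i \<in> I" "q i \<noteq> 0" by blast
    show "0 < (\<Sum>i\<in>I. exp (a i) * q i)"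
      by (rule sum_pos2[OF I(1) i(1)]) (use i in \<open>auto simp: q_def less_le\<close>)
  qed
  also have "(\<Sum>i\<in>I. exp (a i) * q i) \<le> (\<Sum>i\<in>I. p i + e * q i)"
  proof (rule sum_mono)
    fix i assume i: "i \<in> I"
    show "exp (a i) * q i \<le> p i + e * q i"
      using ea[OF i] pq[OF i] e by (cases "q i = 0") (auto simp: p_def q_def)
  qed
  also have "\<dots> = 1 + e"
    using total[OF mu] total[OF \<nu>b] by (simp add: sum.distrib p_def q_def flip: sum_distrib_left)
  finally have "(\<Sum>i\<in>I. p i * ln (p i / q i)) \<le> h + e" by simp
  then show "(\<Sum>i\<in>I. measure \<nu> (B i) * ln (measure \<nu> (B i) / measure \<mu> (B i))) \<le> h + e"
    by (simp add: p_def q_def)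
qed

end

context triangular_array
begin

text \<open>The neighbourhood is replaced by conditions on the cells of a finite partition. The
  draws are tilted by \<theta> = p / q, the density of \<nu> with respect to \<mu> on the cells;
  typical draws then imitate \<nu>, and the price per draw is the entropy on the partition, which is
  at most h.\<close>

theorem frequency_lower_bound:
  assumes U: "openin (weak_topology X) U" "\<nu> \<in> U" and \<nu>: "\<nu> \<in> entropy_ball h" and "\<delta> > 0"
  shows "\<forall>\<^sub>F n in F. exp (- real (m n) * (h + \<delta>)) \<le> frequency n U"
proof -
  interpret A: algebra "topspace X" cont_sets by (rule algebra_cont_sets)
  obtain \<F> e where \<F>: "finite \<F>" "\<F> \<subseteq> cont_sets" "e > 0"
    "\<And>\<nu>'. \<nu>' \<in> borel_probs X \<Longrightarrow> \<forall>A\<in>\<F>. \<bar>measure \<nu>' A - measure \<nu> A\<bar> < e \<Longrightarrow> \<nu>' \<in> U"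
    using weak_nhd_cont_sets[OF U] by blast
  have \<nu>b: "\<nu> \<in> borel_probs X" using \<nu> by (simp add: entropy_ball_def)
  interpret N: prob_space \<nu> using \<nu>b borel_probsD by blast
  define I where "I = Pow \<F>"
  define lab where "lab x = {A \<in> \<F>. x \<in> A}" for x
  define B where "B c = {x \<in> topspace X. lab x = c}" for c
  have I: "finite I" using \<F> by (simp add: I_def)
  have labI: "lab x \<in> I" for x by (auto simp: lab_def I_def)
  have Bc: "B c \<in> cont_sets" if "c \<in> I" for c
    unfolding B_def lab_def by (rule A.label_set_in_algebra) (use \<F> that in \<open>auto simp: I_def\<close>)
  define p where "p c = measure \<nu> (B c)" for c
  define q where "q c = measure \<mu> (B c)" for c
  define \<theta> where "\<theta> c = p c / q c" for c
  have entropy: "(\<Sum>c\<in>I. p c * ln (\<theta> c)) \<le> h"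
    unfolding p_def q_def \<theta>_def by (rule relative_entropy_partition[OF \<nu> I Bc labI B_def])
  have \<theta>0: "0 \<le> \<theta> c" for c by (simp add: \<theta>_def p_def q_def)
  have \<theta>q: "\<theta> c * q c = p c" if "c \<in> I" for c
    using measure_zero_if_entropy_bounded[OF entropy_ball_imp_bounded[OF \<nu>] Bc[OF that]]
    unfolding \<theta>_def p_def q_def by (auto simp: measure_le_0_iff)
  have decomp: "measure \<rho> A = (\<Sum>c\<in>{c \<in> I. A \<in> c}. measure \<rho> (B c))" if \<rho>: "\<rho> \<in> borel_probs X" and A: "A \<in> \<F>" for \<rho> A
  proof -
    interpret R: prob_space \<rho> using \<rho> borel_probsD by blast
    have "(\<Sum>c\<in>{c \<in> I. A \<in> c}. measure \<rho> (B c)) = measure \<rho> (\<Union>c\<in>{c \<in> I. A \<in> c}. B c)"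
    proof (rule measure_finite_Union[symmetric])
      show "finite {c \<in> I. A \<in> c}" using I by simp
      show "B ` {c \<in> I. A \<in> c} \<subseteq> sets \<rho>" using Bc cont_sets_events[OF \<rho>] by blast
      show "disjoint_family_on B {c \<in> I. A \<in> c}" unfolding disjoint_family_on_def B_def by blast
    qed simp
    also have "(\<Union>c\<in>{c \<in> I. A \<in> c}. B c) = A"
    proof (rule set_eqI)
      fix x
      have "x \<in> (\<Union>c\<in>{c \<in> I. A \<in> c}. B c) \<longleftrightarrow> x \<in> topspace X \<and> A \<in> lab x"
        using labI by (auto simp: B_def)
      moreover have "A \<in> lab x \<longleftrightarrow> x \<in> A" using A by (simp add: lab_def)
      moreover have "A \<subseteq> topspace X" using A A.sets_into_space \<F>(2) by blast
      ultimately show "x \<in> (\<Union>c\<in>{c \<in> I. A \<in> c}. B c) \<longleftrightarrow> x \<in> A" by blast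
    qed
    finally show ?thesis by simp
  qed
  have sump: "(\<Sum>c\<in>I. p c) = 1"
  proof -
    have "(\<Sum>c\<in>I. p c) = measure \<nu> (\<Union>c\<in>I. B c)" unfolding p_def
      by (rule measure_finite_Union[symmetric])
        (use I Bc cont_sets_events[OF \<nu>b] in \<open>auto simp: disjoint_family_on_def B_def\<close>)
    also have "(\<Union>c\<in>I. B c) = space \<nu>" using labI borel_probsD(3)[OF \<nu>b] by (auto simp: B_def)
    finally show ?thesis using N.prob_space by simp
  qed
  define \<Lambda> where "\<Lambda> = (\<Sum>c\<in>I. \<bar>ln (\<theta> c)\<bar>)"
  have \<Lambda>: "\<Lambda> \<ge> 0" unfolding \<Lambda>_def by (rule sum_nonneg) simp
  \<comment> \<open>Cell frequencies will be within 2r of p. The first bound makes these errors sum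
    to less than e over the cells of a set; the second makes the logarithmic cost 2 r \<Lambda> at
    most \<delta>/4.\<close>
  define r where "r = min (e / (4 * (real (card I) + 1))) (\<delta> / (8 * (\<Lambda> + 1)))"
  have r: "r > 0" using \<F>(3) \<open>\<delta> > 0\<close> \<Lambda> by (simp add: r_def)
  have r1: "real (card I) * (2 * r) < e"
  proof -
    have "r \<le> e / (4 * (real (card I) + 1))" by (simp add: r_def)
    then have "4 * (real (card I) + 1) * r \<le> e" by (simp add: pos_le_divide_eq mult.commute)
    then have "4 * (real (card I) * r) + 4 * r \<le> e" by (simp add: algebra_simps)
    moreover have "0 \<le> real (card I) * r" using r by simp
    ultimately show ?thesis using r by linarith
  qed
  have r2: "2 * r * \<Lambda> \<le> \<delta> / 4"
  proof -
    have "r \<le> \<delta> / (8 * (\<Lambda> + 1))" by (simp add: r_def)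
    then have "8 * (\<Lambda> + 1) * r \<le> \<delta>" using \<Lambda> by (simp add: pos_le_divide_eq mult.commute)
    then show ?thesis using r by (simp add: algebra_simps)
  qed
  \<comment> \<open>The normalizing constant of the tilted law on the finite population. Since the
    \<theta> c q c add up to 1, it is asymptotically n.\<close>
  define Z where "Z n = (\<Sum>i\<in>{1..n}. \<theta> (lab (y n i)))" for n
  have \<theta>lab: "\<theta> (lab x) = (\<Sum>c\<in>I. \<theta> c * indicator (B c) x)" if "x \<in> topspace X" for x
    unfolding B_def by (rule sum_indicator_label[symmetric]) (use I labI that in auto)
  have Zavg: "Z n / real n = (\<Sum>c\<in>I. \<theta> c * avg n (indicator (B c)))" for n
  proof -
    have "Z n = (\<Sum>i\<in>{1..n}. \<Sum>c\<in>I. \<theta> c * indicator (B c) (y n i))"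
      unfolding Z_def by (rule sum.cong) (use \<theta>lab y in auto)
    also have "\<dots> = (\<Sum>c\<in>I. \<Sum>i\<in>{1..n}. \<theta> c * indicator (B c) (y n i))" by (rule sum.swap)
    finally show ?thesis
      by (simp only: avg_def sum_divide_distrib sum_distrib_left times_divide_eq_right)
  qed
  have lim: "((\<lambda>n. avg n (indicator (B c))) \<longlongrightarrow> q c) F" if "c \<in> I" for c
    unfolding q_def by (rule avg_cont_sets[OF Bc[OF that]])
  have Zlim: "((\<lambda>n. Z n / real n) \<longlongrightarrow> 1) F"
  proof -
    have "((\<lambda>n. \<Sum>c\<in>I. \<theta> c * avg n (indicator (B c))) \<longlongrightarrow> (\<Sum>c\<in>I. \<theta> c * q c)) F"
      by (intro tendsto_intros lim)
    moreover have "(\<Sum>c\<in>I. \<theta> c * q c) = 1" using \<theta>q sump by simp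
    ultimately show ?thesis by (simp add: Zavg)
  qed
  \<comment> \<open>The tilted probability of cell c for the population of size n. Chebyshev's
    inequality centres the frequencies here and not at the limit p c.\<close>
  define P where "P n c = (\<Sum>i\<in>{1..n}. \<theta> (lab (y n i)) * indicator {i. lab (y n i) = c} i) / Z n" for n c
  have Plim: "((\<lambda>n. P n c) \<longlongrightarrow> p c) F" if c: "c \<in> I" for c
  proof -
    have "((\<lambda>n. \<theta> c * avg n (indicator (B c)) / (Z n / real n)) \<longlongrightarrow> \<theta> c * q c / 1) F"
      by (intro tendsto_intros lim[OF c] Zlim) simp
    moreover have "\<forall>\<^sub>F n in F. \<theta> c * avg n (indicator (B c)) / (Z n / real n) = P n c"
      using n_pos
    proof eventually_elim
      case (elim n)
      have "(\<Sum>i\<in>{1..n}. \<theta> (lab (y n i)) * indicator {i. lab (y n i) = c} i)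
          = (\<Sum>i\<in>{1..n}. \<theta> c * indicator (B c) (y n i))"
        by (rule sum.cong) (use y in \<open>auto simp: B_def indicator_def\<close>)
      then have "P n c = \<theta> c * (\<Sum>i\<in>{1..n}. indicator (B c) (y n i)) / Z n"
        by (simp only: P_def sum_distrib_left)
      moreover have "\<theta> c * (S / real n) / (Z n / real n) = \<theta> c * S / Z n" for S
        using elim by simp
      ultimately show ?case by (simp only: avg_def)
    qed
    ultimately show ?thesis using \<theta>q[OF c] by (simp add: tendsto_cong)
  qed
  have "\<forall>\<^sub>F n in F. \<forall>c\<in>I. \<bar>P n c - p c\<bar> < r"
  proof (rule eventually_ball_finite[OF I], rule ballI)
    fix c assume "c \<in> I"
    show "\<forall>\<^sub>F n in F. \<bar>P n c - p c\<bar> < r"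
      using tendstoD[OF Plim[OF \<open>c \<in> I\<close>] r] by (simp add: dist_real_def)
  qed
  moreover have "\<forall>\<^sub>F n in F. exp (- \<delta> / 4) < Z n / real n"
    using order_tendstoD(1)[OF Zlim, of "exp (- \<delta> / 4)"] \<open>\<delta> > 0\<close> by simp
  moreover have "\<forall>\<^sub>F n in F. 2 * real (card I) / r\<^sup>2 < real (m n)" by (rule m_eventually_gt)
  moreover have "\<forall>\<^sub>F n in F. ln 2 / (\<delta> / 4) < real (m n)" by (rule m_eventually_gt)
  ultimately show ?thesis
    using n_pos m_eventually_pos
  proof eventually_elim
    case (elim n)
    have "0 < Z n / real n" using elim(2) exp_gt_zero[of "- \<delta> / 4"] by linarith
    then have Zpos: "Z n > 0" using elim(5) by (simp add: zero_less_divide_iff)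
    define G where "G = {b \<in> PiE {..<m n} (\<lambda>_. {1..n}). \<forall>c\<in>I.
      \<bar>real (card {l \<in> {..<m n}. b l \<in> {i. lab (y n i) = c}}) / real (m n) - P n c\<bar> < r}"
    have freq: "measure (empirical n b) (B c) = real (card {l \<in> {..<m n}. lab (y n (b l)) = c}) / real (m n)"
      if b: "b \<in> draws n" and c: "c \<in> I" for b c
    proof -
      have "{l \<in> {..<m n}. y n (b l) \<in> B c} = {l \<in> {..<m n}. lab (y n (b l)) = c}"
        using PiE_mem[OF b[unfolded draws_def]] y by (auto simp: B_def)
      then show ?thesis unfolding empirical_def
        using cont_sets_borel[OF Bc[OF c]] elim(6) by (simp add: measure_empirical_measure)
    qed
    have close: "\<bar>measure (empirical n b) (B c) - p c\<bar> < 2 * r" if b: "b \<in> G" and c: "c \<in> I" for b c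
    proof -
      have "b \<in> draws n" using b by (simp add: G_def draws_def)
      then have "\<bar>measure (empirical n b) (B c) - P n c\<bar> < r"
        using b c freq by (simp add: G_def)
      moreover have "\<bar>P n c - p c\<bar> < r" using elim(1) c by blast
      ultimately show ?thesis by linarith
    qed
    have "(Z n) ^ m n * (1 - real (card I) / (real (m n) * r\<^sup>2)) * exp (- real (m n) * (h + \<delta> / 4)) \<le> real (card G)"
    proof (rule card_tilted_lower_bound[where S="{1..n}" and I=I and \<theta>="\<lambda>i. \<theta> (lab (y n i))"
          and T="\<lambda>c. {i. lab (y n i) = c}" and p="P n" and e=r])
      fix b assume b: "b \<in> G" and pos: "\<forall>l<m n. 0 < \<theta> (lab (y n (b l)))"
      have bd: "b \<in> draws n" using b by (simp add: G_def draws_def)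
      have "(\<Prod>l<m n. \<theta> (lab (y n (b l)))) = exp (\<Sum>l<m n. ln (\<theta> (lab (y n (b l)))))"
        using pos by (simp add: exp_sum)
      \<comment> \<open>Grouping the draws by cell expresses the log-likelihood ratio through the
        empirical cell frequencies, which are close to p.\<close>
      also have "(\<Sum>l<m n. ln (\<theta> (lab (y n (b l))))) = (\<Sum>c\<in>I. real (card {l \<in> {..<m n}. lab (y n (b l)) = c}) * ln (\<theta> c))"
      proof -
        have "(\<Sum>l<m n. ln (\<theta> (lab (y n (b l))))) = (\<Sum>c\<in>I. \<Sum>l\<in>{l \<in> {..<m n}. lab (y n (b l)) = c}. ln (\<theta> (lab (y n (b l)))))"
          by (rule sum.group[symmetric]) (use I labI in auto)
        then show ?thesis by simp
      qed
      also have "\<dots> = (\<Sum>c\<in>I. real (m n) * (measure (empirical n b) (B c) * ln (\<theta> c)))"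
        by (rule sum.cong) (use freq[OF bd] elim(6) in auto)
      also have "\<dots> = real (m n) * (\<Sum>c\<in>I. measure (empirical n b) (B c) * ln (\<theta> c))"
        by (rule sum_distrib_left[symmetric])
      also have "\<dots> \<le> real (m n) * (h + \<delta> / 4)"
      proof (rule mult_left_mono)
        have "(\<Sum>c\<in>I. measure (empirical n b) (B c) * ln (\<theta> c)) \<le> (\<Sum>c\<in>I. p c * ln (\<theta> c) + 2 * r * \<bar>ln (\<theta> c)\<bar>)"
        proof (rule sum_mono)
          fix c assume c: "c \<in> I"
          have "(measure (empirical n b) (B c) - p c) * ln (\<theta> c) \<le> \<bar>measure (empirical n b) (B c) - p c\<bar> * \<bar>ln (\<theta> c)\<bar>"
            by (metis abs_ge_self abs_mult)
          also have "\<dots> \<le> 2 * r * \<bar>ln (\<theta> c)\<bar>" using close[OF b c] by (intro mult_right_mono) auto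
          finally show "measure (empirical n b) (B c) * ln (\<theta> c) \<le> p c * ln (\<theta> c) + 2 * r * \<bar>ln (\<theta> c)\<bar>"
            by (simp add: left_diff_distrib)
        qed
        also have "\<dots> = (\<Sum>c\<in>I. p c * ln (\<theta> c)) + 2 * r * \<Lambda>"
          by (simp only: sum.distrib \<Lambda>_def sum_distrib_left)
        also have "\<dots> \<le> h + \<delta> / 4" using entropy r2 by linarith
        finally show "(\<Sum>c\<in>I. measure (empirical n b) (B c) * ln (\<theta> c)) \<le> h + \<delta> / 4" .
      qed simp
      finally show "(\<Prod>l<m n. \<theta> (lab (y n (b l)))) \<le> exp (real (m n) * (h + \<delta> / 4))" by simp
    qed (use I \<theta>0 Zpos elim(6) r in \<open>auto simp: Z_def P_def G_def\<close>)
    also have "card G \<le> card {b \<in> draws n. empirical n b \<in> U}"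
    proof (rule card_mono)
      show "finite {b \<in> draws n. empirical n b \<in> U}" using finite_draws by simp
      show "G \<subseteq> {b \<in> draws n. empirical n b \<in> U}"
      proof
        fix b assume b: "b \<in> G"
        then have bd: "b \<in> draws n" by (simp add: G_def draws_def)
        have eb: "empirical n b \<in> borel_probs X" by (rule empirical_borel_probs[OF elim(6) bd])
        have "\<bar>measure (empirical n b) A - measure \<nu> A\<bar> < e" if A: "A \<in> \<F>" for A
        proof -
          have "\<bar>measure (empirical n b) A - measure \<nu> A\<bar>
              = \<bar>\<Sum>c\<in>{c \<in> I. A \<in> c}. measure (empirical n b) (B c) - p c\<bar>"
            using decomp[OF eb A] decomp[OF \<nu>b A] by (simp add: p_def sum_subtractf)
          also have "\<dots> \<le> (\<Sum>c\<in>{c \<in> I. A \<in> c}. 2 * r)"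
            by (intro order_trans[OF sum_abs] sum_mono) (use close[OF b] in \<open>auto intro: less_imp_le\<close>)
          also have "\<dots> \<le> (\<Sum>c\<in>I. 2 * r)" by (rule sum_mono2) (use I r in auto)
          also have "\<dots> < e" using r1 by simp
          finally show ?thesis .
        qed
        then show "b \<in> {b \<in> draws n. empirical n b \<in> U}" using \<F>(4)[OF eb] bd by simp
      qed
    qed
    finally have "(Z n) ^ m n * (1 - real (card I) / (real (m n) * r\<^sup>2)) * exp (- real (m n) * (h + \<delta> / 4))
      \<le> real (card {b \<in> draws n. empirical n b \<in> U})" by simp
    then have "(Z n) ^ m n * (1 - real (card I) / (real (m n) * r\<^sup>2)) * exp (- real (m n) * (h + \<delta> / 4)) / real n ^ m n
      \<le> frequency n U" unfolding frequency_def by (rule divide_right_mono) simp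
    then have fr: "(Z n / real n) ^ m n * (1 - real (card I) / (real (m n) * r\<^sup>2)) * exp (- real (m n) * (h + \<delta> / 4)) \<le> frequency n U"
      by (simp add: power_divide)
    have half: "1 / 2 \<le> 1 - real (card I) / (real (m n) * r\<^sup>2)"
    proof -
      have "2 * real (card I) \<le> real (m n) * r\<^sup>2"
        using elim(3) r by (simp add: pos_divide_less_eq)
      then show ?thesis using elim(6) r by (simp add: field_simps)
    qed
    have two: "exp (- (real (m n) * (\<delta> / 4))) \<le> 1 / 2"
    proof -
      have "ln 2 \<le> real (m n) * (\<delta> / 4)" using elim(4) \<open>\<delta> > 0\<close> by (simp add: field_simps)
      then have "exp (ln 2) \<le> exp (real (m n) * (\<delta> / 4))" by (simp only: exp_le_cancel_iff)
      then show ?thesis by (simp add: exp_minus field_simps)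
    qed
    have zp: "exp (- (real (m n) * (\<delta> / 4))) \<le> (Z n / real n) ^ m n"
    proof -
      have "exp (- (real (m n) * (\<delta> / 4))) = exp (- \<delta> / 4) ^ m n" by (simp flip: exp_of_nat_mult)
      also have "\<dots> \<le> (Z n / real n) ^ m n" using elim(2) by (intro power_mono) auto
      finally show ?thesis .
    qed
    \<comment> \<open>The budget \<delta> covers three losses of \<delta>/4: the normalizing
      constant, the probability at least 1/2 from Chebyshev's inequality, and the deviation of the
      log-likelihood from h.\<close>
    have "exp (- real (m n) * (h + \<delta>)) \<le> exp (- (real (m n) * (\<delta> / 4))) * exp (- (real (m n) * (\<delta> / 4))) * exp (- real (m n) * (h + \<delta> / 4))"
    proof -
      have "real (m n) * (h + \<delta> / 4) + real (m n) * (\<delta> / 4) + real (m n) * (\<delta> / 4) \<le> real (m n) * (h + \<delta>)"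
        using \<open>\<delta> > 0\<close> unfolding distrib_left[symmetric] by (intro mult_left_mono) auto
      then show ?thesis by (simp flip: exp_add)
    qed
    also have "\<dots> \<le> (Z n / real n) ^ m n * (1 - real (card I) / (real (m n) * r\<^sup>2)) * exp (- real (m n) * (h + \<delta> / 4))"
    proof (intro mult_right_mono mult_mono zp)
      show "exp (- (real (m n) * (\<delta> / 4))) \<le> 1 - real (card I) / (real (m n) * r\<^sup>2)"
        using two half by linarith
      show "0 \<le> (Z n / real n) ^ m n" using Zpos by simp
    qed auto
    finally show ?case using fr by linarith
  qed
qed

end

section \<open>Mean marginals\<close>

lemma nn_integral_lin_comb:
  assumes "finite I" and \<mu>: "\<And>i. i \<in> I \<Longrightarrow> sets (\<mu> i) = sets (borel_of X)"
    and f: "f \<in> borel_measurable (borel_of X)"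
  shows "(\<integral>\<^sup>+x. f x \<partial>lin_comb X I w \<mu>) = (\<Sum>i\<in>I. ennreal (w i) * (\<integral>\<^sup>+x. f x \<partial>\<mu> i))"
  using f
proof (induction rule: borel_measurable_induct)
  case (cong f g)
  have "(\<integral>\<^sup>+x. f x \<partial>\<mu> i) = (\<integral>\<^sup>+x. g x \<partial>\<mu> i)" if "i \<in> I" for i
    by (rule nn_integral_cong) (use cong(3) sets_eq_imp_space_eq[OF \<mu>[OF that]] in auto)
  moreover have "(\<integral>\<^sup>+x. f x \<partial>lin_comb X I w \<mu>) = (\<integral>\<^sup>+x. g x \<partial>lin_comb X I w \<mu>)"
    by (rule nn_integral_cong) (use cong(3) in auto)
  ultimately show ?case using cong(4) by simp
next
  case (set A)
  then show ?case using \<mu> by (simp add: emeasure_lin_comb)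
next
  case (mult u c)
  have m: "u \<in> borel_measurable (\<mu> i)" if "i \<in> I" for i
    using mult(2) measurable_cong_sets[OF \<mu>[OF that] refl] by blast
  have ml: "u \<in> borel_measurable (lin_comb X I w \<mu>)"
    using mult(2) measurable_cong_sets[OF sets_lin_comb refl] by blast
  show ?case using mult m ml by (simp add: nn_integral_cmult sum_distrib_left mult_ac)
next
  case (add u v)
  have m: "u \<in> borel_measurable (\<mu> i)" "v \<in> borel_measurable (\<mu> i)" if "i \<in> I" for i
    using add(1,3) measurable_cong_sets[OF \<mu>[OF that] refl] by blast+
  have ml: "u \<in> borel_measurable (lin_comb X I w \<mu>)" "v \<in> borel_measurable (lin_comb X I w \<mu>)"
    using add(1,3) measurable_cong_sets[OF sets_lin_comb refl] by blast+
  show ?case using add m ml by (simp add: nn_integral_add sum.distrib distrib_left)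
next
  case (seq U)
  have m: "U n \<in> borel_measurable (\<mu> i)" if "i \<in> I" for i n
    using seq(1) measurable_cong_sets[OF \<mu>[OF that] refl] by blast
  have ml: "U n \<in> borel_measurable (lin_comb X I w \<mu>)" for n
    using seq(1) measurable_cong_sets[OF sets_lin_comb refl] by blast
  have "(\<integral>\<^sup>+x. (SUP n. U n) x \<partial>lin_comb X I w \<mu>) = (SUP n. \<integral>\<^sup>+x. U n x \<partial>lin_comb X I w \<mu>)"
    unfolding SUP_apply by (rule nn_integral_monotone_convergence_SUP) (use seq ml in auto)
  also have "\<dots> = (SUP n. \<Sum>i\<in>I. ennreal (w i) * (\<integral>\<^sup>+x. U n x \<partial>\<mu> i))" using seq by simp
  also have "\<dots> = (\<Sum>i\<in>I. SUP n. ennreal (w i) * (\<integral>\<^sup>+x. U n x \<partial>\<mu> i))"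
    by (rule ennreal_SUP_sum)
      (use seq in \<open>auto simp: incseq_def le_fun_def intro!: mult_left_mono nn_integral_mono\<close>)
  also have "\<dots> = (\<Sum>i\<in>I. ennreal (w i) * (\<integral>\<^sup>+x. (SUP n. U n) x \<partial>\<mu> i))"
  proof (rule sum.cong[OF refl])
    fix i assume i: "i \<in> I"
    have "(SUP n. ennreal (w i) * (\<integral>\<^sup>+x. U n x \<partial>\<mu> i)) = ennreal (w i) * (SUP n. \<integral>\<^sup>+x. U n x \<partial>\<mu> i)"
      by (rule SUP_mult_left_ennreal[symmetric])
    also have "(SUP n. \<integral>\<^sup>+x. U n x \<partial>\<mu> i) = (\<integral>\<^sup>+x. (SUP n. U n) x \<partial>\<mu> i)"
      unfolding SUP_apply
      by (rule nn_integral_monotone_convergence_SUP[symmetric]) (use seq m[OF i] in auto)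
    finally show "(SUP n. ennreal (w i) * (\<integral>\<^sup>+x. U n x \<partial>\<mu> i)) = ennreal (w i) * (\<integral>\<^sup>+x. (SUP n. U n) x \<partial>\<mu> i)" .
  qed
  finally show ?case .
qed

text \<open>The maximum with 0 appears because \<open>lin_comb\<close> passes weights through
  \<open>ennreal\<close>. Arbitrary real weight vectors have to be allowed, since the bootstrap map
  is studied on the whole space of such vectors.\<close>

lemma integral_lin_comb:
  fixes f :: "'b \<Rightarrow> real"
  assumes "finite I" and \<mu>: "\<And>i. i \<in> I \<Longrightarrow> \<mu> i \<in> borel_probs X" and f: "bounded_continuous X f"
  shows "(\<integral>x. f x \<partial>lin_comb X I w \<mu>) = (\<Sum>i\<in>I. max 0 (w i) * (\<integral>x. f x \<partial>\<mu> i))"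
proof -
  have s: "\<And>i. i \<in> I \<Longrightarrow> sets (\<mu> i) = sets (borel_of X)" using \<mu> borel_probsD(2) by blast
  have fm: "f \<in> borel_measurable (borel_of X)"
    by (rule continuous_map_borel_measurable[OF bounded_continuous_map[OF f] refl])
  have int: "integrable (\<mu> i) f" if "i \<in> I" for i by (rule bounded_continuous_integrable[OF f \<mu>[OF that]])
  have fin: "(\<integral>\<^sup>+x. ennreal (f x) \<partial>\<mu> i) < \<infinity>" "(\<integral>\<^sup>+x. ennreal (- f x) \<partial>\<mu> i) < \<infinity>" if "i \<in> I" for i
    using int[OF that] by (auto simp: real_integrable_def less_top)
  have e: "enn2real (\<Sum>i\<in>I. ennreal (w i) * g i) = (\<Sum>i\<in>I. max 0 (w i) * enn2real (g i))"
    if "\<And>i. i \<in> I \<Longrightarrow> g i < \<infinity>" for g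
  proof -
    have "enn2real (\<Sum>i\<in>I. ennreal (w i) * g i) = (\<Sum>i\<in>I. enn2real (ennreal (w i) * g i))"
      using that by (subst enn2real_sum) (auto simp: ennreal_mult_less_top)
    also have "\<dots> = (\<Sum>i\<in>I. max 0 (w i) * enn2real (g i))"
      by (rule sum.cong) (auto simp: enn2real_mult max_def ennreal_neg)
    finally show ?thesis .
  qed
  have nn: "(\<integral>\<^sup>+x. ennreal (f x) \<partial>lin_comb X I w \<mu>) = (\<Sum>i\<in>I. ennreal (w i) * (\<integral>\<^sup>+x. ennreal (f x) \<partial>\<mu> i))"
    "(\<integral>\<^sup>+x. ennreal (- f x) \<partial>lin_comb X I w \<mu>) = (\<Sum>i\<in>I. ennreal (w i) * (\<integral>\<^sup>+x. ennreal (- f x) \<partial>\<mu> i))"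
    using fm by (auto intro!: nn_integral_lin_comb assms(1) s)
  have "f \<in> borel_measurable (lin_comb X I w \<mu>)"
    using fm measurable_cong_sets[OF sets_lin_comb refl] by blast
  then have "integrable (lin_comb X I w \<mu>) f"
    unfolding real_integrable_def nn using fin[THEN less_imp_neq] assms(1)
    by (auto simp: ennreal_mult_eq_top_iff)
  then have "(\<integral>x. f x \<partial>lin_comb X I w \<mu>) = enn2real (\<Sum>i\<in>I. ennreal (w i) * (\<integral>\<^sup>+x. ennreal (f x) \<partial>\<mu> i))
      - enn2real (\<Sum>i\<in>I. ennreal (w i) * (\<integral>\<^sup>+x. ennreal (- f x) \<partial>\<mu> i))"
    by (simp add: real_lebesgue_integral_def nn)
  also have "\<dots> = (\<Sum>i\<in>I. max 0 (w i) * (enn2real (\<integral>\<^sup>+x. ennreal (f x) \<partial>\<mu> i) - enn2real (\<integral>\<^sup>+x. ennreal (- f x) \<partial>\<mu> i)))"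
    using fin by (simp add: e right_diff_distrib sum_subtractf)
  also have "\<dots> = (\<Sum>i\<in>I. max 0 (w i) * (\<integral>x. f x \<partial>\<mu> i))"
    by (rule sum.cong) (use int in \<open>auto simp: real_lebesgue_integral_def\<close>)
  finally show ?thesis .
qed

text \<open>The equivalence identifies the weight vectors for which the bootstrapped object is a
  probability measure; they form a closed set.\<close>

lemma lin_comb_borel_probs_iff:
  assumes "finite I" and \<mu>: "\<And>i. i \<in> I \<Longrightarrow> \<mu> i \<in> borel_probs X"
  shows "lin_comb X I w \<mu> \<in> borel_probs X \<longleftrightarrow> (\<Sum>i\<in>I. max 0 (w i)) = 1"
proof -
  have "emeasure (lin_comb X I w \<mu>) (topspace X) = (\<Sum>i\<in>I. ennreal (w i) * emeasure (\<mu> i) (topspace X))"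
    by (rule emeasure_lin_comb) (use borel_probsD(2)[OF \<mu>] sets.top[of "borel_of X"] in simp_all)
  also have "\<dots> = (\<Sum>i\<in>I. ennreal (max 0 (w i)))"
  proof (rule sum.cong[OF refl])
    fix i assume "i \<in> I"
    then have "emeasure (\<mu> i) (topspace X) = 1"
      using prob_space.emeasure_space_1[OF borel_probsD(1)[OF \<mu>]] borel_probsD(3)[OF \<mu>] by metis
    then show "ennreal (w i) * emeasure (\<mu> i) (topspace X) = ennreal (max 0 (w i))"
      by (simp add: max_def ennreal_neg)
  qed
  also have "\<dots> = ennreal (\<Sum>i\<in>I. max 0 (w i))" by (rule sum_ennreal) simp
  finally have e: "emeasure (lin_comb X I w \<mu>) (topspace X) = ennreal (\<Sum>i\<in>I. max 0 (w i))" .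
  have "prob_space (lin_comb X I w \<mu>) \<longleftrightarrow> emeasure (lin_comb X I w \<mu>) (topspace X) = 1"
    using prob_space.emeasure_space_1[of "lin_comb X I w \<mu>"] prob_spaceI[of "lin_comb X I w \<mu>"] by auto
  also have "\<dots> \<longleftrightarrow> (\<Sum>i\<in>I. max 0 (w i)) = 1"
    unfolding e using ennreal_eq_1[of "\<Sum>i\<in>I. max 0 (w i)"] by simp
  finally show ?thesis by (simp add: borel_probs_def)
qed

lemma dirac_borel_probs: "z \<in> topspace X \<Longrightarrow> dirac X z \<in> borel_probs X"
  by (auto simp: borel_probs_def intro!: prob_space_return)

lemma integral_dirac:
  assumes "bounded_continuous X f" "z \<in> topspace X"
  shows "(\<integral>x. f x \<partial>dirac X z) = f z"
  using assms by (intro integral_return)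
    (auto intro!: continuous_map_borel_measurable bounded_continuous_map)

text \<open>The distance to the complement, truncated at 1, is positive exactly on the open
  set.\<close>

lemma perfect_topology_euclidean: "perfect_topology (euclidean :: 'a::metric_space topology)"
proof
  fix U :: "'a set" assume "openin euclidean U"
  then have U: "open U" by simp
  show "\<exists>f. bounded_continuous euclidean f \<and> (\<forall>x\<in>topspace euclidean. 0 \<le> f x)
    \<and> U = {x \<in> topspace euclidean. 0 < f x}"
  proof (cases "U = UNIV")
    \<comment> \<open>The distance to an empty complement would be 0 by convention, hence the
      separate case.\<close>
    case True
    then show ?thesis by (intro exI[of _ "\<lambda>_. 1"]) (auto intro: bounded_continuous_const)
  next
    case False
    define f where "f x = min 1 (infdist x (- U))" for x
    have "bounded_continuous euclidean f"
    proof (rule bounded_continuousI)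
      show "continuous_map euclidean euclideanreal f"
        by (simp add: f_def continuous_intros)
      show "\<bar>f x\<bar> \<le> 1" for x by (simp add: f_def infdist_nonneg abs_le_iff)
    qed
    moreover have "0 < f x \<longleftrightarrow> x \<in> U" for x
    proof -
      have "x \<in> - U \<longleftrightarrow> infdist x (- U) = 0"
        by (rule in_closed_iff_infdist_zero) (use U False in \<open>auto simp: closed_Compl\<close>)
      moreover have "0 < f x \<longleftrightarrow> infdist x (- U) \<noteq> 0"
        using infdist_nonneg[of x "- U"] by (auto simp: f_def less_le min_def)
      ultimately show ?thesis by blast
    qed
    moreover have "0 \<le> f x" for x by (simp add: f_def infdist_nonneg)
    ultimately show ?thesis by (intro exI[of _ f]) auto
  qed
qed

lemma continuous_map_power_topology_component:
  "i < k \<Longrightarrow> continuous_map (power_topology k X) X (\<lambda>z. z i)"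
  unfolding power_topology_def by (rule continuous_map_product_projection) simp

lemma topspace_power_topology: "topspace (power_topology k X) = PiE {..<k} (\<lambda>_. topspace X)"
  by (simp add: power_topology_def)

text \<open>The property is transported from the metric space of all sequences: the open set is
  pulled back along restriction, and the resulting function is restricted to the tuples.\<close>

lemma perfect_topology_power:
  "perfect_topology (power_topology k (euclidean :: 'a::polish_space topology))"
proof
  let ?P = "power_topology k (euclidean :: 'a topology)"
  interpret S: perfect_topology "euclidean :: (nat \<Rightarrow> 'a) topology" by (rule perfect_topology_euclidean)
  fix U assume U: "openin ?P U"
  define V where "V = {z. restrict z {..<k} \<in> U}"
  have "continuous_map euclidean ?P (\<lambda>z. restrict z {..<k})"
    unfolding power_topology_def euclidean_product_topology[symmetric]
    by (rule continuous_on_restrict) simp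
  then have "openin euclidean V"
    using openin_continuous_map_preimage[OF _ U] unfolding V_def by force
  then obtain f where f: "bounded_continuous euclidean f" "\<forall>x\<in>topspace euclidean. 0 \<le> f x"
    "V = {x \<in> topspace euclidean. 0 < f x}" using S.cozero by blast
  \<comment> \<open>Tuples are extensional, so coordinates from k onwards are constantly
    \<open>undefined\<close> and the inclusion into all sequences is continuous.\<close>
  have id: "continuous_map ?P euclidean (\<lambda>z. z)"
  proof -
    have "continuous_map ?P (product_topology (\<lambda>_::nat. euclidean :: 'a topology) UNIV) (\<lambda>z. z)"
      unfolding continuous_map_componentwise_UNIV
    proof
      fix i
      show "continuous_map ?P euclidean (\<lambda>z. z i)"
      proof (cases "i < k")
        case True
        then show ?thesis by (rule continuous_map_power_topology_component)
      next
        case False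
        have "continuous_map ?P (euclidean :: 'a topology) (\<lambda>z. undefined)" by simp
        then show ?thesis
        proof (rule continuous_map_eq)
          fix z assume "z \<in> topspace ?P"
          then show "undefined = z i"
            using False PiE_arb[of z "{..<k}"] by (simp add: topspace_power_topology)
        qed
      qed
    qed
    then show ?thesis by (simp only: euclidean_product_topology)
  qed
  have "continuous_map ?P euclideanreal f"
    using continuous_map_compose[OF id bounded_continuous_map[OF f(1)]] by (simp add: o_def)
  then have "bounded_continuous ?P f"
    using f(1) unfolding bounded_continuous_def by (metis bounded_subset image_mono subset_UNIV topspace_euclidean)
  moreover have "U = {z \<in> topspace ?P. 0 < f z}"
  proof -
    have "restrict z {..<k} = z" if "z \<in> topspace ?P" for z
      using that unfolding topspace_power_topology by (rule PiE_restrict)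
    then have "z \<in> U \<longleftrightarrow> z \<in> V" if "z \<in> topspace ?P" for z
      using that by (simp add: V_def)
    then have "U = {z \<in> topspace ?P. z \<in> V}"
      using openin_subset[OF U] by blast
    then show ?thesis using f(3) by auto
  qed
  ultimately show "\<exists>f. bounded_continuous ?P f \<and> (\<forall>x\<in>topspace ?P. 0 \<le> f x) \<and> U = {x \<in> topspace ?P. 0 < f x}"
    using f(2) by (intro exI[of _ f]) auto
qed

text \<open>The contraction map; its fibre over a measure is the constraint set in
  \<open>bootstrap_rate\<close>.\<close>

definition mean_marginal :: "'a topology \<Rightarrow> nat \<Rightarrow> (nat \<Rightarrow> 'a) measure \<Rightarrow> 'a measure" where
  "mean_marginal X k \<nu> = lin_comb X {..<k} (\<lambda>_. 1 / real k) (\<lambda>i. marginal X i \<nu>)"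

lemma continuous_map_measurable_borel_of:
  assumes "continuous_map X Y h" and "sets M = sets (borel_of X)"
  shows "h \<in> measurable M (borel_of Y)"
proof -
  have spc: "space M = topspace X" using sets_eq_imp_space_eq[OF assms(2)] by simp
  have "h \<in> measurable M (sigma (topspace Y) {U. openin Y U})"
  proof (rule measurable_sigma_sets)
    show "sets (sigma (topspace Y) {U. openin Y U}) = sigma_sets (topspace Y) {U. openin Y U}"
      by (rule sets_measure_of) (auto dest: openin_subset)
    show "h \<in> space M \<rightarrow> topspace Y" using continuous_map_funspace[OF assms(1)] spc by simp
    fix U assume "U \<in> {U. openin Y U}"
    then have "openin X {x \<in> topspace X. h x \<in> U}" using openin_continuous_map_preimage[OF assms(1)] by simp
    moreover have "h -` U \<inter> space M = {x \<in> topspace X. h x \<in> U}" using spc by auto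
    ultimately show "h -` U \<inter> space M \<in> sets M" using openin_sets_borel_of assms(2) by metis
  qed (auto dest: openin_subset)
  then show ?thesis by (simp add: borel_of_def)
qed

lemma marginal_borel_probs:
  assumes "\<nu> \<in> borel_probs (power_topology k X)" "i < k"
  shows "marginal X i \<nu> \<in> borel_probs X"
proof -
  have "(\<lambda>z. z i) \<in> measurable \<nu> (borel_of X)"
    by (rule continuous_map_measurable_borel_of[OF continuous_map_power_topology_component borel_probsD(2)])
      (use assms in auto)
  then show ?thesis unfolding marginal_def borel_probs_def
    using prob_space.prob_space_distr[OF borel_probsD(1)[OF assms(1)]] by simp
qed

lemma bounded_continuous_component:
  assumes "bounded_continuous X f" "i < k"
  shows "bounded_continuous (power_topology k X) (\<lambda>z. f (z i))"
proof -
  obtain B where B: "B > 0" "\<And>x. x \<in> topspace X \<Longrightarrow> \<bar>f x\<bar> \<le> B"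
    by (rule bounded_continuousE[OF assms(1)]) (rule that)
  show ?thesis
  proof (rule bounded_continuousI)
    show "continuous_map (power_topology k X) euclideanreal (\<lambda>z. f (z i))"
      using continuous_map_compose[OF continuous_map_power_topology_component[OF assms(2)]
        bounded_continuous_map[OF assms(1)]] by (simp add: o_def)
    show "\<bar>f (z i)\<bar> \<le> B" if "z \<in> topspace (power_topology k X)" for z
      using that assms(2) by (intro B(2)) (auto simp: topspace_power_topology)
  qed
qed

lemma integral_marginal:
  fixes f :: "'a \<Rightarrow> real"
  assumes "\<nu> \<in> borel_probs (power_topology k X)" "i < k" "bounded_continuous X f"
  shows "(\<integral>x. f x \<partial>marginal X i \<nu>) = (\<integral>z. f (z i) \<partial>\<nu>)"
  unfolding marginal_def
proof (rule integral_distr)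
  show "(\<lambda>z. z i) \<in> measurable \<nu> (borel_of X)"
    by (rule continuous_map_measurable_borel_of[OF continuous_map_power_topology_component borel_probsD(2)])
      (use assms in auto)
  show "f \<in> borel_measurable (borel_of X)"
    by (rule continuous_map_borel_measurable[OF bounded_continuous_map[OF assms(3)] refl])
qed

lemma mean_marginal_borel_probs:
  assumes "\<nu> \<in> borel_probs (power_topology k X)" "k \<ge> 1"
  shows "mean_marginal X k \<nu> \<in> borel_probs X"
  unfolding mean_marginal_def
  by (subst lin_comb_borel_probs_iff) (use assms marginal_borel_probs in auto)

text \<open>The integral of f against the image is the average over i of the integrals of f(z i),
  each of which is a bounded continuous function of the tuple.\<close>

lemma continuous_map_mean_marginal:
  assumes "k \<ge> 1"
  shows "continuous_map (weak_topology (power_topology k X)) (weak_topology X) (mean_marginal X k)"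
proof (rule continuous_map_into_weak_topology)
  show "mean_marginal X k \<nu> \<in> borel_probs X" if "\<nu> \<in> topspace (weak_topology (power_topology k X))" for \<nu>
    using that assms by (intro mean_marginal_borel_probs) (auto simp: topspace_weak_topology)
  fix f assume f: "bounded_continuous X f"
  have "continuous_map (weak_topology (power_topology k X)) euclideanreal
      (\<lambda>\<nu>. \<Sum>i<k. (1 / real k) * (\<integral>z. f (z i) \<partial>\<nu>))"
    by (intro continuous_map_sum continuous_map_real_mult_left continuous_map_weak_topology_integral
        bounded_continuous_component f) auto
  then show "continuous_map (weak_topology (power_topology k X)) euclideanreal (\<lambda>\<nu>. \<integral>x. f x \<partial>mean_marginal X k \<nu>)"
  proof (rule continuous_map_eq)
    fix \<nu> assume "\<nu> \<in> topspace (weak_topology (power_topology k X))"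
    then have \<nu>: "\<nu> \<in> borel_probs (power_topology k X)" by (simp add: topspace_weak_topology)
    have "(\<integral>x. f x \<partial>mean_marginal X k \<nu>) = (\<Sum>i<k. max 0 (1 / real k) * (\<integral>x. f x \<partial>marginal X i \<nu>))"
      unfolding mean_marginal_def by (rule integral_lin_comb) (use marginal_borel_probs[OF \<nu>] f in auto)
    also have "\<dots> = (\<Sum>i<k. (1 / real k) * (\<integral>z. f (z i) \<partial>\<nu>))"
      by (rule sum.cong) (use integral_marginal[OF \<nu> _ f] in auto)
    finally show "(\<Sum>i<k. (1 / real k) * (\<integral>z. f (z i) \<partial>\<nu>)) = (\<integral>x. f x \<partial>mean_marginal X k \<nu>)" by simp
  qed
qed

section \<open>The bootstrap as an image of an empirical measure of tuples\<close>

lemma index_mod_range: "n > 0 \<Longrightarrow> index_mod n z \<in> {1..n}"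
proof -
  assume "n > 0"
  then have "0 \<le> (z - 1) mod int n" "(z - 1) mod int n < int n" by auto
  then show ?thesis by (auto simp: index_mod_def nat_less_iff Suc_le_eq)
qed

lemma index_mod_eq_iff:
  assumes "n > 0"
  shows "index_mod n z = index_mod n z' \<longleftrightarrow> int n dvd z - z'"
proof -
  have "index_mod n z = index_mod n z' \<longleftrightarrow> (z - 1) mod int n = (z' - 1) mod int n"
    using assms by (simp add: index_mod_def eq_nat_nat_iff)
  also have "\<dots> \<longleftrightarrow> int n dvd z - z'" by (simp add: mod_eq_dvd_iff)
  finally show ?thesis .
qed

lemma index_mod_index_mod:
  assumes "n > 0"
  shows "index_mod n (int (index_mod n z) + r) = index_mod n (z + r)"
proof -
  have "int (index_mod n z) = (z - 1) mod int n + 1" using assms by (simp add: index_mod_def)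
  then have "int (index_mod n z) + r - (z + r) = (z - 1) mod int n - (z - 1)" by simp
  also have "int n dvd \<dots>" by (simp add: mod_eq_dvd_iff[symmetric])
  finally show ?thesis by (simp add: index_mod_eq_iff[OF assms])
qed

lemma inj_on_index_mod:
  assumes "n > 0" "\<And>u v. u \<in> S \<Longrightarrow> v \<in> S \<Longrightarrow> \<bar>int u - int v\<bar> < int n"
  shows "inj_on (\<lambda>u. index_mod n (int u + c)) S"
proof (rule inj_onI)
  fix u v assume uv: "u \<in> S" "v \<in> S" "index_mod n (int u + c) = index_mod n (int v + c)"
  then have "int n dvd int u - int v" by (simp add: index_mod_eq_iff[OF assms(1)])
  then have "int u - int v = 0" using assms(2)[OF uv(1,2)] dvd_imp_le_int[of "int u - int v" "int n"] by force
  then show "u = v" by simp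
qed

lemma bij_betw_index_mod:
  assumes "n > 0"
  shows "bij_betw (\<lambda>i. index_mod n (int i + c)) {1..n} {1..n}"
proof -
  have inj: "inj_on (\<lambda>i. index_mod n (int i + c)) {1..n}"
    by (rule inj_on_index_mod) (use assms in auto)
  moreover have "(\<lambda>i. index_mod n (int i + c)) ` {1..n} = {1..n}"
    by (rule endo_inj_surj[OF _ _ inj]) (use index_mod_range[OF assms] in auto)
  ultimately show ?thesis by (simp add: bij_betw_def)
qed

definition shifted_tuple :: "nat \<Rightarrow> nat \<Rightarrow> nat \<Rightarrow> (nat \<Rightarrow> 'a) \<Rightarrow> nat \<Rightarrow> nat \<Rightarrow> 'a" where
  "shifted_tuple k s n x i = (\<lambda>r\<in>{..<k}. x (index_mod n (int i - int s + int r)))"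

lemma shifted_tuple_in_topspace: "shifted_tuple k s n x i \<in> topspace (power_topology k euclidean)"
  by (simp add: shifted_tuple_def topspace_power_topology)

text \<open>Subtracting s rotates {1..n} modulo n, so the moving and the circular scheme draw from
  the same multiset of tuples.\<close>

lemma sum_shifted_tuple:
  assumes "n > 0"
  shows "(\<Sum>i\<in>{1..n}. f (shifted_tuple k s n x i)) = (\<Sum>i\<in>{1..n}. f (shifted_tuple k 0 n x i))"
proof -
  have "shifted_tuple k s n x i = shifted_tuple k 0 n x (index_mod n (int i + - int s))" for i
    unfolding shifted_tuple_def using index_mod_index_mod[OF assms] by (simp add: add.assoc)
  then have "(\<Sum>i\<in>{1..n}. f (shifted_tuple k s n x i))
      = (\<Sum>i\<in>{1..n}. f (shifted_tuple k 0 n x (index_mod n (int i + - int s))))" by simp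
  also have "\<dots> = (\<Sum>i\<in>{1..n}. f (shifted_tuple k 0 n x i))"
    by (rule sum.reindex_bij_betw[OF bij_betw_index_mod[OF assms]])
  finally show ?thesis .
qed

lemma integral_tuple_empirical:
  assumes "n > 0" and f: "bounded_continuous (power_topology k euclidean) f"
  shows "(\<integral>z. f z \<partial>tuple_empirical euclidean k n x) = (\<Sum>i\<in>{1..n}. f (shifted_tuple k s n x i)) / real n"
proof -
  have t: "(\<lambda>r\<in>{..<k}. x (index_mod n (int i + int r))) = shifted_tuple k 0 n x i" for i
    by (simp add: shifted_tuple_def)
  have "(\<integral>z. f z \<partial>tuple_empirical euclidean k n x)
      = (\<Sum>i\<in>{1..n}. max 0 (1 / real n) * (\<integral>z. f z \<partial>dirac (power_topology k euclidean) (shifted_tuple k 0 n x i)))"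
    unfolding tuple_empirical_def t
    by (rule integral_lin_comb[OF _ dirac_borel_probs[OF shifted_tuple_in_topspace] f]) simp
  also have "\<dots> = (\<Sum>i\<in>{1..n}. 1 / real n * f (shifted_tuple k 0 n x i))"
    by (rule sum.cong) (use integral_dirac[OF f shifted_tuple_in_topspace] in auto)
  also have "\<dots> = (\<Sum>i\<in>{1..n}. f (shifted_tuple k 0 n x i)) / real n"
    by (simp add: sum_divide_distrib)
  finally show ?thesis using sum_shifted_tuple[OF assms(1), of f k s x] by simp
qed

definition block_measure :: "nat \<Rightarrow> nat \<Rightarrow> nat \<Rightarrow> (nat \<Rightarrow> 'a::polish_space) \<Rightarrow> nat \<Rightarrow> 'a measure" where
  "block_measure k s n x i = lin_comb euclidean (block n k s i) (\<lambda>_. 1 / real k) (\<lambda>j. dirac euclidean (x j))"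

lemma finite_block: "finite (block n k s i)"
  by (simp add: block_def)

text \<open>A block is a set, so a repeated index would count only once; k \<le> n makes the k
  consecutive residues distinct.\<close>

lemma sum_block:
  assumes "0 < n" "k \<le> n"
  shows "(\<Sum>j\<in>block n k s i. g (x j)) = (\<Sum>r<k. g (shifted_tuple k s n x i r))"
proof -
  have "inj_on (\<lambda>r. index_mod n (int r + (int i - int s))) {..<k}"
    by (rule inj_on_index_mod) (use assms in auto)
  then have "inj_on (\<lambda>r. index_mod n (int i - int s + int r)) {..<k}" by (simp add: add.commute)
  then have "(\<Sum>j\<in>block n k s i. g (x j)) = (\<Sum>r<k. g (x (index_mod n (int i - int s + int r))))"
    unfolding block_def by (simp add: sum.reindex)
  then show ?thesis by (simp add: shifted_tuple_def)
qed

lemma block_measure_borel_probs: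
  assumes "0 < n" "k \<le> n" "k \<ge> 1"
  shows "block_measure k s n x i \<in> borel_probs euclidean"
proof -
  have "(\<Sum>j\<in>block n k s i. 1 / real k) = (\<Sum>r<k. 1 / real k)"
    by (rule sum_block[OF assms(1,2), where g="\<lambda>_. 1 / real k"])
  then have "(\<Sum>j\<in>block n k s i. max 0 (1 / real k)) = 1" using assms(3) by simp
  then show ?thesis
    unfolding block_measure_def
    by (subst lin_comb_borel_probs_iff) (auto intro: finite_block dirac_borel_probs)
qed

lemma emeasure_block_measure:
  fixes x :: "nat \<Rightarrow> 'a::polish_space"
  assumes "0 < n" "k \<le> n" and A: "A \<in> sets (borel_of euclidean)"
  shows "emeasure (block_measure k s n x i) A = ennreal ((\<Sum>r<k. indicator A (shifted_tuple k s n x i r)) / real k)"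
proof -
  have "emeasure (block_measure k s n x i) A = (\<Sum>j\<in>block n k s i. ennreal (1 / real k) * indicator A (x j))"
    unfolding block_measure_def using A by (subst emeasure_lin_comb) auto
  also have "\<dots> = (\<Sum>j\<in>block n k s i. (\<lambda>z. ennreal (indicator A z / real k)) (x j))"
    by (rule sum.cong) (auto simp: indicator_def)
  also have "\<dots> = (\<Sum>r<k. ennreal (indicator A (shifted_tuple k s n x i r) / real k))"
    unfolding sum_block[OF assms(1,2), where g="\<lambda>z. ennreal (indicator A z / real k)"] by simp
  also have "\<dots> = ennreal (\<Sum>r<k. indicator A (shifted_tuple k s n x i r) / real k)"
    by (rule sum_ennreal) simp
  finally show ?thesis by (simp add: sum_divide_distrib)
qed

lemma sum_occupation:
  fixes g :: "nat \<Rightarrow> real" and m :: nat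
  assumes "b \<in> PiE {..<m} (\<lambda>_. {1..n})"
  shows "(\<Sum>i\<in>{1..n}. real (card {l \<in> {..<m}. b l = i}) * g i) = (\<Sum>l<m. g (b l))"
proof -
  have "(\<Sum>l<m. g (b l)) = (\<Sum>i\<in>{1..n}. \<Sum>l\<in>{l \<in> {..<m}. b l = i}. g (b l))"
    by (rule sum.group[symmetric]) (use PiE_mem[OF assms] in auto)
  then show ?thesis by simp
qed

text \<open>With weights k times the occupation numbers, the sum over urns becomes a sum over draws,
  and then the sums over draws and over positions in the tuple are exchanged. Each pair of a draw
  and a position has mass 1/n = 1/(m k).\<close>

lemma block_bootstrap_occupation:
  fixes x :: "nat \<Rightarrow> 'a::polish_space"
  assumes n: "0 < n" "k dvd n" and k: "k \<ge> 1" and b: "b \<in> PiE {..<n div k} (\<lambda>_. {1..n})"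
  shows "block_bootstrap euclidean k s n x (\<lambda>i. real k * real (card {l \<in> {..<n div k}. b l = i}))
    = mean_marginal euclidean k (empirical_measure (power_topology k euclidean) (n div k) (\<lambda>l. shifted_tuple k s n x (b l)))"
    (is "?L = ?R")
proof (rule measure_eqI)
  have kn: "k \<le> n" using n by (intro dvd_imp_le) auto
  define m where "m = n div k"
  have nmk: "n = m * k" using n by (simp add: m_def)
  have m: "m > 0" using nmk n by (cases m) auto
  show "sets ?L = sets ?R" by (simp add: block_bootstrap_def mean_marginal_def)
  fix A assume "A \<in> sets ?L"
  then have A: "A \<in> sets (borel_of euclidean)" by (simp add: block_bootstrap_def)
  define N where "N i = (\<Sum>r<k. indicator A (shifted_tuple k s n x i r) :: real)" for i
  have N0: "0 \<le> N i" for i unfolding N_def by (rule sum_nonneg) simp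
  let ?c = "\<lambda>i. real (card {l \<in> {..<n div k}. b l = i})"
  have "emeasure ?L A = (\<Sum>i\<in>{1..n}. ennreal (1 / real n * (real k * ?c i)) * ennreal (N i / real k))"
    unfolding block_bootstrap_def N_def
    by (subst emeasure_lin_comb)
      (use A emeasure_block_measure[OF n(1) kn A] in \<open>auto simp: block_measure_def\<close>)
  also have "\<dots> = (\<Sum>i\<in>{1..n}. ennreal (?c i * (N i / real n)))"
    by (rule sum.cong) (use k N0 in \<open>simp_all flip: ennreal_mult'\<close>)
  also have "\<dots> = ennreal (\<Sum>i\<in>{1..n}. ?c i * (N i / real n))"
    by (rule sum_ennreal) (use N0 in simp)
  also have "(\<Sum>i\<in>{1..n}. ?c i * (N i / real n)) = (\<Sum>l<n div k. N (b l) / real n)"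
    by (rule sum_occupation[OF b])
  also have "\<dots> = (\<Sum>l<m. \<Sum>r<k. indicator A (shifted_tuple k s n x (b l) r) / real n)"
    by (simp only: N_def sum_divide_distrib m_def)
  also have "\<dots> = (\<Sum>r<k. \<Sum>l<m. indicator A (shifted_tuple k s n x (b l) r) / real n)"
    by (rule sum.swap)
  also have "ennreal \<dots> = (\<Sum>r<k. ennreal (\<Sum>l<m. indicator A (shifted_tuple k s n x (b l) r) / real n))"
    by (rule sum_ennreal[symmetric]) (simp add: sum_nonneg)
  also have "\<dots> = (\<Sum>r<k. ennreal (1 / real k) * emeasure (marginal euclidean r
      (empirical_measure (power_topology k euclidean) (n div k) (\<lambda>l. shifted_tuple k s n x (b l)))) A)"
  proof (rule sum.cong[OF refl])
    fix r assume "r \<in> {..<k}"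
    then have r: "r < k" by simp
    let ?E = "empirical_measure (power_topology k euclidean) m (\<lambda>l. shifted_tuple k s n x (b l))"
    have Eb: "?E \<in> borel_probs (power_topology k euclidean)"
      by (rule empirical_measure_borel_probs[OF m shifted_tuple_in_topspace])
    have pm: "(\<lambda>z. z r) \<in> measurable ?E (borel_of euclidean)"
      by (rule continuous_map_measurable_borel_of[OF continuous_map_power_topology_component[OF r] borel_probsD(2)[OF Eb]])
    let ?A = "(\<lambda>z. z r) -` A \<inter> space ?E"
    have As: "?A \<in> sets (borel_of (power_topology k euclidean))"
      using measurable_sets[OF pm A] borel_probsD(2)[OF Eb] by simp
    have "emeasure (marginal euclidean r ?E) A = emeasure ?E ?A"
      unfolding marginal_def by (rule emeasure_distr[OF pm A])
    also have "\<dots> = ennreal (real (card {l \<in> {..<m}. shifted_tuple k s n x (b l) \<in> ?A}) / real m)"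
      by (rule emeasure_empirical_measure[OF As m])
    also have "{l \<in> {..<m}. shifted_tuple k s n x (b l) \<in> ?A} = {l \<in> {..<m}. shifted_tuple k s n x (b l) r \<in> A}"
      using borel_probsD(3)[OF Eb] shifted_tuple_in_topspace by auto
    also have "real (card {l \<in> {..<m}. shifted_tuple k s n x (b l) r \<in> A}) = (\<Sum>l<m. indicator A (shifted_tuple k s n x (b l) r))"
    proof -
      have "(\<Sum>l<m. indicator A (shifted_tuple k s n x (b l) r)) = (\<Sum>l<m. if shifted_tuple k s n x (b l) r \<in> A then 1 else 0 :: real)"
        by (rule sum.cong) auto
      then show ?thesis by (simp add: sum.If_cases Int_def)
    qed
    finally have e: "emeasure (marginal euclidean r ?E) A = ennreal ((\<Sum>l<m. indicator A (shifted_tuple k s n x (b l) r)) / real m)" .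
    have "ennreal (1 / real k) * emeasure (marginal euclidean r ?E) A
        = ennreal (1 / real k * ((\<Sum>l<m. indicator A (shifted_tuple k s n x (b l) r)) / real m))"
      unfolding e by (rule ennreal_mult'[symmetric]) simp
    also have "1 / real k * ((\<Sum>l<m. indicator A (shifted_tuple k s n x (b l) r)) / real m)
        = (\<Sum>l<m. indicator A (shifted_tuple k s n x (b l) r) / real n)"
      by (simp add: nmk sum_divide_distrib[symmetric] mult.commute)
    finally show "ennreal (\<Sum>l<m. indicator A (shifted_tuple k s n x (b l) r) / real n)
        = ennreal (1 / real k) * emeasure (marginal euclidean r
          (empirical_measure (power_topology k euclidean) (n div k) (\<lambda>l. shifted_tuple k s n x (b l)))) A"
      by (simp only: m_def)
  qed
  also have "\<dots> = emeasure ?R A"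
    unfolding mean_marginal_def
    by (rule emeasure_lin_comb[symmetric]) (use A in \<open>auto simp: marginal_def\<close>)
  finally show "emeasure ?L A = emeasure ?R A" .
qed

section \<open>The law of the bootstrapped measure\<close>

text \<open>Phrased by preimages because h may take values outside the topological space: arbitrary
  weights need not give a probability measure.\<close>

lemma borel_measurable_preimage:
  assumes "\<And>U. openin T U \<Longrightarrow> {\<omega> \<in> space M. h \<omega> \<in> U} \<in> sets M" and A: "A \<in> sets (borel_of T)"
  shows "{\<omega> \<in> space M. h \<omega> \<in> A} \<in> sets M"
  using A unfolding sets_borel_of
proof (induction rule: sigma_sets.induct)
  case (Basic a)
  then show ?case using assms(1) by simp
next
  case Empty
  then show ?case by simp
next
  case (Compl a)
  have "{\<omega> \<in> space M. h \<omega> \<in> topspace T - a} = {\<omega> \<in> space M. h \<omega> \<in> topspace T} - {\<omega> \<in> space M. h \<omega> \<in> a}" by auto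
  then show ?case using Compl.IH assms(1)[OF openin_topspace] by (simp add: sets.Diff)
next
  case (Union a)
  have "{\<omega> \<in> space M. h \<omega> \<in> (\<Union>i. a i)} = (\<Union>i. {\<omega> \<in> space M. h \<omega> \<in> a i})" by auto
  then show ?case using Union.IH by simp
qed

text \<open>The weights that give a probability measure form a closed set S, on which the bootstrap
  map is weakly continuous. The preimage of a weakly open set is thus the trace on S of an open set
  of weight vectors.\<close>

lemma block_bootstrap_preimage:
  fixes x :: "nat \<Rightarrow> 'a::polish_space"
  assumes n: "0 < n" "k \<le> n" and k: "k \<ge> 1" and A: "A \<in> sets (borel_of (weak_topology (euclidean :: 'a topology)))"
  shows "{w \<in> space (Pi\<^sub>M {1..n} (\<lambda>_. borel)). block_bootstrap euclidean k s n x (\<lambda>i. real k * w i) \<in> A}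
    \<in> sets (Pi\<^sub>M {1..n} (\<lambda>_. borel))"
proof (rule borel_measurable_preimage[OF _ A])
  let ?P = "Pi\<^sub>M {1..n} (\<lambda>_. borel) :: (nat \<Rightarrow> real) measure"
  define h where "h w = block_bootstrap euclidean k s n x (\<lambda>i. real k * w i)" for w :: "nat \<Rightarrow> real"
  define S where "S = {w :: nat \<Rightarrow> real. (\<Sum>i\<in>{1..n}. max 0 (1 / real n * (real k * w i))) = 1}"
  have h: "h w = lin_comb euclidean {1..n} (\<lambda>i. 1 / real n * (real k * w i)) (block_measure k s n x)" for w
  proof -
    have "block_measure k s n x = (\<lambda>i. lin_comb euclidean (block n k s i) (\<lambda>_. 1 / real k) (\<lambda>j. dirac euclidean (x j)))"
      by (rule ext) (rule block_measure_def)
    then show ?thesis by (simp only: h_def block_bootstrap_def)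
  qed
  have bp: "block_measure k s n x i \<in> borel_probs euclidean" for i
    by (rule block_measure_borel_probs[OF n k])
  have hS: "h w \<in> borel_probs euclidean \<longleftrightarrow> w \<in> S" for w
    unfolding h S_def by (subst lin_comb_borel_probs_iff) (use bp in auto)
  have cont: "continuous_map (top_of_set S) (weak_topology euclidean) h"
  proof (rule continuous_map_into_weak_topology)
    show "h w \<in> borel_probs euclidean" if "w \<in> topspace (top_of_set S)" for w
      using hS that by simp
    fix f :: "'a \<Rightarrow> real" assume f: "bounded_continuous euclidean f"
    have "(\<integral>x. f x \<partial>h w) = (\<Sum>i\<in>{1..n}. max 0 (1 / real n * (real k * w i)) * (\<integral>z. f z \<partial>block_measure k s n x i))" for w
      unfolding h by (rule integral_lin_comb) (use bp f in auto)
    moreover have "continuous_on S (\<lambda>w. \<Sum>i\<in>{1..n}. max 0 (1 / real n * (real k * w i)) * (\<integral>z. f z \<partial>block_measure k s n x i))"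
      by (intro continuous_intros continuous_on_subset[OF continuous_on_product_coordinates]) auto
    ultimately show "continuous_map (top_of_set S) euclideanreal (\<lambda>w. \<integral>x. f x \<partial>h w)" by simp
  qed
  \<comment> \<open>The product space lives on {1..n} only; the other coordinates are constantly
    \<open>undefined\<close> on it. This makes the identity measurable into the Borel sets of the
    full function space.\<close>
  have comp: "(\<lambda>w. w i) \<in> borel_measurable ?P" for i
  proof (cases "i \<in> {1..n}")
    case True
    then show ?thesis by (rule measurable_component_singleton)
  next
    case False
    have "w i = undefined" if "w \<in> space ?P" for w
      using PiE_arb[OF that[unfolded space_PiM] False] .
    then have "(\<lambda>w. w i) \<in> borel_measurable ?P \<longleftrightarrow> (\<lambda>w. undefined :: real) \<in> borel_measurable ?P"
      by (rule measurable_cong)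
    then show ?thesis by simp
  qed
  have idm: "(\<lambda>w. w) \<in> measurable ?P borel"
    by (rule measurable_coordinatewise_then_product) (rule comp)
  fix U assume U: "openin (weak_topology (euclidean :: 'a topology)) U"
  have "openin (top_of_set S) {w \<in> S. h w \<in> U}"
    using openin_continuous_map_preimage[OF cont U] by simp
  then obtain V where V: "open V" "{w \<in> S. h w \<in> U} = S \<inter> V" unfolding openin_open by blast
  have "closed S" unfolding S_def
    by (intro closed_Collect_eq continuous_intros continuous_on_product_coordinates)
  have "{w \<in> space ?P. h w \<in> U} = (\<lambda>w. w) -` (S \<inter> V) \<inter> space ?P"
    using V(2) hS openin_subset[OF U] by (auto simp: topspace_weak_topology)
  also have "\<dots> \<in> sets ?P"
    by (rule measurable_sets[OF idm]) (use V(1) \<open>closed S\<close> in auto)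
  finally show "{w \<in> space ?P. block_bootstrap euclidean k s n x (\<lambda>i. real k * w i) \<in> U} \<in> sets ?P"
    by (simp add: h_def)
qed

section \<open>Multinomial weights as counts of draws\<close>

lemma measure_uniform_draws:
  assumes "n > 0" and E: "E \<in> sets (Pi\<^sub>M {..<m} (\<lambda>_. point_measure {1..n} (\<lambda>_. ennreal (1 / real n))))"
  shows "emeasure (Pi\<^sub>M {..<m} (\<lambda>_. point_measure {1..n} (\<lambda>_. ennreal (1 / real n)))) E
    = ennreal (real (card E) / real n ^ m)"
proof -
  let ?N = "point_measure {1..n} (\<lambda>_. ennreal (1 / real n))"
  let ?P = "Pi\<^sub>M {..<m} (\<lambda>_. ?N)"
  have one: "emeasure ?N {1..n} = 1"
  proof -
    have "emeasure ?N {1..n} = (\<Sum>i\<in>{1..n}. ennreal (1 / real n))"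
      by (rule emeasure_point_measure_finite) auto
    also have "\<dots> = ennreal (\<Sum>i\<in>{1..n}. 1 / real n)" by (rule sum_ennreal) simp
    finally show ?thesis using assms(1) by simp
  qed
  have N: "prob_space ?N" by (rule prob_spaceI) (simp only: space_point_measure one)
  interpret product_sigma_finite "\<lambda>_::nat. ?N"
    using prob_space_imp_sigma_finite[OF N] unfolding product_sigma_finite_def by blast
  have spP: "space ?P = PiE {..<m} (\<lambda>_. {1..n})" by (simp add: space_PiM space_point_measure)
  have sub: "E \<subseteq> PiE {..<m} (\<lambda>_. {1..n})" using sets.sets_into_space[OF E] spP by simp
  have fin: "finite E" by (rule finite_subset[OF sub]) (auto intro: finite_PiE)
  have single: "{b} \<in> sets ?P \<and> emeasure ?P {b} = ennreal ((1 / real n) ^ m)" if "b \<in> E" for b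
  proof -
    have b: "b \<in> PiE {..<m} (\<lambda>_. {1..n})" using sub that by blast
    have eq: "PiE {..<m} (\<lambda>l. {b l}) = {b}"
      by (rule PiE_singleton) (use b in \<open>simp add: PiE_def\<close>)
    have s: "{b l} \<in> sets ?N" if "l < m" for l
      using PiE_mem[OF b, of l] that by (simp add: sets_point_measure)
    have "{b} \<in> sets ?P" unfolding eq[symmetric] by (rule sets_PiM_I_finite) (use s in auto)
    moreover have "emeasure ?P {b} = (\<Prod>l<m. emeasure ?N {b l})"
      unfolding eq[symmetric] by (rule emeasure_PiM) (use s in auto)
    moreover have "(\<Prod>l<m. emeasure ?N {b l}) = (\<Prod>l<m. ennreal (1 / real n))"
    proof (rule prod.cong[OF refl])
      fix l assume "l \<in> {..<m}"
      then have "{b l} \<subseteq> {1..n}" using PiE_mem[OF b, of l] by simp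
      then show "emeasure ?N {b l} = ennreal (1 / real n)"
        by (subst emeasure_point_measure_finite) auto
    qed
    ultimately show ?thesis by (simp add: ennreal_power)
  qed
  have "emeasure ?P E = (\<Sum>b\<in>E. emeasure ?P {b})"
    by (rule emeasure_eq_sum_singleton[OF fin]) (use single in auto)
  also have "\<dots> = (\<Sum>b\<in>E. ennreal ((1 / real n) ^ m))" using single by simp
  also have "\<dots> = ennreal (\<Sum>b\<in>E. (1 / real n) ^ m)" by (rule sum_ennreal) simp
  also have "\<dots> = ennreal (real (card E) / real n ^ m)" by (simp add: power_one_over)
  finally show ?thesis .
qed

lemma Mult_uniform_emeasure:
  assumes "n > 0" and D: "D \<in> sets (Pi\<^sub>M {1..n} (\<lambda>_. borel))"
  shows "emeasure (Mult n m (\<lambda>_. 1 / real n)) D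
    = ennreal (real (card {b \<in> PiE {..<m} (\<lambda>_. {1..n}). (\<lambda>i\<in>{1..n}. real (card {l \<in> {..<m}. b l = i})) \<in> D}) / real n ^ m)"
proof -
  let ?P = "Pi\<^sub>M {..<m} (\<lambda>_. point_measure {1..n} (\<lambda>_. ennreal (1 / real n)))"
  let ?c = "\<lambda>b. \<lambda>i\<in>{1..n}. real (card {l \<in> {..<m}. b l = i})"
  have spP: "space ?P = PiE {..<m} (\<lambda>_. {1..n})" by (simp add: space_PiM space_point_measure)
  have "(\<lambda>b. real (card {l \<in> {..<m}. b l = i})) \<in> borel_measurable ?P" for i
  proof -
    have "(\<lambda>b. if b l = i then 1 else 0 :: real) \<in> borel_measurable ?P" if "l \<in> {..<m}" for l
    proof -
      have "(\<lambda>b. b l) \<in> measurable ?P (point_measure {1..n} (\<lambda>_. ennreal (1 / real n)))"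
        by (rule measurable_component_singleton[OF that])
      from measurable_compose[OF this, of "\<lambda>j. if j = i then 1 else 0 :: real" borel]
      show ?thesis by simp
    qed
    then have "(\<lambda>b. \<Sum>l<m. if b l = i then 1 else 0 :: real) \<in> borel_measurable ?P"
      by (rule borel_measurable_sum)
    moreover have "(\<Sum>l<m. if b l = i then 1 else 0 :: real) = real (card {l \<in> {..<m}. b l = i})" for b
      by (simp add: sum.If_cases Int_def)
    ultimately show ?thesis by simp
  qed
  then have c: "?c \<in> measurable ?P (Pi\<^sub>M {1..n} (\<lambda>_. borel))" by (intro measurable_restrict)
  have "emeasure (Mult n m (\<lambda>_. 1 / real n)) D = emeasure ?P (?c -` D \<inter> space ?P)"
    unfolding Mult_def by (rule emeasure_distr[OF c D])
  also have "\<dots> = ennreal (real (card (?c -` D \<inter> space ?P)) / real n ^ m)"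
    by (rule measure_uniform_draws[OF assms(1) measurable_sets[OF c D]])
  also have "?c -` D \<inter> space ?P = {b \<in> PiE {..<m} (\<lambda>_. {1..n}). ?c b \<in> D}" using spP by auto
  finally show ?thesis .
qed

text \<open>The usual formula under a condition on preimages alone. The bootstrap map can leave the
  space of probability measures on a null event, so it need not be measurable in the sense of
  \<open>measurable\<close>.\<close>

lemma emeasure_distr_preimage:
  assumes pre: "\<And>A. A \<in> sets N \<Longrightarrow> h -` A \<inter> space M \<in> sets M" and A: "A \<in> sets N"
  shows "emeasure (distr M N h) A = emeasure M (h -` A \<inter> space M)"
  unfolding distr_def
proof (rule emeasure_measure_of_sigma)
  show "sigma_algebra (space N) (sets N)" by (rule sets.sigma_algebra_axioms)
  show "positive (sets N) (\<lambda>A. emeasure M (h -` A \<inter> space M))" by (simp add: positive_def)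
  show "countably_additive (sets N) (\<lambda>A. emeasure M (h -` A \<inter> space M))"
  proof (rule countably_additiveI)
    fix B :: "nat \<Rightarrow> _" assume B: "range B \<subseteq> sets N" "disjoint_family B"
    have "(\<Sum>i. emeasure M (h -` B i \<inter> space M)) = emeasure M (\<Union>i. h -` B i \<inter> space M)"
      by (rule suminf_emeasure) (use B pre in \<open>auto simp: disjoint_family_on_def\<close>)
    also have "(\<Union>i. h -` B i \<inter> space M) = h -` (\<Union>i. B i) \<inter> space M" by auto
    finally show "(\<Sum>i. emeasure M (h -` B i \<inter> space M)) = emeasure M (h -` (\<Union>i. B i) \<inter> space M)" .
  qed
qed (rule A)

lemma block_bootstrap_cong:
  assumes "\<And>i. i \<in> {1..n} \<Longrightarrow> w i = w' i"
  shows "block_bootstrap X k s n x w = block_bootstrap X k s n x w'"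
proof -
  have "(\<Sum>i\<in>{1..n}. ennreal (1 / real n * w i) * g i) = (\<Sum>i\<in>{1..n}. ennreal (1 / real n * w' i) * g i)" for g :: "nat \<Rightarrow> ennreal"
    by (rule sum.cong) (use assms in auto)
  then show ?thesis by (simp only: block_bootstrap_def lin_comb_def)
qed

text \<open>Only the joint law of the weights divided by k is prescribed, so the bootstrapped
  measure is written as a function of that vector, and the multinomial law then reduces the
  probability to a count of draws.\<close>

lemma emeasure_law_block_bootstrap:
  fixes x :: "nat \<Rightarrow> 'a::polish_space" and W :: "nat \<Rightarrow> 'w \<Rightarrow> real"
  assumes n: "0 < n" "k dvd n" and k: "k \<ge> 1"
    and W: "\<And>i. i \<in> {1..n} \<Longrightarrow> W i \<in> borel_measurable M"
    and law: "distr M (Pi\<^sub>M {1..n} (\<lambda>_. borel)) (\<lambda>\<omega>. \<lambda>i\<in>{1..n}. 1 / real k * W i \<omega>)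
      = Mult n (n div k) (\<lambda>_. 1 / real n)"
    and A: "A \<in> sets (borel_of (weak_topology (euclidean :: 'a topology)))"
  shows "emeasure (distr M (borel_of (weak_topology euclidean)) (\<lambda>\<omega>. block_bootstrap euclidean k s n x (\<lambda>i. W i \<omega>))) A
    = ennreal (real (card {b \<in> PiE {..<n div k} (\<lambda>_. {1..n}). mean_marginal euclidean k
        (empirical_measure (power_topology k euclidean) (n div k) (\<lambda>l. shifted_tuple k s n x (b l))) \<in> A})
      / real n ^ (n div k))"
proof -
  have kn: "k \<le> n" using n by (intro dvd_imp_le) auto
  let ?P = "Pi\<^sub>M {1..n} (\<lambda>_. borel) :: (nat \<Rightarrow> real) measure"
  let ?h = "\<lambda>\<omega>. block_bootstrap euclidean k s n x (\<lambda>i. W i \<omega>)"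
  define V where "V \<omega> = (\<lambda>i\<in>{1..n}. 1 / real k * W i \<omega>)" for \<omega>
  define D where "D A = {w \<in> space ?P. block_bootstrap euclidean k s n x (\<lambda>i. real k * w i) \<in> A}" for A
  have V: "V \<in> measurable M ?P"
    unfolding V_def using W by (intro measurable_restrict) auto
  have hV: "block_bootstrap euclidean k s n x (\<lambda>i. real k * V \<omega> i) = ?h \<omega>" for \<omega>
    by (rule block_bootstrap_cong) (use k in \<open>simp add: V_def\<close>)
  have D: "D A \<in> sets ?P" if "A \<in> sets (borel_of (weak_topology euclidean))" for A
    unfolding D_def by (rule block_bootstrap_preimage[OF n(1) kn k that])
  have pre: "?h -` A \<inter> space M = V -` D A \<inter> space M" for A
    using measurable_space[OF V] by (auto simp: D_def hV)
  have "emeasure (distr M (borel_of (weak_topology euclidean)) ?h) A = emeasure M (?h -` A \<inter> space M)"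
    by (rule emeasure_distr_preimage[OF _ A]) (unfold pre, rule measurable_sets[OF V D])
  also have "\<dots> = emeasure (distr M ?P V) (D A)"
    unfolding pre by (rule emeasure_distr[symmetric, OF V D[OF A]])
  also have "distr M ?P V = Mult n (n div k) (\<lambda>_. 1 / real n)"
    unfolding V_def by (rule law)
  also have "emeasure (Mult n (n div k) (\<lambda>_. 1 / real n)) (D A) = ennreal (real (card {b \<in> PiE {..<n div k} (\<lambda>_. {1..n}).
      (\<lambda>i\<in>{1..n}. real (card {l \<in> {..<n div k}. b l = i})) \<in> D A}) / real n ^ (n div k))"
    by (rule Mult_uniform_emeasure[OF n(1) D[OF A]])
  also have "{b \<in> PiE {..<n div k} (\<lambda>_. {1..n}). (\<lambda>i\<in>{1..n}. real (card {l \<in> {..<n div k}. b l = i})) \<in> D A}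
    = {b \<in> PiE {..<n div k} (\<lambda>_. {1..n}). mean_marginal euclidean k
        (empirical_measure (power_topology k euclidean) (n div k) (\<lambda>l. shifted_tuple k s n x (b l))) \<in> A}"
  proof (rule Collect_cong, rule conj_cong[OF refl])
    fix b assume b: "b \<in> PiE {..<n div k} (\<lambda>_. {1..n})"
    have "block_bootstrap euclidean k s n x (\<lambda>i. real k * (\<lambda>i\<in>{1..n}. real (card {l \<in> {..<n div k}. b l = i})) i)
      = block_bootstrap euclidean k s n x (\<lambda>i. real k * real (card {l \<in> {..<n div k}. b l = i}))"
      by (rule block_bootstrap_cong) simp
    then show "(\<lambda>i\<in>{1..n}. real (card {l \<in> {..<n div k}. b l = i})) \<in> D A \<longleftrightarrow> mean_marginal euclidean k
        (empirical_measure (power_topology k euclidean) (n div k) (\<lambda>l. shifted_tuple k s n x (b l))) \<in> A"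
      using block_bootstrap_occupation[OF n k b, of s x] by (simp add: D_def space_PiM)
  qed
  finally show ?thesis .
qed

section \<open>The contracted rate function\<close>

lemma bootstrap_rate_alt:
  "bootstrap_rate X k \<mu> x = Inf {ereal (1 / real k) * rel_entropy \<nu> \<mu> | \<nu>.
    \<nu> \<in> borel_probs (power_topology k X) \<and> mean_marginal X k \<nu> = x}"
  by (simp add: bootstrap_rate_def mean_marginal_def)

text \<open>The empty step function has pressure 0, so no negative number can bound the
  entropy.\<close>

lemma (in continuity_algebra) rel_entropy_nonneg:
  assumes "\<nu> \<in> borel_probs X"
  shows "0 \<le> rel_entropy \<nu> \<mu>"
proof (rule ccontr)
  assume "\<not> 0 \<le> rel_entropy \<nu> \<mu>"
  then have "rel_entropy \<nu> \<mu> < 0" by (simp add: not_le)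
  from ereal_dense2[OF this] obtain c where c: "rel_entropy \<nu> \<mu> < ereal c" "ereal c < 0" by blast
  then have "entropy_bounded c (measure \<nu>)"
    by (intro entropy_ball_imp_bounded) (use assms in \<open>simp add: entropy_ball_def\<close>)
  from entropy_boundedD[OF this, of 0] have "0 \<le> c" by (simp add: pressure_def M.prob_space)
  then show False using c(2) by simp
qed

locale bootstrap_rate_setting =
  fixes k :: nat and \<mu> :: "(nat \<Rightarrow> 'a::polish_space) measure"
  assumes k: "k \<ge> 1" and mu': "\<mu> \<in> borel_probs (power_topology k euclidean)"
begin

sublocale continuity_algebra "power_topology k euclidean" \<mu>
proof -
  interpret perfect_topology "power_topology k (euclidean :: 'a topology)" by (rule perfect_topology_power)
  show "continuity_algebra (power_topology k euclidean) \<mu>" by unfold_locales (rule mu')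
qed

sublocale S: perfect_topology "euclidean :: 'a topology"
  by (rule perfect_topology_euclidean)

abbreviation G :: "(nat \<Rightarrow> 'a) measure \<Rightarrow> 'a measure" where
  "G \<equiv> mean_marginal euclidean k"

abbreviation rate :: "'a measure \<Rightarrow> ereal" where
  "rate \<equiv> bootstrap_rate euclidean k \<mu>"

lemma rate_nonneg: "0 \<le> rate x"
  unfolding bootstrap_rate_alt
proof (rule Inf_greatest)
  fix z assume "z \<in> {ereal (1 / real k) * rel_entropy \<nu> \<mu> | \<nu>.
    \<nu> \<in> borel_probs (power_topology k euclidean) \<and> G \<nu> = x}"
  then show "0 \<le> z" using rel_entropy_nonneg by auto
qed

lemma rate_le:
  assumes "\<nu> \<in> entropy_ball h"
  shows "rate (G \<nu>) \<le> ereal (h / real k)"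
  unfolding bootstrap_rate_alt
proof (rule Inf_lower2)
  show "ereal (1 / real k) * rel_entropy \<nu> \<mu> \<in> {ereal (1 / real k) * rel_entropy \<nu>' \<mu> | \<nu>'.
    \<nu>' \<in> borel_probs (power_topology k euclidean) \<and> G \<nu>' = G \<nu>}"
    using assms by (auto simp: entropy_ball_def)
  have "ereal (1 / real k) * rel_entropy \<nu> \<mu> \<le> ereal (1 / real k) * ereal h"
    using assms by (intro ereal_mult_left_mono) (auto simp: entropy_ball_def)
  then show "ereal (1 / real k) * rel_entropy \<nu> \<mu> \<le> ereal (h / real k)" by simp
qed

text \<open>The rate is an infimum over a fibre, so strict inequality is what provides a competitor
  in an entropy ball.\<close>

lemma rate_less:
  assumes "rate x < ereal c"
  shows "\<exists>\<nu>\<in>entropy_ball (real k * c). G \<nu> = x"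
proof -
  obtain \<nu> where \<nu>: "\<nu> \<in> borel_probs (power_topology k euclidean)" "G \<nu> = x"
    "ereal (1 / real k) * rel_entropy \<nu> \<mu> < ereal c"
    using assms unfolding bootstrap_rate_alt Inf_less_iff by auto
  have "rel_entropy \<nu> \<mu> \<le> ereal (real k * c)"
    using \<nu>(3) rel_entropy_nonneg[OF \<nu>(1)] k
    by (cases "rel_entropy \<nu> \<mu>") (auto simp: field_simps)
  then show ?thesis using \<nu> by (auto simp: entropy_ball_def)
qed

lemma compactin_image_entropy_ball: "compactin (weak_topology euclidean) (G ` entropy_ball c)"
  by (rule image_compactin[OF compactin_entropy_ball continuous_map_mean_marginal[OF k]])

text \<open>The level c is approached through c + 1/(j+1), which avoids having to show that the
  infimum is attained.\<close>

lemma rate_level_set: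
  "{x \<in> topspace (weak_topology euclidean). rate x \<le> ereal c} = (\<Inter>j. G ` entropy_ball (real k * (c + 1 / (real j + 1))))"
proof (rule set_eqI, rule iffI)
  fix x assume "x \<in> {x \<in> topspace (weak_topology euclidean). rate x \<le> ereal c}"
  then have "rate x \<le> ereal c" by simp
  moreover have "ereal c < ereal (c + 1 / (real j + 1))" for j :: nat by simp
  ultimately have "rate x < ereal (c + 1 / (real j + 1))" for j :: nat by (rule le_less_trans)
  from rate_less[OF this] show "x \<in> (\<Inter>j. G ` entropy_ball (real k * (c + 1 / (real j + 1))))" by blast
next
  fix x assume x: "x \<in> (\<Inter>j. G ` entropy_ball (real k * (c + 1 / (real j + 1))))"
  have le: "rate x \<le> ereal (c + 1 / (real j + 1))" for j
  proof -
    obtain \<nu> where "\<nu> \<in> entropy_ball (real k * (c + 1 / (real j + 1)))" "x = G \<nu>" using x by blast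
    then show ?thesis using rate_le[of \<nu>] k by force
  qed
  have "rate x \<le> ereal c"
  proof (rule ereal_le_epsilon2)
    fix e :: real assume "0 < e"
    then obtain j where "inverse (real (Suc j)) < e" using reals_Archimedean by blast
    then have "c + 1 / (real j + 1) \<le> c + e" by (simp add: inverse_eq_divide add.commute)
    then show "rate x \<le> ereal c + ereal e" using le[of j] by (metis ereal_less_eq(3) order_trans plus_ereal.simps(1))
  qed
  moreover have "x \<in> topspace (weak_topology euclidean)"
    using x compactin_subset_topspace[OF compactin_image_entropy_ball] by blast
  ultimately show "x \<in> {x \<in> topspace (weak_topology euclidean). rate x \<le> ereal c}" by simp
qed

text \<open>Images of entropy balls are compact, hence closed in a Hausdorff space; the intersection
  is a closed subset of its member j = 0.\<close>

lemma compactin_rate_level_set: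
  "compactin (weak_topology euclidean) {x \<in> topspace (weak_topology euclidean). rate x \<le> ereal c}"
  unfolding rate_level_set
proof (rule closed_compactin)
  show "compactin (weak_topology euclidean) (G ` entropy_ball (real k * (c + 1 / (real 0 + 1))))"
    by (rule compactin_image_entropy_ball)
  show "(\<Inter>j. G ` entropy_ball (real k * (c + 1 / (real j + 1)))) \<subseteq> G ` entropy_ball (real k * (c + 1 / (real 0 + 1)))"
    by (rule INF_lower2[of 0]) auto
  show "closedin (weak_topology euclidean) (\<Inter>j. G ` entropy_ball (real k * (c + 1 / (real j + 1))))"
    by (rule closedin_INT)
      (use compactin_imp_closedin[OF S.Hausdorff_space_weak_topology compactin_image_entropy_ball] in auto)
qed

lemma good_rate_function_bootstrap_rate: "good_rate_function (weak_topology euclidean) rate"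
  unfolding good_rate_function_def rate_function_def
proof (intro conjI ballI allI impI)
  show "0 \<le> rate x" for x by (rule rate_nonneg)
  show "compactin (weak_topology euclidean) {x \<in> topspace (weak_topology euclidean). rate x \<le> ereal c}" for c
    by (rule compactin_rate_level_set)
  fix x and c assume x: "x \<in> topspace (weak_topology euclidean)" "c < rate x"
  have *: "\<exists>U. openin (weak_topology euclidean) U \<and> x \<in> U \<and> (\<forall>y\<in>U. ereal r < rate y)" if "ereal r < rate x" for r
  proof -
    let ?L = "{x \<in> topspace (weak_topology euclidean). rate x \<le> ereal r}"
    have "closedin (weak_topology euclidean) ?L"
      by (rule compactin_imp_closedin[OF S.Hausdorff_space_weak_topology compactin_rate_level_set])
    then show ?thesis using x(1) that
      by (intro exI[of _ "topspace (weak_topology euclidean) - ?L"]) (auto simp: closedin_def)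
  qed
  \<comment> \<open>The level c is an extended real; a real number between it and the rate at x
    reduces the claim to real level sets.\<close>
  obtain r where "c \<le> ereal r" "ereal r < rate x"
    using ereal_dense2[OF x(2)] less_imp_le by blast
  with *[of r] show "\<exists>U. openin (weak_topology euclidean) U \<and> x \<in> U \<and> (\<forall>y\<in>U. c < rate y)"
    by (meson le_less_trans)
qed

end

section \<open>The large deviation principle\<close>

lemma scaled_log_prob_le:
  assumes "0 \<le> p" "p \<le> exp (- (real n * c))" "n > 0"
  shows "ereal (1 / real n) * log_prob p \<le> ereal (- c)"
proof (cases "p = 0")
  case True
  then show ?thesis using assms(3) by (simp add: log_prob_def)
next
  case False
  then have p: "p > 0" using assms(1) by simp
  have "ln p \<le> ln (exp (- (real n * c)))" using p assms(2) by (subst ln_le_cancel_iff) auto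
  then have "ln p \<le> - (real n * c)" by simp
  then have "1 / real n * ln p \<le> - c" using assms(3) by (simp add: field_simps)
  then show ?thesis using False by (simp add: log_prob_def)
qed

lemma scaled_log_prob_ge:
  assumes "exp (- (real n * c)) \<le> p" "n > 0"
  shows "ereal (- c) \<le> ereal (1 / real n) * log_prob p"
proof -
  have p: "p > 0" using assms(1) exp_gt_zero[of "- (real n * c)"] by linarith
  have "ln (exp (- (real n * c))) \<le> ln p" using p assms(1) by (subst ln_le_cancel_iff) auto
  then have "- (real n * c) \<le> ln p" by simp
  then have "- c \<le> 1 / real n * ln p" using assms(2) by (simp add: field_simps)
  then show ?thesis using p by (simp add: log_prob_def)
qed

lemma eventually_multiples:
  "eventually P (multiples k) \<longleftrightarrow> eventually (\<lambda>n. k dvd n \<longrightarrow> P n) sequentially"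
  by (simp add: multiples_def eventually_inf_principal)

lemma eventually_multiples_I:
  assumes "\<And>n. 0 < n \<Longrightarrow> k dvd n \<Longrightarrow> P n"
  shows "eventually P (multiples k)"
  unfolding eventually_multiples using eventually_gt_at_top[of 0]
  by eventually_elim (use assms in auto)

lemma multiples_nontrivial:
  assumes "k \<ge> 1"
  shows "multiples k \<noteq> bot"
proof
  assume "multiples k = bot"
  then have "eventually (\<lambda>_. False) (multiples k)" by simp
  then obtain N where N: "\<And>n. n \<ge> N \<Longrightarrow> \<not> k dvd n"
    unfolding eventually_multiples eventually_sequentially by blast
  have "N \<le> k * N" using assms by simp
  from N[OF this] show False by simp
qed

lemma filterlim_div_multiples:
  assumes "k \<ge> 1"
  shows "filterlim (\<lambda>n. n div k) at_top (multiples k)"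
  unfolding filterlim_at_top eventually_multiples
proof
  fix Z
  show "\<forall>\<^sub>F n in sequentially. k dvd n \<longrightarrow> Z \<le> n div k"
    using eventually_ge_at_top[of "Z * k"]
    by eventually_elim (use assms in \<open>simp add: less_eq_div_iff_mult_less_eq\<close>)
qed

context triangular_array
begin

lemma frequency_mono:
  assumes "U \<subseteq> V"
  shows "frequency n U \<le> frequency n V"
  unfolding frequency_def using assms finite_draws
  by (intro divide_right_mono) (auto intro!: card_mono)

lemma frequency_borel_probs:
  assumes "0 < n" "0 < m n"
  shows "frequency n (borel_probs X) = 1"
proof -
  have "{b \<in> draws n. empirical n b \<in> borel_probs X} = draws n"
    using empirical_borel_probs[OF assms(2)] by blast
  then show ?thesis using assms(1) by (simp add: frequency_def draws_def card_PiE)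
qed

end

theorem theorem2p5:
  fixes k s :: nat
    and x :: "nat \<Rightarrow> nat \<Rightarrow> 'a::polish_space"
    and \<mu> :: "(nat \<Rightarrow> 'a) measure"
    and M :: "nat \<Rightarrow> 'w measure"
    and W :: "nat \<Rightarrow> nat \<Rightarrow> 'w \<Rightarrow> real"
  assumes "k \<ge> 1"
    and "s = 0 \<or> s = k div 2"
    and "\<mu> \<in> borel_probs (power_topology k euclidean)"
    and "limitin (weak_topology (power_topology k euclidean))
           (\<lambda>n. tuple_empirical euclidean k n (x n)) \<mu> (multiples k)"
    and "\<And>n. n > 0 \<Longrightarrow> k dvd n \<Longrightarrow> prob_space (M n)"
    and "\<And>n i. n > 0 \<Longrightarrow> k dvd n \<Longrightarrow> i \<in> {1..n} \<Longrightarrow> W n i \<in> borel_measurable (M n)"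
    and "\<And>n. n > 0 \<Longrightarrow> k dvd n \<Longrightarrow>
           distr (M n) (Pi\<^sub>M {1..n} (\<lambda>_. borel)) (\<lambda>\<omega>. \<lambda>i\<in>{1..n}. 1 / real k * W n i \<omega>)
             = Mult n (n div k) (\<lambda>_. 1 / real n)"
  shows "satisfies_LDP (multiples k) (weak_topology euclidean)
           (\<lambda>n. distr (M n) (borel_of (weak_topology euclidean))
              (\<lambda>\<omega>. block_bootstrap euclidean k s n (x n) (\<lambda>i. W n i \<omega>)))
           (bootstrap_rate euclidean k \<mu>)
         \<and> good_rate_function (weak_topology euclidean) (bootstrap_rate euclidean k \<mu>)"
proof -
  note k = assms(1)
  let ?E = "power_topology k (euclidean :: 'a topology)"
  let ?T = "weak_topology (euclidean :: 'a topology)"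
  let ?F = "multiples k"
  interpret R: bootstrap_rate_setting k \<mu> using assms(1,3) by unfold_locales
  interpret A: triangular_array ?E \<mu> ?F "\<lambda>n. n div k" "\<lambda>n. shifted_tuple k s n (x n)"
  proof unfold_locales
    show "shifted_tuple k s n (x n) i \<in> topspace ?E" for n i by (rule shifted_tuple_in_topspace)
    show "\<forall>\<^sub>F n in ?F. n > 0" by (rule eventually_multiples_I)
    show "filterlim (\<lambda>n. n div k) at_top ?F" by (rule filterlim_div_multiples[OF k])
    fix f assume f: "bounded_continuous ?E f"
    show "((\<lambda>n. (\<Sum>i\<in>{1..n}. f (shifted_tuple k s n (x n) i)) / real n) \<longlongrightarrow> (\<integral>z. f z \<partial>\<mu>)) ?F"
    proof (rule tendstoI)
      fix e :: real assume "e > 0"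
      \<comment> \<open>The limit is given in the weak topology for tuples starting at i; this
        neighbourhood extracts the integral of f, and the rotation invariance of the sum brings in
        the shift s.\<close>
      let ?U = "{\<nu> \<in> borel_probs ?E. (\<integral>z. f z \<partial>\<nu>) \<in> ball (\<integral>z. f z \<partial>\<mu>) e}"
      have "openin (weak_topology ?E) ?U" by (rule weak_topology_basis[OF f open_ball])
      moreover have "\<mu> \<in> ?U" using assms(3) \<open>e > 0\<close> by simp
      ultimately have "\<forall>\<^sub>F n in ?F. tuple_empirical euclidean k n (x n) \<in> ?U"
        using assms(4) unfolding limitin_def by blast
      moreover have "\<forall>\<^sub>F n in ?F. n > 0" by (rule eventually_multiples_I)
      ultimately show "\<forall>\<^sub>F n in ?F. dist ((\<Sum>i\<in>{1..n}. f (shifted_tuple k s n (x n) i)) / real n) (\<integral>z. f z \<partial>\<mu>) < e"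
      proof eventually_elim
        case (elim n)
        then show ?case
          using integral_tuple_empirical[OF elim(2) f, of "x n" s] by (simp add: dist_commute)
      qed
    qed
  qed
  define P where "P n = distr (M n) (borel_of ?T) (\<lambda>\<omega>. block_bootstrap euclidean k s n (x n) (\<lambda>i. W n i \<omega>))" for n
  \<comment> \<open>Events for the bootstrapped measure are pulled back to events for the empirical
    measure of tuples.\<close>
  define pre where "pre U = {\<nu> \<in> borel_probs ?E. mean_marginal euclidean k \<nu> \<in> U}" for U
  have m_pos: "0 < n div k" if "0 < n" "k dvd n" for n
    using that k by (simp add: div_greater_zero_iff dvd_imp_le)
  have law: "emeasure (P n) B = ennreal (A.frequency n (pre B))"
    if n: "0 < n" "k dvd n" and B: "B \<in> sets (borel_of ?T)" for n B
  proof -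
    have "{b \<in> A.draws n. mean_marginal euclidean k (A.empirical n b) \<in> B} = {b \<in> A.draws n. A.empirical n b \<in> pre B}"
      using A.empirical_borel_probs[OF m_pos[OF n]] by (auto simp: pre_def)
    then show ?thesis
      using emeasure_law_block_bootstrap[OF n k assms(6)[OF n] assms(7)[OF n] B, of s "x n"]
      unfolding P_def A.frequency_def A.draws_def A.empirical_def by simp
  qed
  have freq0: "0 \<le> A.frequency n U" for n U by (simp add: A.frequency_def)
  have law': "measure (P n) B = A.frequency n (pre B)"
    if "0 < n" "k dvd n" "B \<in> sets (borel_of ?T)" for n B
    using law[OF that] freq0 by (simp add: measure_def)
  have G: "mean_marginal euclidean k \<nu> \<in> borel_probs euclidean" if "\<nu> \<in> borel_probs ?E" for \<nu>
    by (rule mean_marginal_borel_probs[OF that k])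
  \<comment> \<open>Conversion between the two speeds: exponent k c per draw is exponent c per
    index.\<close>
  have mk: "real (n div k) * (real k * c) = real n * c" if "k dvd n" for n c
    using that k by (simp add: real_of_nat_div)
  have P: "\<forall>\<^sub>F n in ?F. P n \<in> borel_probs ?T"
  proof (rule eventually_multiples_I)
    fix n assume n: "0 < n" "k dvd n"
    have "pre (topspace ?T) = borel_probs ?E" using G by (auto simp: pre_def topspace_weak_topology)
    then have "emeasure (P n) (space (P n)) = 1"
      using law[OF n sets.top[of "borel_of ?T"]] A.frequency_borel_probs[OF n(1) m_pos[OF n]]
      by (simp add: P_def)
    then show "P n \<in> borel_probs ?T" by (auto simp: borel_probs_def P_def intro: prob_spaceI)
  qed
  have "- (INF y\<in>?T interior_of B. bootstrap_rate euclidean k \<mu> y)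
      \<le> Liminf ?F (\<lambda>n. ereal (1 / real n) * log_prob (measure (P n) B)) \<and>
    Limsup ?F (\<lambda>n. ereal (1 / real n) * log_prob (measure (P n) B))
      \<le> - (INF y\<in>?T closure_of B. bootstrap_rate euclidean k \<mu> y)"
    if B: "B \<in> sets (borel_of ?T)" for B
  proof
    let ?a = "\<lambda>n. ereal (1 / real n) * log_prob (measure (P n) B)"
    \<comment> \<open>It suffices to bound by the scaled entropy of every \<nu> in the fibre over y.
      The preimage of the interior is a weak neighbourhood of \<nu>, so the lower bound for tuples
      applies.\<close>
    have "- Liminf ?F ?a \<le> bootstrap_rate euclidean k \<mu> y" if y: "y \<in> ?T interior_of B" for y
      unfolding bootstrap_rate_alt
    proof (rule Inf_greatest)
      fix z assume "z \<in> {ereal (1 / real k) * rel_entropy \<nu> \<mu> | \<nu>.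
        \<nu> \<in> borel_probs ?E \<and> mean_marginal euclidean k \<nu> = y}"
      then obtain \<nu> where \<nu>: "\<nu> \<in> borel_probs ?E" "mean_marginal euclidean k \<nu> = y"
        and z: "z = ereal (1 / real k) * rel_entropy \<nu> \<mu>" by blast
      show "- Liminf ?F ?a \<le> z"
      proof (cases "rel_entropy \<nu> \<mu>")
        case (real h)
        have ball: "\<nu> \<in> R.entropy_ball h" using \<nu> real by (simp add: R.entropy_ball_def)
        have open_pre: "openin (weak_topology ?E) (pre (?T interior_of B))"
          using openin_continuous_map_preimage[OF continuous_map_mean_marginal[OF k] openin_interior_of]
          unfolding pre_def topspace_weak_topology by blast
        have mem: "\<nu> \<in> pre (?T interior_of B)" using \<nu> y by (simp add: pre_def)
        have "- Liminf ?F ?a \<le> ereal (h / real k)"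
        proof (rule ereal_le_epsilon2)
          fix e :: real assume "0 < e"
          then have ke: "0 < real k * e" using k by simp
          have "\<forall>\<^sub>F n in ?F. ereal (- (h / real k + e)) \<le> ?a n"
            using A.frequency_lower_bound[OF open_pre mem ball ke]
              eventually_multiples_I[of k "\<lambda>n. 0 < n \<and> k dvd n", simplified]
          proof eventually_elim
            case (elim n)
            have "real k * (h / real k + e) = h + real k * e" using k by (simp add: distrib_left)
            then have "real n * (h / real k + e) = real (n div k) * (h + real k * e)"
              using mk[of n "h / real k + e"] elim(2) by simp
            then have "exp (- (real n * (h / real k + e))) \<le> A.frequency n (pre (?T interior_of B))"
              using elim(1) by (simp only: mult_minus_left)
            also have "\<dots> \<le> A.frequency n (pre B)"
              by (rule A.frequency_mono) (use interior_of_subset[of ?T B] in \<open>unfold pre_def, blast\<close>)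
            also have "\<dots> = measure (P n) B" using law'[OF _ _ B] elim(2) by simp
            finally show ?case by (rule scaled_log_prob_ge) (use elim in simp)
          qed
          then have "ereal (- (h / real k + e)) \<le> Liminf ?F ?a" by (rule Liminf_bounded)
          then have "- Liminf ?F ?a \<le> - ereal (- (h / real k + e))" by (simp only: ereal_minus_le_minus)
          then show "- Liminf ?F ?a \<le> ereal (h / real k) + ereal e" by (simp add: add.commute)
        qed
        then show ?thesis using z real by simp
      next
        case PInf
        then show ?thesis using z k by simp
      next
        case MInf
        then show ?thesis using R.rel_entropy_nonneg[OF \<nu>(1)] by simp
      qed
    qed
    then have "- Liminf ?F ?a \<le> (INF y\<in>?T interior_of B. bootstrap_rate euclidean k \<mu> y)"
      by (rule INF_greatest)
    then show "- (INF y\<in>?T interior_of B. bootstrap_rate euclidean k \<mu> y) \<le> Liminf ?F ?a"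
      by (simp only: ereal_uminus_le_reorder)
    let ?J = "INF y\<in>?T closure_of B. bootstrap_rate euclidean k \<mu> y"
    have BT: "B \<subseteq> topspace ?T" using sets.sets_into_space[OF B] by simp
    \<comment> \<open>The infimum may be infinite, so it is approached from below by numbers
      c.\<close>
    have "?J \<le> - Limsup ?F ?a"
    proof (rule dense_le)
      fix c assume c: "c < ?J"
      show "c \<le> - Limsup ?F ?a"
      proof (cases c)
        case (real r)
        \<comment> \<open>Two levels are needed: the preimage of the closure misses the entropy ball
          at level k c', and the counting estimate then holds at the strictly smaller level k
          r.\<close>
        obtain c' where c': "ereal r < ereal c'" "ereal c' < ?J" using ereal_dense2[OF c] real by blast
        have closed_pre: "closedin (weak_topology ?E) (pre (?T closure_of B))"
          using closedin_continuous_map_preimage[OF continuous_map_mean_marginal[OF k] closedin_closure_of]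
          unfolding pre_def topspace_weak_topology by blast
        have "pre (?T closure_of B) \<inter> R.entropy_ball (real k * c') = {}"
        proof (rule ccontr)
          assume "pre (?T closure_of B) \<inter> R.entropy_ball (real k * c') \<noteq> {}"
          then obtain \<nu> where \<nu>: "\<nu> \<in> pre (?T closure_of B)" "\<nu> \<in> R.entropy_ball (real k * c')" by blast
          have "?J \<le> bootstrap_rate euclidean k \<mu> (mean_marginal euclidean k \<nu>)"
            by (rule INF_lower) (use \<nu>(1) in \<open>simp add: pre_def\<close>)
          also have "\<dots> \<le> ereal (real k * c' / real k)" by (rule R.rate_le[OF \<nu>(2)])
          also have "\<dots> = ereal c'" using k by simp
          finally show False using c'(2) by simp
        qed
        moreover have "real k * r < real k * c'" using c'(1) k by simp
        ultimately have ev: "\<forall>\<^sub>F n in ?F. A.frequency n (pre (?T closure_of B)) \<le> exp (- real (n div k) * (real k * r))"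
          by (rule A.frequency_upper_bound[OF closed_pre])
        have "\<forall>\<^sub>F n in ?F. ?a n \<le> ereal (- r)"
          using ev eventually_multiples_I[of k "\<lambda>n. 0 < n \<and> k dvd n", simplified]
        proof eventually_elim
          case (elim n)
          have "measure (P n) B = A.frequency n (pre B)" using law'[OF _ _ B] elim(2) by simp
          also have "\<dots> \<le> A.frequency n (pre (?T closure_of B))"
            by (rule A.frequency_mono) (use closure_of_subset[OF BT] in \<open>auto simp: pre_def\<close>)
          also have "\<dots> \<le> exp (- (real n * r))" using elim mk[of n r] by simp
          finally show ?case by (intro scaled_log_prob_le) (use elim in auto)
        qed
        then have "Limsup ?F ?a \<le> ereal (- r)" by (rule Limsup_bounded)
        then have "- ereal (- r) \<le> - Limsup ?F ?a" by (simp only: ereal_minus_le_minus)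
        then show ?thesis using real by simp
      qed (use c in auto)
    qed
    then have "- (- Limsup ?F ?a) \<le> - ?J" by (simp only: ereal_minus_le_minus)
    then show "Limsup ?F ?a \<le> - ?J" by simp
  qed
  moreover have "Liminf ?F f \<le> Limsup ?F f" for f :: "nat \<Rightarrow> ereal"
    by (rule Liminf_le_Limsup[OF multiples_nontrivial[OF k]])
  ultimately have "satisfies_LDP ?F ?T P (bootstrap_rate euclidean k \<mu>)"
    using P R.good_rate_function_bootstrap_rate
    unfolding satisfies_LDP_def good_rate_function_def by blast
  then show ?thesis
    using R.good_rate_function_bootstrap_rate unfolding P_def by blast
qed

end
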